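(* Let $p,q$ be distinct primes, and let $\mathcal{U}_1\in\mathcal{O}_{C_p}[\mathrm{DGA}]$ and $\mathcal{U}_2\in\mathcal{O}_{C_q}[\mathrm{DGA}]$ be injective diagrams of DGAs (i.e. injective as objects of $Vec^*_{C_p}$ and $Vec^*_{C_q}$ respectively). Then the wedge product $\mathcal{U}_1\vee\mathcal{U}_2$, a diagram of DGAs over $\mathcal{O}_{C_{pq}}$, is injective as an object of $Vec^*_{C_{pq}}$.
   Context: All DGAs are commutative differential graded algebras over $\mathbb{Q}$. Orbit category: for a finite group $G$, $\mathcal{O}_G$ has objects the $G$-sets $G/H$ ($H\le G$) and morphisms the $G$-maps. $\mathcal{O}_G[\mathrm{DGA}]$ is the category of diagrams of DGAs, i.e. covariant functors from $\mathcal{O}_G$ to cohomologically $1$-connected DGAs ($H^0=\mathbb{Q}$, $H^1=0$). $Vec^*_G$ is the category of covariant functors from $\mathcal{O}_G$ to graded $\mathbb{Q}$-vector spaces. A diagram of DGAs is regarded as an object of $Vec^*_G$ by forgetting differential and multiplication. An object $I$ of a category is injective if for every injective morphism $f:X\to Y$ (for $Vec^*_G$: injective at every $G/H$) and every morphism $g:X\to I$ there is $h:Y\to I$ with $h\circ f=g$. Wedge of DGAs: DGAs occurring in wedges are augmented, $A=\mathbb{Q}\cdot 1_A\oplus\bar A$ with $\bar A$ the augmentation ideal (equal to $A^{>0}$ when $A^0=\mathbb{Q}$), and morphisms preserve augmentations. $A\vee B:=(A\oplus B)/\langle 1_A-1_B\rangle\cong\mathbb{Q}\oplus\bar A\oplus\bar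 B$, with unit $1=1_A=1_B$, multiplication given by those of $A$ and $B$ together with $\bar A\cdot\bar B=0$, and differential $d(a+b)=d_Aa+d_Bb$. For morphisms $f:A\to A'$, $g:B\to B'$, $f\vee g:A\vee B\to A'\vee B'$ is $[a+b]\mapsto[f(a)+g(b)]$. Wedge of diagrams: let $G=C_{pq}\cong C_p\times C_q$ with subgroups $e,P,Q,G$ of orders $1,p,q,pq$. Then $(\mathcal{U}_1\vee\mathcal{U}_2)(G/e)=\mathcal{U}_1(C_p/e)\vee\mathcal{U}_2(C_q/e)$, $(\mathcal{U}_1\vee\mathcal{U}_2)(G/P)=\mathcal{U}_1(C_p/C_p)\vee\mathcal{U}_2(C_q/e)$, $(\mathcal{U}_1\vee\mathcal{U}_2)(G/Q)=\mathcal{U}_1(C_p/e)\vee\mathcal{U}_2(C_q/C_q)$, $(\mathcal{U}_1\vee\mathcal{U}_2)(G/G)=\mathcal{U}_1(C_p/C_p)\vee\mathcal{U}_2(C_q/C_q)$, with structure maps induced by those of $\mathcal{U}_1$ and $\mathcal{U}_2$: with $\mathcal{U}_1^{e,C_p}:\mathcal{U}_1(C_p/e)\to\mathcal{U}_1(C_p/C_p)$ and $\mathcal{U}_2^{e,C_q}:\mathcal{U}_2(C_q/e)\to\mathcal{U}_2(C_q/C_q)$, the maps $G/e\to G/P$ and $G/Q\to G/G$ induce $\mathcal{U}_1^{e,C_p}\vee\mathrm{id}$, the maps $G/e\to G/Q$ and $G/P\to G/G$ induce $\mathrm{id}\vee\mathcal{U}_2^{e,C_q}$, and automorphisms of orbits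 act through $\mathcal{U}_1$ and $\mathcal{U}_2$ via $G\cong C_p\times C_q$. *)

theory Defs
  imports
    Complex_Main
    "HOL-Algebra.Module"
    "HOL-Algebra.AbelCoset"
    "HOL-Algebra.Left_Coset"
    "HOL-Algebra.Elementary_Groups"
    "HOL-Algebra.Multiplicative_Group"
    "HOL-Computational_Algebra.Primes"
begin

section \<open>Rational vector spaces\<close>

definition rat_field :: "rat ring" where
  "rat_field = \<lparr>carrier = UNIV, monoid.mult = (*), one = 1, zero = 0, add = (+)\<rparr>"

text \<open>A rational vector space is a module over \<^const>\<open>rat_field\<close>. The record type of modules extends
  that of rings, so a vector space also carries fields \<^const>\<open>monoid.mult\<close> and \<^const>\<open>one\<close>; no definition
  below looks at them.\<close>

type_synonym 'v rat_space = "(rat, 'v) module"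

definition rat_linear :: "'v rat_space \<Rightarrow> 'w rat_space \<Rightarrow> ('v \<Rightarrow> 'w) set" where
  "rat_linear M N =
    {f \<in> carrier M \<rightarrow> carrier N.
      (\<forall>x\<in>carrier M. \<forall>y\<in>carrier M. f (x \<oplus>\<^bsub>M\<^esub> y) = f x \<oplus>\<^bsub>N\<^esub> f y) \<and>
      (\<forall>c. \<forall>x\<in>carrier M. f (c \<odot>\<^bsub>M\<^esub> x) = c \<odot>\<^bsub>N\<^esub> f x)}"

definition direct_sum :: "'v rat_space \<Rightarrow> 'w rat_space \<Rightarrow> ('v \<times> 'w) rat_space" where
  "direct_sum M N =
    \<lparr>carrier = carrier M \<times> carrier N, monoid.mult = undefined, one = undefined,
     zero = (\<zero>\<^bsub>M\<^esub>, \<zero>\<^bsub>N\<^esub>),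
     add = (\<lambda>x y. (fst x \<oplus>\<^bsub>M\<^esub> fst y, snd x \<oplus>\<^bsub>N\<^esub> snd y)),
     smult = (\<lambda>c x. (c \<odot>\<^bsub>M\<^esub> fst x, c \<odot>\<^bsub>N\<^esub> snd x))\<rparr>"

text \<open>The elements of the quotient by a subspace \<open>W\<close> are the cosets of \<open>W\<close>. Summing with \<open>W\<close> in the
  scalar multiplication only matters for the scalar \<open>0\<close>, where \<open>0 \<cdot> S\<close> is \<open>{0}\<close> instead of \<open>W\<close>.\<close>

definition quotient_space :: "'v rat_space \<Rightarrow> 'v set \<Rightarrow> 'v set rat_space" where
  "quotient_space M W =
    \<lparr>carrier = a_rcosets\<^bsub>M\<^esub> W, monoid.mult = undefined, one = undefined,
     zero = W,
     add = (\<lambda>S T. S <+>\<^bsub>M\<^esub> T),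
     smult = (\<lambda>c S. W <+>\<^bsub>M\<^esub> ((\<lambda>x. c \<odot>\<^bsub>M\<^esub> x) ` S))\<rparr>"

section \<open>The orbit category\<close>

text \<open>The subgroup \<open>H\<close> stands for the object \<open>G/H\<close>, whose underlying set is the set
  \<open>lcosets H\<close> of left cosets, with \<open>G\<close> acting by left translation. Morphisms are the equivariant maps,
  made extensional so that each of them is a single function.\<close>

definition orbit_hom :: "('g, 'm) monoid_scheme \<Rightarrow> 'g set \<Rightarrow> 'g set \<Rightarrow> ('g set \<Rightarrow> 'g set) set" where
  "orbit_hom G H K =
    {\<phi> \<in> (lcosets\<^bsub>G\<^esub> H) \<rightarrow>\<^sub>E (lcosets\<^bsub>G\<^esub> K).
      \<forall>g\<in>carrier G. \<forall>S\<in>lcosets\<^bsub>G\<^esub> H. \<phi> (g <#\<^bsub>G\<^esub> S) = g <#\<^bsub>G\<^esub> \<phi> S}"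

text \<open>The data of a covariant functor from the orbit category to a category whose objects have type
  \<open>'o\<close> and whose morphisms are families of maps indexed by the degree. \<open>mor D H K \<phi> n\<close> is the
  component in degree \<open>n\<close> of the map induced by \<open>\<phi> : G/H \<rightarrow> G/K\<close>.\<close>

record ('g, 'o, 'v) diagram =
  ob :: "'g set \<Rightarrow> 'o"
  mor :: "'g set \<Rightarrow> 'g set \<Rightarrow> ('g set \<Rightarrow> 'g set) \<Rightarrow> nat \<Rightarrow> 'v \<Rightarrow> 'v"

section \<open>Diagrams of graded rational vector spaces\<close>

type_synonym 'v graded_space = "nat \<Rightarrow> 'v rat_space"

definition vec_diagram ::
  "('g, 'm) monoid_scheme \<Rightarrow> ('g, 'v graded_space, 'v) diagram \<Rightarrow> bool" where
  "vec_diagram G V \<longleftrightarrow>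
    (\<forall>H n. subgroup H G \<longrightarrow> module rat_field (ob V H n)) \<and>
    (\<forall>H K \<phi> n. subgroup H G \<longrightarrow> subgroup K G \<longrightarrow> \<phi> \<in> orbit_hom G H K \<longrightarrow>
       mor V H K \<phi> n \<in> rat_linear (ob V H n) (ob V K n)) \<and>
    (\<forall>H n. subgroup H G \<longrightarrow>
       (\<forall>x\<in>carrier (ob V H n). mor V H H (\<lambda>S\<in>lcosets\<^bsub>G\<^esub> H. S) n x = x)) \<and>
    (\<forall>H K L \<phi> \<psi> n. subgroup H G \<longrightarrow> subgroup K G \<longrightarrow> subgroup L G \<longrightarrow>
       \<phi> \<in> orbit_hom G H K \<longrightarrow> \<psi> \<in> orbit_hom G K L \<longrightarrow>
       (\<forall>x\<in>carrier (ob V H n).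
          mor V H L (compose (lcosets\<^bsub>G\<^esub> H) \<psi> \<phi>) n x = mor V K L \<psi> n (mor V H K \<phi> n x)))"

definition vec_hom ::
  "('g, 'm) monoid_scheme \<Rightarrow> ('g, 'v graded_space, 'v) diagram \<Rightarrow>
   ('g, 'w graded_space, 'w) diagram \<Rightarrow> ('g set \<Rightarrow> nat \<Rightarrow> 'v \<Rightarrow> 'w) set" where
  "vec_hom G X Y =
    {f. (\<forall>H n. subgroup H G \<longrightarrow> f H n \<in> rat_linear (ob X H n) (ob Y H n)) \<and>
        (\<forall>H K \<phi> n. subgroup H G \<longrightarrow> subgroup K G \<longrightarrow> \<phi> \<in> orbit_hom G H K \<longrightarrow>
           (\<forall>x\<in>carrier (ob X H n). f K n (mor X H K \<phi> n x) = mor Y H K \<phi> n (f H n x)))}"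

text \<open>HOL cannot quantify over types inside a formula, so injectivity is relative to the type \<open>'x\<close>
  from which the elements of the test objects \<open>X\<close> and \<open>Y\<close> are taken. Two different types for \<open>X\<close> and
  \<open>Y\<close> would give nothing new, as both embed into a sum type. The absolute notion is the
  one where this holds for all types \<open>'x\<close>. If \<open>'x\<close> is finite, the only test objects are zero
  and every diagram is injective relative to \<open>'x\<close>.\<close>

definition vec_injective ::
  "'x itself \<Rightarrow> ('g, 'm) monoid_scheme \<Rightarrow> ('g, 'v graded_space, 'v) diagram \<Rightarrow> bool" where
  "vec_injective _ G I \<longleftrightarrow>
    vec_diagram G I \<and>
    (\<forall>(X :: ('g, 'x graded_space, 'x) diagram) (Y :: ('g, 'x graded_space, 'x) diagram) f g.
       vec_diagram G X \<longrightarrow> vec_diagram G Y \<longrightarrow>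
       f \<in> vec_hom G X Y \<longrightarrow> (\<forall>H n. subgroup H G \<longrightarrow> inj_on (f H n) (carrier (ob X H n))) \<longrightarrow>
       g \<in> vec_hom G X I \<longrightarrow>
       (\<exists>h \<in> vec_hom G Y I. \<forall>H n. subgroup H G \<longrightarrow>
          (\<forall>x\<in>carrier (ob X H n). h H n (f H n x) = g H n x)))"

section \<open>Commutative differential graded algebras\<close>

record 'a dga =
  gr :: "'a graded_space"
  mul :: "nat \<Rightarrow> nat \<Rightarrow> 'a \<Rightarrow> 'a \<Rightarrow> 'a"
  unit :: 'a
  diff :: "nat \<Rightarrow> 'a \<Rightarrow> 'a"

text \<open>\<open>mul A m n\<close> is the product \<open>A\<^sup>m \<times> A\<^sup>n \<rightarrow> A\<^bsup>m+n\<^esup>\<close> and \<open>diff A n\<close> the differential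
  \<open>A\<^sup>n \<rightarrow> A\<^bsup>n+1\<^esup>\<close>.\<close>

locale dga =
  fixes A :: "('a, 'z) dga_scheme"
  assumes gr_module: "module rat_field (gr A n)"
    and mul_linear_left:
      "y \<in> carrier (gr A n) \<Longrightarrow> (\<lambda>x. mul A m n x y) \<in> rat_linear (gr A m) (gr A (m + n))"
    and mul_linear_right:
      "x \<in> carrier (gr A m) \<Longrightarrow> (\<lambda>y. mul A m n x y) \<in> rat_linear (gr A n) (gr A (m + n))"
    and mul_assoc:
      "x \<in> carrier (gr A l) \<Longrightarrow> y \<in> carrier (gr A m) \<Longrightarrow> z \<in> carrier (gr A n) \<Longrightarrow>
       mul A (l + m) n (mul A l m x y) z = mul A l (m + n) x (mul A m n y z)"
    and mul_comm:
      "x \<in> carrier (gr A m) \<Longrightarrow> y \<in> carrier (gr A n) \<Longrightarrow>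
       mul A m n x y = (- 1) ^ (m * n) \<odot>\<^bsub>gr A (m + n)\<^esub> mul A n m y x"
    and unit_closed: "unit A \<in> carrier (gr A 0)"
    and mul_unit: "x \<in> carrier (gr A n) \<Longrightarrow> mul A 0 n (unit A) x = x"
    and diff_linear: "diff A n \<in> rat_linear (gr A n) (gr A (Suc n))"
    and diff_diff: "x \<in> carrier (gr A n) \<Longrightarrow> diff A (Suc n) (diff A n x) = \<zero>\<^bsub>gr A (Suc (Suc n))\<^esub>"
    and diff_mul:
      "x \<in> carrier (gr A m) \<Longrightarrow> y \<in> carrier (gr A n) \<Longrightarrow>
       diff A (m + n) (mul A m n x y) =
         mul A (Suc m) n (diff A m x) y \<oplus>\<^bsub>gr A (Suc (m + n))\<^esub>
         (- 1) ^ m \<odot>\<^bsub>gr A (Suc (m + n))\<^esub> mul A m (Suc n) x (diff A n y)"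

definition cocycles :: "('a, 'z) dga_scheme \<Rightarrow> nat \<Rightarrow> 'a set" where
  "cocycles A n = {x \<in> carrier (gr A n). diff A n x = \<zero>\<^bsub>gr A (Suc n)\<^esub>}"

text \<open>As \<open>H\<^sup>0(A) = Z\<^sup>0(A)\<close>, the first conjunct says that the unit map \<open>\<rat> \<rightarrow> H\<^sup>0(A)\<close> is bijective;
  the second one says \<open>Z\<^sup>1(A) = B\<^sup>1(A)\<close>.\<close>

definition cohomologically_1_connected :: "('a, 'z) dga_scheme \<Rightarrow> bool" where
  "cohomologically_1_connected A \<longleftrightarrow>
    bij_betw (\<lambda>c. c \<odot>\<^bsub>gr A 0\<^esub> unit A) UNIV (cocycles A 0) \<and>
    cocycles A 1 = diff A 0 ` carrier (gr A 0)"

definition dga_hom ::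
  "('a, 'z) dga_scheme \<Rightarrow> ('b, 'y) dga_scheme \<Rightarrow> (nat \<Rightarrow> 'a \<Rightarrow> 'b) set" where
  "dga_hom A B =
    {f. (\<forall>n. f n \<in> rat_linear (gr A n) (gr B n)) \<and>
        (\<forall>m n. \<forall>x\<in>carrier (gr A m). \<forall>y\<in>carrier (gr A n).
           f (m + n) (mul A m n x y) = mul B m n (f m x) (f n y)) \<and>
        f 0 (unit A) = unit B \<and>
        (\<forall>n. \<forall>x\<in>carrier (gr A n). f (Suc n) (diff A n x) = diff B n (f n x))}"

text \<open>An augmentation is a morphism to \<open>\<rat>\<close> (in degree \<open>0\<close>, zero differential), so only its component in
  degree \<open>0\<close> is recorded; compatibility with the differential is automatic. The augmentation ideal
  consists of the kernel of \<open>aug\<close> in degree \<open>0\<close> and of everything in positive degrees.\<close>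

record 'a aug_dga = "'a dga" +
  aug :: "'a \<Rightarrow> rat"

locale aug_dga = dga A for A :: "('a, 'z) aug_dga_scheme" +
  assumes aug_add:
      "x \<in> carrier (gr A 0) \<Longrightarrow> y \<in> carrier (gr A 0) \<Longrightarrow> aug A (x \<oplus>\<^bsub>gr A 0\<^esub> y) = aug A x + aug A y"
    and aug_smult: "x \<in> carrier (gr A 0) \<Longrightarrow> aug A (c \<odot>\<^bsub>gr A 0\<^esub> x) = c * aug A x"
    and aug_mul:
      "x \<in> carrier (gr A 0) \<Longrightarrow> y \<in> carrier (gr A 0) \<Longrightarrow> aug A (mul A 0 0 x y) = aug A x * aug A y"
    and aug_unit: "aug A (unit A) = 1"

section \<open>Diagrams of DGAs\<close>

definition underlying ::
  "('g, ('a, 'z) dga_scheme, 'a) diagram \<Rightarrow> ('g, 'a graded_space, 'a) diagram" where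
  "underlying U = \<lparr>ob = (\<lambda>H. gr (ob U H)), mor = mor U\<rparr>"

definition dga_diagram ::
  "('g, 'm) monoid_scheme \<Rightarrow> ('g, ('a, 'z) dga_scheme, 'a) diagram \<Rightarrow> bool" where
  "dga_diagram G U \<longleftrightarrow>
    vec_diagram G (underlying U) \<and>
    (\<forall>H. subgroup H G \<longrightarrow> dga (ob U H) \<and> cohomologically_1_connected (ob U H)) \<and>
    (\<forall>H K \<phi>. subgroup H G \<longrightarrow> subgroup K G \<longrightarrow> \<phi> \<in> orbit_hom G H K \<longrightarrow>
       mor U H K \<phi> \<in> dga_hom (ob U H) (ob U K))"

definition aug_dga_diagram ::
  "('g, 'm) monoid_scheme \<Rightarrow> ('g, ('a, 'z) aug_dga_scheme, 'a) diagram \<Rightarrow> bool" where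
  "aug_dga_diagram G U \<longleftrightarrow>
    dga_diagram G U \<and>
    (\<forall>H. subgroup H G \<longrightarrow> aug_dga (ob U H)) \<and>
    (\<forall>H K \<phi>. subgroup H G \<longrightarrow> subgroup K G \<longrightarrow> \<phi> \<in> orbit_hom G H K \<longrightarrow>
       (\<forall>x\<in>carrier (gr (ob U H) 0). aug (ob U K) (mor U H K \<phi> 0 x) = aug (ob U H) x))"

section \<open>The wedge of two augmented DGAs\<close>

text \<open>\<open>\<langle>1\<^sub>A - 1\<^sub>B\<rangle>\<close> is the linear span, which lives in degree \<open>0\<close>.\<close>

definition wedge_rel :: "'a aug_dga \<Rightarrow> 'b aug_dga \<Rightarrow> nat \<Rightarrow> ('a \<times> 'b) set" where
  "wedge_rel A B n =
    (if n = 0 then range (\<lambda>c. (c \<odot>\<^bsub>gr A 0\<^esub> unit A, (- c) \<odot>\<^bsub>gr B 0\<^esub> unit B))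
     else {(\<zero>\<^bsub>gr A n\<^esub>, \<zero>\<^bsub>gr B n\<^esub>)})"

text \<open>The two projections \<open>A \<or> B \<rightarrow> A\<close> and \<open>A \<or> B \<rightarrow> B\<close> which collapse the other augmentation ideal, and
  the scalar component of an element of \<open>A \<or> B\<close>, all evaluated on a representative \<open>(a, b)\<close> of degree \<open>n\<close>.\<close>

definition collapse_right :: "'a aug_dga \<Rightarrow> 'b aug_dga \<Rightarrow> nat \<Rightarrow> 'a \<times> 'b \<Rightarrow> 'a" where
  "collapse_right A B n x =
    (if n = 0 then fst x \<oplus>\<^bsub>gr A 0\<^esub> aug B (snd x) \<odot>\<^bsub>gr A 0\<^esub> unit A else fst x)"

definition collapse_left :: "'a aug_dga \<Rightarrow> 'b aug_dga \<Rightarrow> nat \<Rightarrow> 'a \<times> 'b \<Rightarrow> 'b" where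
  "collapse_left A B n x =
    (if n = 0 then snd x \<oplus>\<^bsub>gr B 0\<^esub> aug A (fst x) \<odot>\<^bsub>gr B 0\<^esub> unit B else snd x)"

definition wedge_aug :: "'a aug_dga \<Rightarrow> 'b aug_dga \<Rightarrow> nat \<Rightarrow> 'a \<times> 'b \<Rightarrow> rat" where
  "wedge_aug A B n x = (if n = 0 then aug A (fst x) + aug B (snd x) else 0)"

text \<open>Write \<open>x = r \<cdot> 1 + a + b\<close> and \<open>y = s \<cdot> 1 + a' + b'\<close> with \<open>a, a'\<close> and \<open>b, b'\<close> in the augmentation ideals
  of \<open>A\<close> and \<open>B\<close>. As products of elements of the two ideals vanish,
  \<open>x y = r s \<cdot> 1 + (r a' + s a + a a') + (r b' + s b + b b')
       = (r \<cdot> 1\<^sub>A + a) (s \<cdot> 1\<^sub>A + a') + (r \<cdot> 1\<^sub>B + b) (s \<cdot> 1\<^sub>B + b') - r s \<cdot> 1\<close>.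
  The last term occurs only if both degrees are \<open>0\<close>.\<close>

definition wedge_mul_rep ::
  "'a aug_dga \<Rightarrow> 'b aug_dga \<Rightarrow> nat \<Rightarrow> nat \<Rightarrow> 'a \<times> 'b \<Rightarrow> 'a \<times> 'b \<Rightarrow> 'a \<times> 'b" where
  "wedge_mul_rep A B m n x y =
    (let a = mul A m n (collapse_right A B m x) (collapse_right A B n y);
         b = mul B m n (collapse_left A B m x) (collapse_left A B n y)
     in if m = 0 \<and> n = 0
        then (a, b \<oplus>\<^bsub>gr B 0\<^esub> (- (wedge_aug A B 0 x * wedge_aug A B 0 y)) \<odot>\<^bsub>gr B 0\<^esub> unit B)
        else (a, b))"

text \<open>All operations on cosets are those induced by operations on representatives.\<close>

definition wedge :: "'a aug_dga \<Rightarrow> 'b aug_dga \<Rightarrow> ('a \<times> 'b) set dga" where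
  "wedge A B =
    \<lparr>gr = (\<lambda>n. quotient_space (direct_sum (gr A n) (gr B n)) (wedge_rel A B n)),
     mul = (\<lambda>m n S T. wedge_rel A B (m + n) <+>\<^bsub>direct_sum (gr A (m + n)) (gr B (m + n))\<^esub>
              {wedge_mul_rep A B m n x y | x y. x \<in> S \<and> y \<in> T}),
     unit = wedge_rel A B 0 +>\<^bsub>direct_sum (gr A 0) (gr B 0)\<^esub> (unit A, \<zero>\<^bsub>gr B 0\<^esub>),
     diff = (\<lambda>n S. wedge_rel A B (Suc n) <+>\<^bsub>direct_sum (gr A (Suc n)) (gr B (Suc n))\<^esub>
              map_prod (diff A n) (diff B n) ` S)\<rparr>"

text \<open>The map \<open>f \<or> g\<close> into \<open>A' \<or> B'\<close>.\<close>

definition wedge_map ::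
  "'a aug_dga \<Rightarrow> 'b aug_dga \<Rightarrow> (nat \<Rightarrow> 'a \<Rightarrow> 'a) \<Rightarrow> (nat \<Rightarrow> 'b \<Rightarrow> 'b) \<Rightarrow>
   nat \<Rightarrow> ('a \<times> 'b) set \<Rightarrow> ('a \<times> 'b) set" where
  "wedge_map A' B' f g n S =
    wedge_rel A' B' n <+>\<^bsub>direct_sum (gr A' n) (gr B' n)\<^esub> map_prod (f n) (g n) ` S"

section \<open>The wedge of two diagrams\<close>

text \<open>Let \<open>\<pi>\<close> be a homomorphism from \<open>G\<close> onto an abelian group \<open>C\<close>. The morphism \<open>\<phi> : G/H \<rightarrow> G/K\<close> is
  \<open>g H \<mapsto> g \<phi>(H)\<close>, and its component \<open>C/\<pi>(H) \<rightarrow> C/\<pi>(K)\<close> is \<open>c \<pi>(H) \<mapsto> c \<pi>(\<phi>(H))\<close>.\<close>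

definition orbit_component ::
  "('c, 'n) monoid_scheme \<Rightarrow> ('g \<Rightarrow> 'c) \<Rightarrow> 'g set \<Rightarrow> ('g set \<Rightarrow> 'g set) \<Rightarrow> 'c set \<Rightarrow> 'c set" where
  "orbit_component C \<pi> H \<phi> = (\<lambda>S\<in>lcosets\<^bsub>C\<^esub> (\<pi> ` H). S <#>\<^bsub>C\<^esub> (\<pi> ` \<phi> H))"

text \<open>\<open>\<theta>\<close> is the isomorphism from \<open>G\<close> to \<open>C\<^sub>p \<times> C\<^sub>q\<close>. The orbit \<open>G/H\<close> is the product of the orbits
  \<open>C\<^sub>p/\<pi>\<^sub>1(H)\<close> and \<open>C\<^sub>q/\<pi>\<^sub>2(H)\<close>. By \<open>wedge_diagram_subgroups\<close> below
  these are the expected orbits for the subgroups of orders \<open>1\<close>, \<open>p\<close>, \<open>q\<close> and \<open>p q\<close>, and by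
  \<open>orbit_component_projection\<close> the components of a projection \<open>G/H \<rightarrow> G/K\<close> are the projections,
  which is the identity in the component where the two images agree.\<close>

definition wedge_diagram ::
  "('a, 'm) monoid_scheme \<Rightarrow> ('b, 'n) monoid_scheme \<Rightarrow> ('g \<Rightarrow> 'a \<times> 'b) \<Rightarrow>
   ('a, 'v aug_dga, 'v) diagram \<Rightarrow> ('b, 'w aug_dga, 'w) diagram \<Rightarrow>
   ('g, ('v \<times> 'w) set dga, ('v \<times> 'w) set) diagram" where
  "wedge_diagram Cp Cq \<theta> U1 U2 =
    (let \<pi>1 = fst \<circ> \<theta>; \<pi>2 = snd \<circ> \<theta> in
     \<lparr>ob = (\<lambda>H. wedge (ob U1 (\<pi>1 ` H)) (ob U2 (\<pi>2 ` H))),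
      mor = (\<lambda>H K \<phi>.
        wedge_map (ob U1 (\<pi>1 ` K)) (ob U2 (\<pi>2 ` K))
          (mor U1 (\<pi>1 ` H) (\<pi>1 ` K) (orbit_component Cp \<pi>1 H \<phi>))
          (mor U2 (\<pi>2 ` H) (\<pi>2 ` K) (orbit_component Cq \<pi>2 H \<phi>)))\<rparr>)"

lemma image_l_coset:
  assumes "\<pi> \<in> hom G C" "g \<in> carrier G" "S \<subseteq> carrier G"
  shows "\<pi> ` (g <#\<^bsub>G\<^esub> S) = \<pi> g <#\<^bsub>C\<^esub> (\<pi> ` S)"
  using assms unfolding l_coset_def hom_def by (auto simp: subset_iff image_iff)

lemma lcoset_subset_carrier:
  assumes "group G" "subgroup H G" "S \<in> lcosets\<^bsub>G\<^esub> H"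
  shows "S \<subseteq> carrier G"
  using assms subgroup.lcosets_carrier by blast

lemma orbit_component_image:
  assumes G: "group G" and C: "comm_group C" and hom: "\<pi> \<in> hom G C" and H: "subgroup H G" and K: "subgroup K G"
    and phi: "\<phi> \<in> orbit_hom G H K" and S: "S \<in> lcosets\<^bsub>G\<^esub> H"
  shows "orbit_component C \<pi> H \<phi> (\<pi> ` S) = \<pi> ` \<phi> S"
proof -
  interpret G: group G by fact
  interpret C: comm_group C by fact
  interpret h: group_hom G C \<pi> using G hom C.is_group by (simp add: group_hom_def group_hom_axioms_def)
  obtain g where g: "g \<in> carrier G" "S = g <#\<^bsub>G\<^esub> H" using S by (auto simp: LCOSETS_def)
  have HH: "H \<in> lcosets\<^bsub>G\<^esub> H"
    using G.lcos_mult_one[OF subgroup.subset[OF H]] by (auto simp: LCOSETS_def)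
  have pS: "\<phi> S = g <#\<^bsub>G\<^esub> \<phi> H" using phi g HH by (auto simp: orbit_hom_def)
  have "\<phi> H \<in> lcosets\<^bsub>G\<^esub> K" using phi HH by (auto simp: orbit_hom_def)
  then obtain k where k: "k \<in> carrier G" "\<phi> H = k <#\<^bsub>G\<^esub> K" by (auto simp: LCOSETS_def)
  have Hc: "H \<subseteq> carrier G" and Kc: "K \<subseteq> carrier G" using H K subgroup.subset by auto
  have sH: "subgroup (\<pi> ` H) C" by (rule h.subgroup_img_is_subgroup[OF H])
  have sK: "subgroup (\<pi> ` K) C" by (rule h.subgroup_img_is_subgroup[OF K])
  have stab: "h \<in> H \<Longrightarrow> h <#\<^bsub>G\<^esub> \<phi> H = \<phi> H" for h
  proof -
    assume h: "h \<in> H"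
    have "h <#\<^bsub>G\<^esub> H = H" using G.coset_join3 H h Hc by blast
    then show ?thesis using phi HH h Hc by (force simp: orbit_hom_def)
  qed
  have fc: "\<phi> H \<subseteq> carrier G" using \<open>\<phi> H \<in> _\<close> K lcoset_subset_carrier[OF G] by blast
  have pimg: "\<pi> ` S = \<pi> g <#\<^bsub>C\<^esub> \<pi> ` H" using image_l_coset[OF hom g(1) Hc] g by simp
  have mem: "\<pi> ` S \<in> lcosets\<^bsub>C\<^esub> (\<pi> ` H)" unfolding pimg using g by (auto simp: LCOSETS_def)
  have st: "(\<pi> ` H) <#>\<^bsub>C\<^esub> (\<pi> ` \<phi> H) = \<pi> ` \<phi> H"
  proof
    show "(\<pi> ` H) <#>\<^bsub>C\<^esub> (\<pi> ` \<phi> H) \<subseteq> \<pi> ` \<phi> H"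
    proof
      fix y assume "y \<in> (\<pi> ` H) <#>\<^bsub>C\<^esub> (\<pi> ` \<phi> H)"
      then obtain h x where hx: "h \<in> H" "x \<in> \<phi> H" "y = \<pi> h \<otimes>\<^bsub>C\<^esub> \<pi> x" by (auto simp: set_mult_def)
      then have "y = \<pi> (h \<otimes>\<^bsub>G\<^esub> x)" using Hc fc by (metis h.hom_mult subsetD)
      moreover have "h \<otimes>\<^bsub>G\<^esub> x \<in> \<phi> H" using stab[OF hx(1)] hx(2) by (auto simp: l_coset_def)
      ultimately show "y \<in> \<pi> ` \<phi> H" by blast
    qed
    show "\<pi> ` \<phi> H \<subseteq> (\<pi> ` H) <#>\<^bsub>C\<^esub> (\<pi> ` \<phi> H)"
    proof
      fix y assume "y \<in> \<pi> ` \<phi> H"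
      then have "y = \<pi> \<one>\<^bsub>G\<^esub> \<otimes>\<^bsub>C\<^esub> y" using fc by auto
      then show "y \<in> (\<pi> ` H) <#>\<^bsub>C\<^esub> (\<pi> ` \<phi> H)"
        using subgroup.one_closed[OF H] \<open>y \<in> _\<close> unfolding set_mult_def by blast
    qed
  qed
  have "orbit_component C \<pi> H \<phi> (\<pi> ` S) = (\<pi> g <#\<^bsub>C\<^esub> \<pi> ` H) <#>\<^bsub>C\<^esub> \<pi> ` \<phi> H"
    using mem by (simp add: orbit_component_def pimg)
  also have "\<dots> = \<pi> g <#\<^bsub>C\<^esub> ((\<pi> ` H) <#>\<^bsub>C\<^esub> \<pi> ` \<phi> H)"
    unfolding l_coset_eq_set_mult[of C]
    using g Hc fc by (intro C.set_mult_assoc) auto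
  also have "\<dots> = \<pi> ` \<phi> S"
    unfolding st pS using image_l_coset[OF hom g(1) fc] by simp
  finally show ?thesis .
qed

lemma orbit_component_in_orbit_hom:
  assumes G: "group G" and C: "comm_group C" and hom: "\<pi> \<in> hom G C" and sur: "\<pi> ` carrier G = carrier C"
    and H: "subgroup H G" and K: "subgroup K G"
    and phi: "\<phi> \<in> orbit_hom G H K"
  shows "orbit_component C \<pi> H \<phi> \<in> orbit_hom C (\<pi> ` H) (\<pi> ` K)"
proof -
  interpret G: group G by fact
  have Hc: "H \<subseteq> carrier G" and Kc: "K \<subseteq> carrier G" using H K subgroup.subset by auto
  have eq: "lcosets\<^bsub>C\<^esub> (\<pi> ` L) = (`) \<pi> ` (lcosets\<^bsub>G\<^esub> L)" if "L \<subseteq> carrier G" for L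
  proof -
    have "lcosets\<^bsub>C\<^esub> (\<pi> ` L) = (\<lambda>c. c <#\<^bsub>C\<^esub> (\<pi> ` L)) ` \<pi> ` carrier G"
      unfolding sur by (auto simp: LCOSETS_def)
    also have "\<dots> = (\<lambda>g. \<pi> ` (g <#\<^bsub>G\<^esub> L)) ` carrier G"
      unfolding image_image by (intro image_cong refl) (simp add: image_l_coset[OF hom _ that])
    also have "\<dots> = (`) \<pi> ` (lcosets\<^bsub>G\<^esub> L)" by (auto simp: LCOSETS_def)
    finally show ?thesis .
  qed
  have cl: "g <#\<^bsub>G\<^esub> S \<in> lcosets\<^bsub>G\<^esub> H" if g: "g \<in> carrier G" and S: "S \<in> lcosets\<^bsub>G\<^esub> H" for g S
  proof -
    obtain a where "a \<in> carrier G" "S = a <#\<^bsub>G\<^esub> H" using S by (auto simp: LCOSETS_def)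
    then show ?thesis using g G.lcos_m_assoc[OF Hc] by (auto simp: LCOSETS_def)
  qed
  note im = orbit_component_image[OF G C hom H K phi]
  have ph: "S \<in> lcosets\<^bsub>G\<^esub> H \<Longrightarrow> \<phi> S \<in> lcosets\<^bsub>G\<^esub> K" for S using phi by (auto simp: orbit_hom_def)
  have "orbit_component C \<pi> H \<phi> (c <#\<^bsub>C\<^esub> T) = c <#\<^bsub>C\<^esub> orbit_component C \<pi> H \<phi> T"
    if c: "c \<in> carrier C" and T: "T \<in> lcosets\<^bsub>C\<^esub> (\<pi> ` H)" for c T
  proof -
    obtain g S where gS: "g \<in> carrier G" "c = \<pi> g" "S \<in> lcosets\<^bsub>G\<^esub> H" "T = \<pi> ` S"
      using c T unfolding eq[OF Hc] sur[symmetric] by blast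
    have "c <#\<^bsub>C\<^esub> T = \<pi> ` (g <#\<^bsub>G\<^esub> S)"
      using image_l_coset[OF hom gS(1) lcoset_subset_carrier[OF G H gS(3)]] gS by simp
    moreover have "\<phi> (g <#\<^bsub>G\<^esub> S) = g <#\<^bsub>G\<^esub> \<phi> S" using phi gS by (auto simp: orbit_hom_def)
    ultimately show ?thesis
      using im[OF cl[OF gS(1,3)]] im[OF gS(3)] image_l_coset[OF hom gS(1) lcoset_subset_carrier[OF G K ph[OF gS(3)]]] gS
      by simp
  qed
  moreover have "orbit_component C \<pi> H \<phi> T \<in> lcosets\<^bsub>C\<^esub> (\<pi> ` K)" if T: "T \<in> lcosets\<^bsub>C\<^esub> (\<pi> ` H)" for T
    using T im ph unfolding eq[OF Hc] eq[OF Kc] by fastforce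
  ultimately show ?thesis unfolding orbit_hom_def by (auto simp: orbit_component_def)
qed

lemma image_trivial_if_coprime:
  assumes "group G" "group C" "\<pi> \<in> hom G C" "subgroup H G" "coprime (card H) (order C)"
  shows "\<pi> ` H = {\<one>\<^bsub>C\<^esub>}"
proof -
  interpret h: group_hom G C \<pi> using assms by (simp add: group_hom_def group_hom_axioms_def)
  interpret HG: group "G\<lparr>carrier := H\<rparr>" using assms subgroup.subgroup_is_group by blast
  have "\<pi> x = \<one>\<^bsub>C\<^esub>" if x: "x \<in> H" for x
  proof -
    have xG: "x \<in> carrier G" using x subgroup.mem_carrier[OF assms(4)] by auto
    have "x [^]\<^bsub>G\<^esub> card H = \<one>\<^bsub>G\<^esub>"
      using HG.pow_order_eq_1[of x] x by (simp add: order_def h.G.nat_pow_consistent[symmetric])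
    then have "\<pi> x [^]\<^bsub>C\<^esub> card H = \<one>\<^bsub>C\<^esub>" using h.hom_nat_pow[OF xG, of "card H"] by simp
    then have 1: "group.ord C (\<pi> x) dvd card H" using h.H.pow_eq_id xG by auto
    have "group.ord C (\<pi> x) dvd order C" using h.H.ord_dvd_group_order xG by auto
    then have "group.ord C (\<pi> x) = 1" using 1 assms(5) coprime_common_divisor_nat by blast
    then show ?thesis using h.H.ord_eq_1 xG by auto
  qed
  then show ?thesis using subgroup.one_closed[OF assms(4)] by force
qed

lemma orbit_component_projection:
  assumes "group G" "subgroup H G" "subgroup K G" "H \<subseteq> K"
  shows "orbit_component C \<pi> H (\<lambda>S\<in>lcosets\<^bsub>G\<^esub> H. S <#>\<^bsub>G\<^esub> K) = (\<lambda>S\<in>lcosets\<^bsub>C\<^esub> (\<pi> ` H). S <#>\<^bsub>C\<^esub> (\<pi> ` K))"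
proof -
  interpret G: group G by fact
  have H: "H \<in> lcosets\<^bsub>G\<^esub> H"
    using G.lcos_mult_one[OF subgroup.subset[OF assms(2)]] by (auto simp: LCOSETS_def)
  have "H <#>\<^bsub>G\<^esub> K = K"
  proof
    show "H <#>\<^bsub>G\<^esub> K \<subseteq> K" using assms by (auto simp: set_mult_def subgroup.m_closed)
    show "K \<subseteq> H <#>\<^bsub>G\<^esub> K"
    proof
      fix k assume "k \<in> K"
      moreover have "k = \<one>\<^bsub>G\<^esub> \<otimes>\<^bsub>G\<^esub> k" using \<open>k \<in> K\<close> subgroup.subset[OF assms(3)] by auto
      ultimately show "k \<in> H <#>\<^bsub>G\<^esub> K" using subgroup.one_closed[OF assms(2)] unfolding set_mult_def by blast
    qed
  qed
  then show ?thesis using H by (simp add: orbit_component_def)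
qed

lemma wedge_diagram_subgroups:
  fixes \<theta> :: "'g \<Rightarrow> 'a \<times> 'b"
  assumes p: "prime p" and q: "prime q" and pq: "p \<noteq> q"
    and Cp: "group Cp" "order Cp = p" and Cq: "group Cq" "order Cq = q"
    and G: "group G" and \<theta>: "\<theta> \<in> iso G (Cp \<times>\<times> Cq)"
    and H: "subgroup H G"
  defines "\<pi>1 \<equiv> fst \<circ> \<theta>" and "\<pi>2 \<equiv> snd \<circ> \<theta>"
  shows "card H = 1 \<Longrightarrow> \<pi>1 ` H = {\<one>\<^bsub>Cp\<^esub>} \<and> \<pi>2 ` H = {\<one>\<^bsub>Cq\<^esub>}"
    and "card H = p \<Longrightarrow> \<pi>1 ` H = carrier Cp \<and> \<pi>2 ` H = {\<one>\<^bsub>Cq\<^esub>}"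
    and "card H = q \<Longrightarrow> \<pi>1 ` H = {\<one>\<^bsub>Cp\<^esub>} \<and> \<pi>2 ` H = carrier Cq"
    and "card H = p * q \<Longrightarrow> \<pi>1 ` H = carrier Cp \<and> \<pi>2 ` H = carrier Cq"
proof -
  have pos: "p > 0" "q > 0" using p q prime_gt_0_nat by auto
  have fin: "finite (carrier Cp)" "finite (carrier Cq)"
    using pos Cp Cq card_gt_0_iff unfolding order_def by metis+
  have bij: "bij_betw \<theta> (carrier G) (carrier Cp \<times> carrier Cq)" and \<theta>h: "\<theta> \<in> hom G (Cp \<times>\<times> Cq)"
    using \<theta> by (auto simp: iso_def)
  have h1: "\<pi>1 \<in> hom G Cp" and h2: "\<pi>2 \<in> hom G Cq"
    using \<theta>h unfolding \<pi>1_def \<pi>2_def hom_def DirProd_def by (auto simp: Pi_iff split_beta)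
  have cG: "card (carrier G) = p * q"
    using bij_betw_same_card[OF bij] Cp Cq by (simp add: order_def card_cartesian_product)
  then have fG: "finite (carrier G)" using pos by (metis card_gt_0_iff nat_0_less_mult_iff)
  have HG: "H \<subseteq> carrier G" using H subgroup.subset by auto
  have fH: "finite H" using HG fG finite_subset by auto
  have cop: "coprime p q" using p q pq primes_coprime by auto
  have inj: "inj_on \<theta> H" using bij HG bij_betw_imp_inj_on inj_on_subset by blast
  note t1 = image_trivial_if_coprime[OF G Cp(1) h1 H] and t2 = image_trivial_if_coprime[OF G Cq(1) h2 H]
  have s1: "\<pi>1 ` H \<subseteq> carrier Cp" and s2: "\<pi>2 ` H \<subseteq> carrier Cq" using h1 h2 HG by (auto simp: hom_def)
  show "card H = 1 \<Longrightarrow> \<pi>1 ` H = {\<one>\<^bsub>Cp\<^esub>} \<and> \<pi>2 ` H = {\<one>\<^bsub>Cq\<^esub>}" using t1 t2 by simp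
  show "card H = p \<Longrightarrow> \<pi>1 ` H = carrier Cp \<and> \<pi>2 ` H = {\<one>\<^bsub>Cq\<^esub>}"
  proof -
    assume c: "card H = p"
    then have t: "\<pi>2 ` H = {\<one>\<^bsub>Cq\<^esub>}" using t2 cop Cq by simp
    have "inj_on \<pi>1 H"
    proof (rule inj_onI)
      fix x y assume "x \<in> H" "y \<in> H" "\<pi>1 x = \<pi>1 y"
      moreover have "\<pi>2 x = \<pi>2 y" using t \<open>x \<in> H\<close> \<open>y \<in> H\<close> by (metis imageI singletonD)
      ultimately show "x = y" using inj by (auto simp: \<pi>1_def \<pi>2_def inj_on_def prod_eq_iff)
    qed
    then have "card (\<pi>1 ` H) = card (carrier Cp)" using c Cp by (simp add: card_image order_def)
    then show ?thesis using t s1 fin card_subset_eq by blast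
  qed
  show "card H = q \<Longrightarrow> \<pi>1 ` H = {\<one>\<^bsub>Cp\<^esub>} \<and> \<pi>2 ` H = carrier Cq"
  proof -
    assume c: "card H = q"
    then have t: "\<pi>1 ` H = {\<one>\<^bsub>Cp\<^esub>}" using t1 cop Cp by (simp add: coprime_commute)
    have "inj_on \<pi>2 H"
    proof (rule inj_onI)
      fix x y assume "x \<in> H" "y \<in> H" "\<pi>2 x = \<pi>2 y"
      moreover have "\<pi>1 x = \<pi>1 y" using t \<open>x \<in> H\<close> \<open>y \<in> H\<close> by (metis imageI singletonD)
      ultimately show "x = y" using inj by (auto simp: \<pi>1_def \<pi>2_def inj_on_def prod_eq_iff)
    qed
    then have "card (\<pi>2 ` H) = card (carrier Cq)" using c Cq by (simp add: card_image order_def)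
    then show ?thesis using t s2 fin card_subset_eq by blast
  qed
  show "card H = p * q \<Longrightarrow> \<pi>1 ` H = carrier Cp \<and> \<pi>2 ` H = carrier Cq"
  proof -
    assume "card H = p * q"
    then have "H = carrier G" using cG HG fG card_subset_eq by metis
    then have "\<theta> ` H = carrier Cp \<times> carrier Cq" using bij by (simp add: bij_betw_def)
    then have "\<pi>1 ` H = fst ` (carrier Cp \<times> carrier Cq)" "\<pi>2 ` H = snd ` (carrier Cp \<times> carrier Cq)"
      unfolding \<pi>1_def \<pi>2_def by (metis image_comp)+
    moreover have "carrier Cp \<noteq> {}" "carrier Cq \<noteq> {}" using Cp Cq group.is_monoid monoid.one_closed by blast+
    ultimately show ?thesis by auto
  qed
qed

end

theory Submission
  imports Defs "HOL-Library.Countable"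
begin

text \<open>
  The two maps \<open>A \<or> B \<rightarrow> A\<close> and \<open>A \<or> B \<rightarrow> B\<close> which collapse the other augmentation ideal identify \<open>A \<or> B\<close>
  with the fibre product of \<open>A\<close> and \<open>B\<close> over the augmentations: pairs \<open>(a, b)\<close> with \<open>\<epsilon>(a) = \<epsilon>(b)\<close> in
  degree \<open>0\<close>, and all pairs in positive degrees. There the operations are componentwise. So the axioms of
  a DGA hold for \<open>A \<or> B\<close> because they hold for \<open>A\<close> and \<open>B\<close> (\<open>dga_of_jointly_injective\<close>), its cohomology in
  degrees \<open>0\<close> and \<open>1\<close> can be read off (\<open>wedge_connected\<close>), and the maps \<open>f \<or> g\<close> are functorial.

  As a diagram of graded vector spaces, the wedge is a retract of \<open>\<pi>\<^sub>1\<^sup>*\<U>\<^sub>1 \<oplus> \<pi>\<^sub>2\<^sup>*\<U>\<^sub>2\<close>, where \<open>\<pi>\<^sub>1\<close> and \<open>\<pi>\<^sub>2\<close> are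
  the projections of \<open>G\<close> onto the two factors and \<open>(\<pi>\<^sup>*I)(G/H) = I(C/\<pi>(H))\<close>: the inclusion sends \<open>(a, b)\<close>
  to \<open>(a, b - \<epsilon>(b) \<cdot> 1)\<close>, and the retraction sends \<open>a\<close> and \<open>b\<close> to their classes \<open>[a]\<close> and \<open>[b]\<close>. Since retracts of sums
  of two injective objects are injective (\<open>vec_injective_retract_of_two\<close>), it remains to see that \<open>\<pi>\<^sup>*I\<close> is
  injective whenever \<open>I\<close> is. The functor \<open>\<pi>\<^sup>*\<close> is right adjoint to the restriction of diagrams along
  \<open>C/K \<mapsto> G/\<pi>\<inverse>(K)\<close>, and restriction preserves injective morphisms (\<open>vec_injective_pullback\<close>).

  Finally, injectivity relative to one infinite type has to be carried over to every other type of test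
  objects. For a group \<open>C\<close> of prime order there is a criterion without test objects: \<open>I\<close> is injective if and only
  if \<open>I(C/1) \<rightarrow> I(C/C)\<close> is surjective in every degree. Necessity needs test objects of countable size only
  (\<open>surjective_to_point_if_vec_injective\<close>). Sufficiency is a linear lifting argument, followed by averaging
  over \<open>C\<close> (\<open>vec_injective_if_surjective_to_point\<close>).
\<close>

section \<open>Rational vector spaces\<close>

lemma rat_field_simps [simp]:
  "carrier rat_field = UNIV" "x \<oplus>\<^bsub>rat_field\<^esub> y = x + y" "x \<otimes>\<^bsub>rat_field\<^esub> y = x * y"
  "\<zero>\<^bsub>rat_field\<^esub> = 0" "\<one>\<^bsub>rat_field\<^esub> = 1"
  by (simp_all add: rat_field_def)

lemma cring_rat_field: "cring rat_field"
proof (intro cringI abelian_groupI comm_monoidI)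
  fix x assume "x \<in> carrier rat_field"
  show "\<exists>y\<in>carrier rat_field. y \<oplus>\<^bsub>rat_field\<^esub> x = \<zero>\<^bsub>rat_field\<^esub>"
    by (rule bexI[of _ "- x"]) simp_all
qed (simp_all add: algebra_simps)

locale rational_space = module rat_field M for M :: "'v rat_space" (structure)
begin

lemma scale_closed: "x \<in> carrier M \<Longrightarrow> c \<odot> x \<in> carrier M"
  by simp

lemma scale_add: "x \<in> carrier M \<Longrightarrow> (a + b) \<odot> x = a \<odot> x \<oplus> b \<odot> x"
  using smult_l_distr[of a b x] by simp

lemma add_scale: "x \<in> carrier M \<Longrightarrow> y \<in> carrier M \<Longrightarrow> c \<odot> (x \<oplus> y) = c \<odot> x \<oplus> c \<odot> y"
  using smult_r_distr[of c x y] by simp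

lemma scale_scale: "x \<in> carrier M \<Longrightarrow> a \<odot> (b \<odot> x) = (a * b) \<odot> x"
  using smult_assoc1[of a b x] by simp

lemma scale_one: "x \<in> carrier M \<Longrightarrow> 1 \<odot> x = x"
  using smult_one[of x] by simp

lemma scale_zero_left: "x \<in> carrier M \<Longrightarrow> 0 \<odot> x = \<zero>"
  using smult_l_null[of x] by simp

lemma scale_zero_right: "c \<odot> \<zero> = \<zero>"
  using smult_r_null[of c] by simp

lemma add_neg_scale: "x \<in> carrier M \<Longrightarrow> x \<oplus> (- 1) \<odot> x = \<zero>"
  using scale_add[of x 1 "- 1"] by (simp add: scale_one scale_zero_left)

lemma neg_scale_add: "x \<in> carrier M \<Longrightarrow> (- 1) \<odot> x \<oplus> x = \<zero>"
  using add_neg_scale[of x] by (simp add: M.a_comm)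

lemma eq_if_diff_zero:
  assumes "x \<in> carrier M" "y \<in> carrier M" "x \<oplus> (- 1) \<odot> y = \<zero>"
  shows "x = y"
proof -
  have "x = x \<oplus> ((- 1) \<odot> y \<oplus> y)" using assms by (simp add: neg_scale_add)
  also have "\<dots> = y" using assms by (simp add: M.a_assoc[symmetric])
  finally show ?thesis .
qed

end

lemma rational_spaceI:
  fixes M :: "'v rat_space" (structure)
  assumes "\<zero> \<in> carrier M"
    and "\<And>x y. x \<in> carrier M \<Longrightarrow> y \<in> carrier M \<Longrightarrow> x \<oplus> y \<in> carrier M"
    and "\<And>c x. x \<in> carrier M \<Longrightarrow> c \<odot> x \<in> carrier M"
    and "\<And>x y z. x \<in> carrier M \<Longrightarrow> y \<in> carrier M \<Longrightarrow> z \<in> carrier M \<Longrightarrow> (x \<oplus> y) \<oplus> z = x \<oplus> (y \<oplus> z)"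
    and "\<And>x y. x \<in> carrier M \<Longrightarrow> y \<in> carrier M \<Longrightarrow> x \<oplus> y = y \<oplus> x"
    and "\<And>x. x \<in> carrier M \<Longrightarrow> \<zero> \<oplus> x = x"
    and "\<And>x. x \<in> carrier M \<Longrightarrow> (- 1) \<odot> x \<oplus> x = \<zero>"
    and "\<And>a b x. x \<in> carrier M \<Longrightarrow> (a + b) \<odot> x = a \<odot> x \<oplus> b \<odot> x"
    and "\<And>c x y. x \<in> carrier M \<Longrightarrow> y \<in> carrier M \<Longrightarrow> c \<odot> (x \<oplus> y) = c \<odot> x \<oplus> c \<odot> y"
    and "\<And>a b x. x \<in> carrier M \<Longrightarrow> (a * b) \<odot> x = a \<odot> (b \<odot> x)"
    and "\<And>x. x \<in> carrier M \<Longrightarrow> 1 \<odot> x = x"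
  shows "rational_space M"
proof -
  have "abelian_group M"
  proof (rule abelian_groupI)
    fix x assume "x \<in> carrier M"
    then show "\<exists>y\<in>carrier M. y \<oplus> x = \<zero>" using assms(3,7) by blast
  qed (use assms in auto)
  then show ?thesis
    unfolding rational_space_def
    by (intro moduleI cring_rat_field) (use assms in auto)
qed

lemma rational_space_module: "rational_space M \<longleftrightarrow> module rat_field M"
  by (simp add: rational_space_def)

lemma rat_linearI:
  assumes "\<And>x. x \<in> carrier M \<Longrightarrow> f x \<in> carrier N"
    and "\<And>x y. x \<in> carrier M \<Longrightarrow> y \<in> carrier M \<Longrightarrow> f (x \<oplus>\<^bsub>M\<^esub> y) = f x \<oplus>\<^bsub>N\<^esub> f y"
    and "\<And>c x. x \<in> carrier M \<Longrightarrow> f (c \<odot>\<^bsub>M\<^esub> x) = c \<odot>\<^bsub>N\<^esub> f x"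
  shows "f \<in> rat_linear M N"
  using assms by (auto simp: rat_linear_def)

lemma rat_linear_closed: "f \<in> rat_linear M N \<Longrightarrow> x \<in> carrier M \<Longrightarrow> f x \<in> carrier N"
  by (auto simp: rat_linear_def)

lemma rat_linear_add:
  "f \<in> rat_linear M N \<Longrightarrow> x \<in> carrier M \<Longrightarrow> y \<in> carrier M \<Longrightarrow> f (x \<oplus>\<^bsub>M\<^esub> y) = f x \<oplus>\<^bsub>N\<^esub> f y"
  by (auto simp: rat_linear_def)

lemma rat_linear_scale:
  "f \<in> rat_linear M N \<Longrightarrow> x \<in> carrier M \<Longrightarrow> f (c \<odot>\<^bsub>M\<^esub> x) = c \<odot>\<^bsub>N\<^esub> f x"
  by (auto simp: rat_linear_def)

lemma rat_linear_zero:
  assumes "rational_space M" "rational_space N" "f \<in> rat_linear M N"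
  shows "f \<zero>\<^bsub>M\<^esub> = \<zero>\<^bsub>N\<^esub>"
proof -
  interpret M: rational_space M by fact
  interpret N: rational_space N by fact
  have "f (0 \<odot>\<^bsub>M\<^esub> \<zero>\<^bsub>M\<^esub>) = 0 \<odot>\<^bsub>N\<^esub> f \<zero>\<^bsub>M\<^esub>"
    using assms(3) by (rule rat_linear_scale) simp
  then show ?thesis
    using rat_linear_closed[OF assms(3)] by (simp add: M.scale_zero_right N.scale_zero_left)
qed

lemma rat_linear_comp:
  assumes "f \<in> rat_linear L M" "g \<in> rat_linear M N"
  shows "(\<lambda>x. g (f x)) \<in> rat_linear L N"
  using assms by (auto simp: rat_linear_def Pi_iff)

lemma rat_linear_cong:
  assumes "rational_space M" "\<And>x. x \<in> carrier M \<Longrightarrow> f x = g x" "g \<in> rat_linear M N"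
  shows "f \<in> rat_linear M N"
proof -
  interpret M: rational_space M by fact
  show ?thesis
    by (rule rat_linearI)
      (simp_all add: assms(2) rat_linear_closed[OF assms(3)] rat_linear_add[OF assms(3)]
        rat_linear_scale[OF assms(3)])
qed

lemma rat_linear_plus:
  assumes "rational_space N" "f \<in> rat_linear M N" "g \<in> rat_linear M N"
  shows "(\<lambda>x. f x \<oplus>\<^bsub>N\<^esub> g x) \<in> rat_linear M N"
proof -
  interpret N: rational_space N by fact
  show ?thesis
    by (rule rat_linearI)
      (simp_all add: rat_linear_closed[OF assms(2)] rat_linear_closed[OF assms(3)]
        rat_linear_add[OF assms(2)] rat_linear_add[OF assms(3)]
        rat_linear_scale[OF assms(2)] rat_linear_scale[OF assms(3)] N.add_scale N.M.a_ac)
qed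

lemma rat_linear_scaled:
  assumes "rational_space N" "f \<in> rat_linear M N"
  shows "(\<lambda>x. c \<odot>\<^bsub>N\<^esub> f x) \<in> rat_linear M N"
proof -
  interpret N: rational_space N by fact
  show ?thesis
    by (rule rat_linearI)
      (simp_all add: rat_linear_closed[OF assms(2)] rat_linear_add[OF assms(2)]
        rat_linear_scale[OF assms(2)] N.add_scale N.scale_scale mult.commute)
qed

lemma rat_linear_finsum_arg:
  assumes "rational_space M" "rational_space N" "f \<in> rat_linear M N"
    and "finite A" "u \<in> A \<rightarrow> carrier M"
  shows "f (finsum M u A) = finsum N (\<lambda>a. f (u a)) A"
proof -
  interpret M: rational_space M by fact
  interpret N: rational_space N by fact
  show ?thesis
    using assms(4,5)
  proof (induction A rule: finite_induct)
    case empty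
    then show ?case using rat_linear_zero[OF assms(1-3)] by simp
  next
    case (insert a A)
    then have 1: "u \<in> A \<rightarrow> carrier M" "u a \<in> carrier M" by auto
    then have 2: "(\<lambda>a. f (u a)) \<in> A \<rightarrow> carrier N" "f (u a) \<in> carrier N"
      using rat_linear_closed[OF assms(3)] by auto
    show ?case
      using insert 1 2 by (simp add: M.M.finsum_insert N.M.finsum_insert rat_linear_add[OF assms(3)])
  qed
qed

lemma rat_linear_finsum:
  assumes "rational_space M" "rational_space N" "finite A" "\<And>a. a \<in> A \<Longrightarrow> u a \<in> rat_linear M N"
  shows "(\<lambda>x. finsum N (\<lambda>a. u a x) A) \<in> rat_linear M N"
proof -
  interpret N: rational_space N by fact
  show ?thesis
    using assms(3,4)
  proof (induction A rule: finite_induct)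
    case empty
    then show ?case by (intro rat_linearI) (simp_all add: N.scale_zero_right)
  next
    case (insert a A)
    have lin: "(\<lambda>x. u a x \<oplus>\<^bsub>N\<^esub> finsum N (\<lambda>a. u a x) A) \<in> rat_linear M N"
      by (rule rat_linear_plus[OF assms(2)]) (use insert in auto)
    have eq: "finsum N (\<lambda>a. u a x) (insert a A) = u a x \<oplus>\<^bsub>N\<^esub> finsum N (\<lambda>a. u a x) A"
      if "x \<in> carrier M" for x
    proof -
      have "u b x \<in> carrier N" if "b \<in> insert a A" for b
        using insert.prems[OF that] \<open>x \<in> carrier M\<close> by (rule rat_linear_closed)
      then show ?thesis using insert.hyps by (simp add: N.M.finsum_insert Pi_iff)
    qed
    show ?case by (rule rat_linear_cong[OF assms(1) _ lin]) (rule eq)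
  qed
qed

lemma (in rational_space) finsum_constant:
  assumes "finite A" "x \<in> carrier M"
  shows "finsum M (\<lambda>_. x) A = of_nat (card A) \<odot> x"
  using assms
proof (induction A rule: finite_induct)
  case empty
  then show ?case by (simp add: scale_zero_left)
next
  case (insert a A)
  then show ?case by (simp add: M.finsum_insert scale_add scale_one)
qed

text \<open>Extending \<open>g\<close> along the injection \<open>f\<close> and lifting \<open>k\<close> through the surjection \<open>\<beta>\<close> at the
  same time is possible because every vector \<open>y\<close> outside a subspace can be given any
  value, in particular one of the values in the fibre of \<open>\<beta>\<close> over \<open>k y\<close>. The partial solutions are
  handled as graphs, for which the union of a chain is again a partial solution.\<close>

lemma extension_with_prescribed_image:
  assumes X: "rational_space X" and Y: "rational_space Y" and V: "rational_space V" and W: "rational_space W"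
    and f: "f \<in> rat_linear X Y" "inj_on f (carrier X)"
    and g: "g \<in> rat_linear X V"
    and \<beta>: "\<beta> \<in> rat_linear V W" "\<beta> ` carrier V = carrier W"
    and k: "k \<in> rat_linear Y W"
    and compat: "\<And>x. x \<in> carrier X \<Longrightarrow> \<beta> (g x) = k (f x)"
  obtains h where "h \<in> rat_linear Y V"
    and "\<And>x. x \<in> carrier X \<Longrightarrow> h (f x) = g x"
    and "\<And>y. y \<in> carrier Y \<Longrightarrow> \<beta> (h y) = k y"
proof -
  interpret X: rational_space X by fact
  interpret Y: rational_space Y by fact
  interpret V: rational_space V by fact
  interpret W: rational_space W by fact
  define \<G> where "\<G> = {R. R \<subseteq> carrier Y \<times> carrier V \<and>
      (\<forall>x\<in>carrier X. (f x, g x) \<in> R) \<and>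
      (\<forall>y v y' v'. (y, v) \<in> R \<longrightarrow> (y', v') \<in> R \<longrightarrow> (y \<oplus>\<^bsub>Y\<^esub> y', v \<oplus>\<^bsub>V\<^esub> v') \<in> R) \<and>
      (\<forall>c y v. (y, v) \<in> R \<longrightarrow> (c \<odot>\<^bsub>Y\<^esub> y, c \<odot>\<^bsub>V\<^esub> v) \<in> R) \<and>
      (\<forall>v. (\<zero>\<^bsub>Y\<^esub>, v) \<in> R \<longrightarrow> v = \<zero>\<^bsub>V\<^esub>) \<and>
      (\<forall>y v. (y, v) \<in> R \<longrightarrow> \<beta> v = k y)}"
  have "\<exists>R\<in>\<G>. \<forall>S\<in>\<G>. R \<subseteq> S \<longrightarrow> S = R"
  proof (rule subset_Zorn_nonempty)
    let ?R = "(\<lambda>x. (f x, g x)) ` carrier X"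
    have "?R \<in> \<G>"
    proof -
      have "g x = \<zero>\<^bsub>V\<^esub>" if "x \<in> carrier X" "f x = \<zero>\<^bsub>Y\<^esub>" for x
      proof -
        have "f x = f \<zero>\<^bsub>X\<^esub>" using that rat_linear_zero[OF X Y f(1)] by simp
        then have "x = \<zero>\<^bsub>X\<^esub>" using f(2) that by (auto dest: inj_onD)
        then show ?thesis using rat_linear_zero[OF X V g] by simp
      qed
      moreover have "(f x \<oplus>\<^bsub>Y\<^esub> f y, g x \<oplus>\<^bsub>V\<^esub> g y) \<in> ?R" if "x \<in> carrier X" "y \<in> carrier X" for x y
        using that rat_linear_add[OF f(1)] rat_linear_add[OF g]
        by (intro image_eqI[of _ _ "x \<oplus>\<^bsub>X\<^esub> y"]) auto
      moreover have "(c \<odot>\<^bsub>Y\<^esub> f x, c \<odot>\<^bsub>V\<^esub> g x) \<in> ?R" if "x \<in> carrier X" for c x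
        using that rat_linear_scale[OF f(1)] rat_linear_scale[OF g]
        by (intro image_eqI[of _ _ "c \<odot>\<^bsub>X\<^esub> x"]) auto
      moreover have "?R \<subseteq> carrier Y \<times> carrier V"
        using rat_linear_closed[OF f(1)] rat_linear_closed[OF g] by auto
      ultimately show ?thesis
        unfolding \<G>_def mem_Collect_eq using compat by (intro conjI allI impI ballI) (auto simp: image_iff)
    qed
    then show "\<G> \<noteq> {}" by blast
  next
    fix \<C> assume ne: "\<C> \<noteq> {}" and ch: "subset.chain \<G> \<C>"
    then have sub: "\<C> \<subseteq> \<G>" by (auto simp: subset.chain_def)
    have two: "\<exists>R\<in>\<C>. x \<in> R \<and> y \<in> R" if xy: "x \<in> \<Union>\<C>" "y \<in> \<Union>\<C>" for x y
    proof -
      obtain R S where "R \<in> \<C>" "S \<in> \<C>" "x \<in> R" "y \<in> S" using xy by blast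
      moreover have "R \<subseteq> S \<or> S \<subseteq> R" using ch \<open>R \<in> \<C>\<close> \<open>S \<in> \<C>\<close> by (auto simp: subset_chain_def)
      ultimately show ?thesis by blast
    qed
    show "\<Union>\<C> \<in> \<G>"
      unfolding \<G>_def mem_Collect_eq
    proof (intro conjI allI impI ballI)
      show "\<Union>\<C> \<subseteq> carrier Y \<times> carrier V" using sub unfolding \<G>_def by blast
      show "(f x, g x) \<in> \<Union>\<C>" if "x \<in> carrier X" for x using that ne sub unfolding \<G>_def by blast
      show "(y \<oplus>\<^bsub>Y\<^esub> y', v \<oplus>\<^bsub>V\<^esub> v') \<in> \<Union>\<C>" if "(y, v) \<in> \<Union>\<C>" "(y', v') \<in> \<Union>\<C>" for y v y' v'
        using two[OF that] sub unfolding \<G>_def by blast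
      show "(c \<odot>\<^bsub>Y\<^esub> y, c \<odot>\<^bsub>V\<^esub> v) \<in> \<Union>\<C>" if "(y, v) \<in> \<Union>\<C>" for c y v
        using that sub unfolding \<G>_def by blast
      show "v = \<zero>\<^bsub>V\<^esub>" if "(\<zero>\<^bsub>Y\<^esub>, v) \<in> \<Union>\<C>" for v using that sub unfolding \<G>_def by blast
      show "\<beta> v = k y" if "(y, v) \<in> \<Union>\<C>" for y v using that sub unfolding \<G>_def by blast
    qed
  qed
  then obtain R where R: "R \<in> \<G>" and max: "\<And>S. S \<in> \<G> \<Longrightarrow> R \<subseteq> S \<Longrightarrow> S = R" by blast
  have RYV: "y \<in> carrier Y" "v \<in> carrier V" if "(y, v) \<in> R" for y v using R that unfolding \<G>_def by auto
  have Rfg: "(f x, g x) \<in> R" if "x \<in> carrier X" for x using R that unfolding \<G>_def by auto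
  have Radd: "(y \<oplus>\<^bsub>Y\<^esub> y', v \<oplus>\<^bsub>V\<^esub> v') \<in> R" if "(y, v) \<in> R" "(y', v') \<in> R" for y v y' v'
    using R that unfolding \<G>_def by blast
  have Rscale: "(c \<odot>\<^bsub>Y\<^esub> y, c \<odot>\<^bsub>V\<^esub> v) \<in> R" if "(y, v) \<in> R" for c y v
    using R that unfolding \<G>_def by blast
  have R0: "v = \<zero>\<^bsub>V\<^esub>" if "(\<zero>\<^bsub>Y\<^esub>, v) \<in> R" for v using R that unfolding \<G>_def by blast
  have R\<beta>: "\<beta> v = k y" if "(y, v) \<in> R" for y v using R that unfolding \<G>_def by blast
  have unique: "v = v'" if "(y, v) \<in> R" "(y, v') \<in> R" for y v v'
  proof -
    have "(\<zero>\<^bsub>Y\<^esub>, v \<oplus>\<^bsub>V\<^esub> (- 1) \<odot>\<^bsub>V\<^esub> v') \<in> R"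
      using Radd[OF that(1) Rscale[OF that(2), of "- 1"]] Y.add_neg_scale[of y] RYV[OF that(1)] by simp
    then show ?thesis using R0 V.eq_if_diff_zero RYV[OF that(1)] RYV[OF that(2)] by blast
  qed
  have R00: "(\<zero>\<^bsub>Y\<^esub>, \<zero>\<^bsub>V\<^esub>) \<in> R"
    using Rfg[of "\<zero>\<^bsub>X\<^esub>"] rat_linear_zero[OF X Y f(1)] rat_linear_zero[OF X V g] by simp
  have total: "\<exists>v. (y, v) \<in> R" if y: "y \<in> carrier Y" for y
  proof (rule ccontr)
    assume no: "\<nexists>v. (y, v) \<in> R"
    have "k y \<in> carrier W" using y k by (rule rat_linear_closed[rotated])
    then obtain v where v: "v \<in> carrier V" "\<beta> v = k y" using \<beta>(2) by (metis imageE)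
    define S where "S = {(a \<oplus>\<^bsub>Y\<^esub> c \<odot>\<^bsub>Y\<^esub> y, b \<oplus>\<^bsub>V\<^esub> c \<odot>\<^bsub>V\<^esub> v) | a b c. (a, b) \<in> R}"
    have SI: "(a \<oplus>\<^bsub>Y\<^esub> c \<odot>\<^bsub>Y\<^esub> y, b \<oplus>\<^bsub>V\<^esub> c \<odot>\<^bsub>V\<^esub> v) \<in> S" if "(a, b) \<in> R" for a b c
      using that unfolding S_def by blast
    have RS: "R \<subseteq> S"
    proof
      fix z assume z: "z \<in> R"
      obtain a b where ab: "z = (a, b)" by (cases z)
      then show "z \<in> S" using SI[of a b 0] z RYV[of a b] y v
        by (simp add: Y.scale_zero_left V.scale_zero_left)
    qed
    have "S \<in> \<G>"
      unfolding \<G>_def mem_Collect_eq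
    proof (intro conjI allI impI ballI)
      show "S \<subseteq> carrier Y \<times> carrier V" unfolding S_def using RYV y v by auto
      show "(f x, g x) \<in> S" if "x \<in> carrier X" for x using Rfg[OF that] RS by blast
      show "(s \<oplus>\<^bsub>Y\<^esub> s', t \<oplus>\<^bsub>V\<^esub> t') \<in> S" if st: "(s, t) \<in> S" "(s', t') \<in> S" for s t s' t'
      proof -
        obtain a b c where 1: "(a, b) \<in> R" "s = a \<oplus>\<^bsub>Y\<^esub> c \<odot>\<^bsub>Y\<^esub> y" "t = b \<oplus>\<^bsub>V\<^esub> c \<odot>\<^bsub>V\<^esub> v"
          using st(1) unfolding S_def by blast
        obtain a' b' c' where 2: "(a', b') \<in> R" "s' = a' \<oplus>\<^bsub>Y\<^esub> c' \<odot>\<^bsub>Y\<^esub> y" "t' = b' \<oplus>\<^bsub>V\<^esub> c' \<odot>\<^bsub>V\<^esub> v"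
          using st(2) unfolding S_def by blast
        have "s \<oplus>\<^bsub>Y\<^esub> s' = (a \<oplus>\<^bsub>Y\<^esub> a') \<oplus>\<^bsub>Y\<^esub> (c + c') \<odot>\<^bsub>Y\<^esub> y"
          using RYV[OF 1(1)] RYV[OF 2(1)] y unfolding 1 2 by (simp add: Y.scale_add Y.M.a_ac)
        moreover have "t \<oplus>\<^bsub>V\<^esub> t' = (b \<oplus>\<^bsub>V\<^esub> b') \<oplus>\<^bsub>V\<^esub> (c + c') \<odot>\<^bsub>V\<^esub> v"
          using RYV[OF 1(1)] RYV[OF 2(1)] v unfolding 1 2 by (simp add: V.scale_add V.M.a_ac)
        ultimately show ?thesis using SI[OF Radd[OF 1(1) 2(1)]] by simp
      qed
      show "(d \<odot>\<^bsub>Y\<^esub> s, d \<odot>\<^bsub>V\<^esub> t) \<in> S" if st: "(s, t) \<in> S" for d s t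
      proof -
        obtain a b c where 1: "(a, b) \<in> R" "s = a \<oplus>\<^bsub>Y\<^esub> c \<odot>\<^bsub>Y\<^esub> y" "t = b \<oplus>\<^bsub>V\<^esub> c \<odot>\<^bsub>V\<^esub> v"
          using st unfolding S_def by blast
        have "d \<odot>\<^bsub>Y\<^esub> s = d \<odot>\<^bsub>Y\<^esub> a \<oplus>\<^bsub>Y\<^esub> (d * c) \<odot>\<^bsub>Y\<^esub> y"
          using RYV[OF 1(1)] y unfolding 1 by (simp add: Y.add_scale Y.scale_scale)
        moreover have "d \<odot>\<^bsub>V\<^esub> t = d \<odot>\<^bsub>V\<^esub> b \<oplus>\<^bsub>V\<^esub> (d * c) \<odot>\<^bsub>V\<^esub> v"
          using RYV[OF 1(1)] v unfolding 1 by (simp add: V.add_scale V.scale_scale)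
        ultimately show ?thesis using SI[OF Rscale[OF 1(1)]] by simp
      qed
      show "t = \<zero>\<^bsub>V\<^esub>" if st: "(\<zero>\<^bsub>Y\<^esub>, t) \<in> S" for t
      proof -
        obtain a b c where 1: "(a, b) \<in> R" "\<zero>\<^bsub>Y\<^esub> = a \<oplus>\<^bsub>Y\<^esub> c \<odot>\<^bsub>Y\<^esub> y" "t = b \<oplus>\<^bsub>V\<^esub> c \<odot>\<^bsub>V\<^esub> v"
          using st unfolding S_def by blast
        note ab = RYV[OF 1(1)]
        have "c = 0"
        proof (rule ccontr)
          \<comment> \<open>for \<open>c \<noteq> 0\<close>, the vector \<open>y = - a / c\<close> would lie in the domain of \<open>R\<close>\<close>
          assume c: "c \<noteq> 0"
          have "(- 1 / c) \<odot>\<^bsub>Y\<^esub> a \<oplus>\<^bsub>Y\<^esub> (- 1) \<odot>\<^bsub>Y\<^esub> y = (- 1 / c) \<odot>\<^bsub>Y\<^esub> (a \<oplus>\<^bsub>Y\<^esub> c \<odot>\<^bsub>Y\<^esub> y)"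
            using ab y c by (simp add: Y.add_scale Y.scale_scale)
          also have "\<dots> = \<zero>\<^bsub>Y\<^esub>" using 1(2)[symmetric] by (simp add: Y.scale_zero_right)
          finally have "(- 1 / c) \<odot>\<^bsub>Y\<^esub> a = y" 
            by (rule Y.eq_if_diff_zero[rotated 2]) (use ab y in simp_all)
          then show False using Rscale[OF 1(1), of "- 1 / c"] no by auto
        qed
        then show ?thesis using 1 ab y v R0 by (simp add: Y.scale_zero_left V.scale_zero_left)
      qed
      show "\<beta> t = k s" if st: "(s, t) \<in> S" for s t
      proof -
        obtain a b c where 1: "(a, b) \<in> R" "s = a \<oplus>\<^bsub>Y\<^esub> c \<odot>\<^bsub>Y\<^esub> y" "t = b \<oplus>\<^bsub>V\<^esub> c \<odot>\<^bsub>V\<^esub> v"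
          using st unfolding S_def by blast
        show ?thesis
          using RYV[OF 1(1)] R\<beta>[OF 1(1)] y v(1) v(2)[symmetric] unfolding 1(2,3)
          by (simp add: rat_linear_add[OF \<beta>(1)] rat_linear_add[OF k] rat_linear_scale[OF \<beta>(1)]
              rat_linear_scale[OF k])
      qed
    qed
    then have "S = R" using max RS by blast
    moreover have "(y, v) \<in> S"
      using SI[OF R00, of 1] y v by (simp add: Y.scale_one V.scale_one)
    ultimately show False using no by blast
  qed
  define h where "h y = (THE v. (y, v) \<in> R)" for y
  have h: "(y, h y) \<in> R" if y: "y \<in> carrier Y" for y
    
  proof -
    obtain v where "(y, v) \<in> R" using total[OF y] by blast
    then show ?thesis unfolding h_def by (rule theI) (rule unique[OF _ \<open>(y, v) \<in> R\<close>])
  qed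
  show thesis
  proof (rule that)
    show "h \<in> rat_linear Y V"
    proof (rule rat_linearI)
      show "h y \<in> carrier V" if "y \<in> carrier Y" for y using RYV h[OF that] by blast
      show "h (y \<oplus>\<^bsub>Y\<^esub> y') = h y \<oplus>\<^bsub>V\<^esub> h y'" if "y \<in> carrier Y" "y' \<in> carrier Y" for y y'
        using unique[OF h Radd[OF h h]] that by simp
      show "h (c \<odot>\<^bsub>Y\<^esub> y) = c \<odot>\<^bsub>V\<^esub> h y" if "y \<in> carrier Y" for c y
        using unique[OF h Rscale[OF h]] that by simp
    qed
    show "h (f x) = g x" if "x \<in> carrier X" for x
      using unique[OF h[OF rat_linear_closed[OF f(1) that]] Rfg[OF that]] .
    show "\<beta> (h y) = k y" if "y \<in> carrier Y" for y using R\<beta>[OF h[OF that]] .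
  qed
qed

lemma linear_extension:
  assumes X: "rational_space X" and Y: "rational_space Y" and V: "rational_space V"
    and f: "f \<in> rat_linear X Y" "inj_on f (carrier X)"
    and g: "g \<in> rat_linear X V"
  obtains h where "h \<in> rat_linear Y V" and "\<And>x. x \<in> carrier X \<Longrightarrow> h (f x) = g x"
proof -
  \<comment> \<open>over the zero space, the condition on the image is void\<close>
  define W :: "unit rat_space" where
    "W = \<lparr>carrier = UNIV, monoid.mult = undefined, one = undefined, zero = (), add = (\<lambda>_ _. ()), smult = (\<lambda>_ _. ())\<rparr>"
  have "rational_space W" by (rule rational_spaceI) (simp_all add: W_def)
  moreover have "(\<lambda>_. ()) ` carrier V = carrier W"
    using abelian_group.axioms(1)[OF module.axioms(2)[OF V[unfolded rational_space_module]]]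
    by (auto simp: W_def intro: abelian_monoid.zero_closed)
  ultimately show thesis
    using that extension_with_prescribed_image[OF X Y V, of W f g "\<lambda>_. ()" "\<lambda>_. ()"] f g
    by (auto simp: W_def rat_linear_def)
qed

text \<open>The mean of the conjugates of \<open>h\<close> under a finite group is equivariant, and it keeps every value of
  \<open>h\<close>, and every value of \<open>\<beta> \<circ> h\<close> for an invariant \<open>\<beta>\<close>, that all conjugates have in common.\<close>

lemma equivariant_average:
  fixes C (structure)
  assumes C: "group C" and fin: "finite (carrier C)"
    and Y: "rational_space Y" and V: "rational_space V"
    and S: "\<And>a. a \<in> carrier C \<Longrightarrow> S a \<in> rat_linear Y Y"
    and S_mult: "\<And>a b y. a \<in> carrier C \<Longrightarrow> b \<in> carrier C \<Longrightarrow> y \<in> carrier Y \<Longrightarrow> S (a \<otimes> b) y = S a (S b y)"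
    and T: "\<And>a. a \<in> carrier C \<Longrightarrow> T a \<in> rat_linear V V"
    and T_mult: "\<And>a b v. a \<in> carrier C \<Longrightarrow> b \<in> carrier C \<Longrightarrow> v \<in> carrier V \<Longrightarrow> T (a \<otimes> b) v = T a (T b v)"
    and h: "h \<in> rat_linear Y V"
    and W: "rational_space W" and \<beta>: "\<beta> \<in> rat_linear V W"
  obtains k where "k \<in> rat_linear Y V"
    and "\<And>a y. a \<in> carrier C \<Longrightarrow> y \<in> carrier Y \<Longrightarrow> k (S a y) = T a (k y)"
    and "\<And>y v. y \<in> carrier Y \<Longrightarrow> v \<in> carrier V \<Longrightarrow>
      (\<And>a. a \<in> carrier C \<Longrightarrow> T a (h (S (inv a) y)) = v) \<Longrightarrow> k y = v"
    and "\<And>y w. y \<in> carrier Y \<Longrightarrow> w \<in> carrier W \<Longrightarrow>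
      (\<And>a. a \<in> carrier C \<Longrightarrow> \<beta> (T a (h (S (inv a) y))) = w) \<Longrightarrow> \<beta> (k y) = w"
proof -
  interpret C: group C by fact
  interpret V: rational_space V by fact
  define u where "u a y = T a (h (S (inv a) y))" for a y
  define k where "k y = (1 / of_nat (card (carrier C))) \<odot>\<^bsub>V\<^esub> finsum V (\<lambda>a. u a y) (carrier C)" for y
  have card: "(1 / of_nat (card (carrier C))) * (of_nat (card (carrier C)) :: rat) = 1"
    using fin C.one_closed by (auto simp: card_eq_0_iff)
  have u: "u a \<in> rat_linear Y V" if "a \<in> carrier C" for a
    unfolding u_def using that by (intro rat_linear_comp[OF rat_linear_comp[OF S h] T]) auto
  have u_closed: "(\<lambda>a. u a y) \<in> carrier C \<rightarrow> carrier V" if "y \<in> carrier Y" for y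
    using u that by (auto intro: rat_linear_closed)
  have k: "k \<in> rat_linear Y V"
    unfolding k_def[abs_def] by (intro rat_linear_scaled rat_linear_finsum V Y fin u)
  show thesis
  proof (rule that[OF k])
    fix b y assume b: "b \<in> carrier C" and y: "y \<in> carrier Y"
    have shift: "T b (u a y) = u (b \<otimes> a) (S b y)" if a: "a \<in> carrier C" for a
    proof -
      have y': "S c y \<in> carrier Y" if "c \<in> carrier C" for c using rat_linear_closed[OF S[OF that] y] .
      have "S (inv (b \<otimes> a)) (S b y) = S (inv (b \<otimes> a) \<otimes> b) y"
        using a b y S_mult by simp
      also have "inv (b \<otimes> a) \<otimes> b = inv a" using a b by (simp add: C.inv_mult_group C.m_assoc)
      finally show ?thesis
        unfolding u_def using a b y' T_mult rat_linear_closed[OF h] by simp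
    qed
    have Sby: "S b y \<in> carrier Y" using rat_linear_closed[OF S[OF b] y] .
    have bij: "(\<lambda>a. b \<otimes> a) ` carrier C = carrier C" "inj_on (\<lambda>a. b \<otimes> a) (carrier C)"
      using b C.surj_const_mult C.inj_on_cmult by auto
    have "T b (k y) = (1 / of_nat (card (carrier C))) \<odot>\<^bsub>V\<^esub> T b (finsum V (\<lambda>a. u a y) (carrier C))"
      unfolding k_def using b u_closed[OF y] by (intro rat_linear_scale[OF T]) simp_all
    also have "T b (finsum V (\<lambda>a. u a y) (carrier C)) = finsum V (\<lambda>a. T b (u a y)) (carrier C)"
      by (rule rat_linear_finsum_arg[OF V V T[OF b] fin u_closed[OF y]])
    also have "\<dots> = finsum V (\<lambda>a. u (b \<otimes> a) (S b y)) (carrier C)"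
      using u_closed[OF Sby] b by (intro V.M.finsum_cong') (auto simp: shift)
    also have "\<dots> = finsum V (\<lambda>a. u a (S b y)) ((\<lambda>a. b \<otimes> a) ` carrier C)"
      using u_closed[OF Sby] bij by (intro V.M.finsum_reindex[symmetric]) auto
    finally show "k (S b y) = T b (k y)" unfolding k_def bij by simp
  next
    fix y v assume y: "y \<in> carrier Y" and v: "v \<in> carrier V"
      and "\<And>a. a \<in> carrier C \<Longrightarrow> T a (h (S (inv a) y)) = v"
    then have "finsum V (\<lambda>a. u a y) (carrier C) = finsum V (\<lambda>_. v) (carrier C)"
      by (intro V.M.finsum_cong') (auto simp: u_def)
    then show "k y = v"
      unfolding k_def using v fin card by (simp add: V.finsum_constant V.scale_scale V.scale_one)
  next
    fix y w
    assume y: "y \<in> carrier Y" and w: "w \<in> carrier W"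
      and eq: "\<And>a. a \<in> carrier C \<Longrightarrow> \<beta> (T a (h (S (inv a) y))) = w"
    interpret W: rational_space W by fact
    have "\<beta> (finsum V (\<lambda>a. u a y) (carrier C)) = finsum W (\<lambda>a. \<beta> (u a y)) (carrier C)"
      by (rule rat_linear_finsum_arg[OF V W \<beta> fin u_closed[OF y]])
    also have "\<dots> = finsum W (\<lambda>_. w) (carrier C)"
      using w by (intro W.M.finsum_cong') (auto simp: u_def eq)
    finally show "\<beta> (k y) = w"
      unfolding k_def using w fin card u_closed[OF y]
      by (simp add: rat_linear_scale[OF \<beta>] W.finsum_constant W.scale_scale W.scale_one)
  qed
qed

section \<open>Diagrams of rational vector spaces\<close>

lemma vec_diagram_space:
  "vec_diagram G V \<Longrightarrow> subgroup H G \<Longrightarrow> rational_space (ob V H n)"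
  by (simp add: vec_diagram_def rational_space_module)

lemma vec_diagram_linear:
  "vec_diagram G V \<Longrightarrow> subgroup H G \<Longrightarrow> subgroup K G \<Longrightarrow> \<phi> \<in> orbit_hom G H K \<Longrightarrow>
   mor V H K \<phi> n \<in> rat_linear (ob V H n) (ob V K n)"
  unfolding vec_diagram_def by blast

lemma vec_diagram_closed:
  "vec_diagram G V \<Longrightarrow> subgroup H G \<Longrightarrow> subgroup K G \<Longrightarrow> \<phi> \<in> orbit_hom G H K \<Longrightarrow>
   x \<in> carrier (ob V H n) \<Longrightarrow> mor V H K \<phi> n x \<in> carrier (ob V K n)"
  by (rule rat_linear_closed[OF vec_diagram_linear])

lemma vec_diagram_id:
  "vec_diagram G V \<Longrightarrow> subgroup H G \<Longrightarrow> x \<in> carrier (ob V H n) \<Longrightarrow>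
   mor V H H (\<lambda>S\<in>lcosets\<^bsub>G\<^esub> H. S) n x = x"
  unfolding vec_diagram_def by blast

lemma vec_diagram_comp:
  "vec_diagram G V \<Longrightarrow> subgroup H G \<Longrightarrow> subgroup K G \<Longrightarrow> subgroup L G \<Longrightarrow>
   \<phi> \<in> orbit_hom G H K \<Longrightarrow> \<psi> \<in> orbit_hom G K L \<Longrightarrow> x \<in> carrier (ob V H n) \<Longrightarrow>
   mor V K L \<psi> n (mor V H K \<phi> n x) = mor V H L (compose (lcosets\<^bsub>G\<^esub> H) \<psi> \<phi>) n x"
  unfolding vec_diagram_def by simp

lemma vec_hom_linear:
  "f \<in> vec_hom G X Y \<Longrightarrow> subgroup H G \<Longrightarrow> f H n \<in> rat_linear (ob X H n) (ob Y H n)"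
  by (simp add: vec_hom_def)

lemma vec_hom_closed:
  "f \<in> vec_hom G X Y \<Longrightarrow> subgroup H G \<Longrightarrow> x \<in> carrier (ob X H n) \<Longrightarrow> f H n x \<in> carrier (ob Y H n)"
  by (rule rat_linear_closed[OF vec_hom_linear])

lemma vec_hom_natural:
  "f \<in> vec_hom G X Y \<Longrightarrow> subgroup H G \<Longrightarrow> subgroup K G \<Longrightarrow> \<phi> \<in> orbit_hom G H K \<Longrightarrow>
   x \<in> carrier (ob X H n) \<Longrightarrow> f K n (mor X H K \<phi> n x) = mor Y H K \<phi> n (f H n x)"
  by (simp add: vec_hom_def)

lemma vec_homI:
  assumes "\<And>H n. subgroup H G \<Longrightarrow> f H n \<in> rat_linear (ob X H n) (ob Y H n)"
    and "\<And>H K \<phi> n x. subgroup H G \<Longrightarrow> subgroup K G \<Longrightarrow> \<phi> \<in> orbit_hom G H K \<Longrightarrow>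
      x \<in> carrier (ob X H n) \<Longrightarrow> f K n (mor X H K \<phi> n x) = mor Y H K \<phi> n (f H n x)"
  shows "f \<in> vec_hom G X Y"
  using assms by (simp add: vec_hom_def)

lemma vec_injective_extend:
  fixes X Y :: "('g, 'x graded_space, 'x) diagram"
  assumes "vec_injective TYPE('x) G I"
    and "vec_diagram G X" "vec_diagram G Y" "f \<in> vec_hom G X Y"
    and "\<And>H n. subgroup H G \<Longrightarrow> inj_on (f H n) (carrier (ob X H n))"
    and "g \<in> vec_hom G X I"
  obtains h where "h \<in> vec_hom G Y I"
    and "\<And>H n x. subgroup H G \<Longrightarrow> x \<in> carrier (ob X H n) \<Longrightarrow> h H n (f H n x) = g H n x"
proof -
  have "\<exists>h \<in> vec_hom G Y I. \<forall>H n. subgroup H G \<longrightarrow>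
      (\<forall>x\<in>carrier (ob X H n). h H n (f H n x) = g H n x)"
    using assms(1)[unfolded vec_injective_def] assms(2-6) by simp
  then show thesis using that by blast
qed

lemma vec_injectiveI:
  fixes I :: "('g, 'v graded_space, 'v) diagram"
  assumes "vec_diagram G I"
    and "\<And>(X :: ('g, 'x graded_space, 'x) diagram) (Y :: ('g, 'x graded_space, 'x) diagram) f g.
      vec_diagram G X \<Longrightarrow> vec_diagram G Y \<Longrightarrow> f \<in> vec_hom G X Y \<Longrightarrow>
      (\<And>H n. subgroup H G \<Longrightarrow> inj_on (f H n) (carrier (ob X H n))) \<Longrightarrow> g \<in> vec_hom G X I \<Longrightarrow>
      \<exists>h \<in> vec_hom G Y I. \<forall>H n. subgroup H G \<longrightarrow> (\<forall>x\<in>carrier (ob X H n). h H n (f H n x) = g H n x)"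
  shows "vec_injective TYPE('x) G I"
  using assms unfolding vec_injective_def by blast

lemma orbit_homD:
  assumes "\<phi> \<in> orbit_hom G' H K"
  shows "S \<in> lcosets\<^bsub>G'\<^esub> H \<Longrightarrow> \<phi> S \<in> lcosets\<^bsub>G'\<^esub> K"
    and "g \<in> carrier G' \<Longrightarrow> S \<in> lcosets\<^bsub>G'\<^esub> H \<Longrightarrow> \<phi> (g <#\<^bsub>G'\<^esub> S) = g <#\<^bsub>G'\<^esub> \<phi> S"
    and "\<phi> \<in> extensional (lcosets\<^bsub>G'\<^esub> H)"
  using assms by (auto simp: orbit_hom_def PiE_def)

lemma orbit_homI:
  assumes "\<And>S. S \<in> lcosets\<^bsub>G'\<^esub> H \<Longrightarrow> \<phi> S \<in> lcosets\<^bsub>G'\<^esub> K"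
    and "\<And>g S. g \<in> carrier G' \<Longrightarrow> S \<in> lcosets\<^bsub>G'\<^esub> H \<Longrightarrow> \<phi> (g <#\<^bsub>G'\<^esub> S) = g <#\<^bsub>G'\<^esub> \<phi> S"
    and "\<phi> \<in> extensional (lcosets\<^bsub>G'\<^esub> H)"
  shows "\<phi> \<in> orbit_hom G' H K"
  using assms by (simp add: orbit_hom_def PiE_def Pi_def)

lemma (in group) l_coset_in_lcosets:
  assumes "subgroup H G" "g \<in> carrier G" "S \<in> lcosets H"
  shows "g <# S \<in> lcosets H"
  using assms lcos_m_assoc[OF subgroup.subset[OF assms(1)]] by (fastforce simp: LCOSETS_def)

lemma orbit_hom_compose:
  assumes "group G" "subgroup H G" "\<phi> \<in> orbit_hom G H K" "\<psi> \<in> orbit_hom G K L"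
  shows "compose (lcosets\<^bsub>G\<^esub> H) \<psi> \<phi> \<in> orbit_hom G H L"
proof -
  interpret group G by fact
  show ?thesis
    using assms(3,4) l_coset_in_lcosets[OF assms(2)] by (auto simp: orbit_hom_def compose_def PiE_iff extensional_def)
qed

lemma orbit_hom_id:
  assumes "group G" "subgroup H G"
  shows "(\<lambda>S\<in>lcosets\<^bsub>G\<^esub> H. S) \<in> orbit_hom G H H"
proof -
  interpret group G by fact
  show ?thesis using l_coset_in_lcosets[OF assms(2)] by (auto simp: orbit_hom_def)
qed

definition to_point :: "('g, 'm) monoid_scheme \<Rightarrow> 'g set \<Rightarrow> 'g set \<Rightarrow> 'g set" where
  "to_point G H = (\<lambda>S\<in>lcosets\<^bsub>G\<^esub> H. carrier G)"

lemma (in group) l_coset_carrier_eq: "g \<in> carrier G \<Longrightarrow> g <# carrier G = carrier G"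
  using coset_join3[OF _ subgroup_self] by simp

lemma (in group) lcosets_carrier_eq: "lcosets (carrier G) = {carrier G}"
  using l_coset_carrier_eq one_closed by (auto simp: LCOSETS_def)

lemma (in group) orbit_hom_to_point:
  assumes "subgroup H G"
  shows "orbit_hom G H (carrier G) = {to_point G H}"
proof
  show "orbit_hom G H (carrier G) \<subseteq> {to_point G H}"
    unfolding orbit_hom_def lcosets_carrier_eq to_point_def
    by (auto simp: PiE_iff extensional_def fun_eq_iff)
  show "{to_point G H} \<subseteq> orbit_hom G H (carrier G)"
    unfolding orbit_hom_def lcosets_carrier_eq to_point_def
    using l_coset_carrier_eq l_coset_in_lcosets[OF assms] by auto
qed

lemma (in group) orbit_hom_from_point:
  assumes "subgroup K G" "\<phi> \<in> orbit_hom G (carrier G) K"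
  shows "K = carrier G"
proof -
  have "\<phi> (carrier G) \<in> lcosets K" using assms(2) by (auto simp: orbit_hom_def lcosets_carrier_eq)
  then obtain a where a: "a \<in> carrier G" "\<phi> (carrier G) = a <# K" by (auto simp: LCOSETS_def)
  have K: "K \<subseteq> carrier G" using assms(1) by (rule subgroup.subset)
  have "x \<in> K" if x: "x \<in> carrier G" for x
  proof -
    \<comment> \<open>every group element fixes the point \<open>G/G\<close>, hence also its image \<open>a K\<close>; for \<open>a x a\<inverse>\<close> this says \<open>x \<in> K\<close>\<close>
    have "\<phi> (g <# carrier G) = g <# \<phi> (carrier G)" if "g \<in> carrier G" for g
      using assms(2) that by (simp add: orbit_hom_def lcosets_carrier_eq)
    from this[of "a \<otimes> x \<otimes> inv a"] have "(a \<otimes> x \<otimes> inv a) <# \<phi> (carrier G) = \<phi> (carrier G)"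
      using a x l_coset_carrier_eq by simp
    then have "(a \<otimes> x) <# K = a <# K"
      using a x K by (simp add: lcos_m_assoc m_assoc)
    then have "a \<otimes> x \<in> a <# K"
      using lcos_self[OF _ assms(1), of "a \<otimes> x"] a x by simp
    then have "inv a \<otimes> (a \<otimes> x) \<in> K" by (rule subgroup.lcos_module_imp[OF assms(1) is_group a(1)])
    then show ?thesis using a x by (simp add: m_assoc[symmetric])
  qed
  then show ?thesis using K by blast
qed

lemma (in group) compose_to_point:
  assumes "subgroup H G" "\<phi> \<in> orbit_hom G H K"
  shows "compose (lcosets H) (to_point G K) \<phi> = to_point G H"
  using assms by (auto simp: compose_def to_point_def orbit_hom_def fun_eq_iff)

section \<open>Injectivity over groups of prime order\<close>

text \<open>Lifting against the inclusion of the diagram with one line \<open>\<rat>\<close>, placed at \<open>G/G\<close>, into the constant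
  diagram \<open>\<rat>\<close> gives a preimage of any element of \<open>I(G/G)\<close> in \<open>I(G/H)\<close>. An infinite type has room for a
  copy of \<open>\<rat>\<close>, so the test objects exist over every such type.\<close>

lemma surjective_to_point_if_vec_injective:
  fixes I :: "('g, 'v graded_space, 'v) diagram"
  assumes G: "group G" and inf: "infinite (UNIV :: 'x set)"
    and inj: "vec_injective TYPE('x) G I" and H: "subgroup H G"
  shows "mor I H (carrier G) (to_point G H) n ` carrier (ob I H n) = carrier (ob I (carrier G) n)"
proof -
  interpret G: group G by fact
  have I: "vec_diagram G I" using inj by (simp add: vec_injective_def)
  have top: "subgroup (carrier G) G" by (rule G.subgroup_self)
  have pt: "to_point G K \<in> orbit_hom G K (carrier G)" if "subgroup K G" for K
    using G.orbit_hom_to_point[OF that] by simp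
  have pt_top: "to_point G (carrier G) = (\<lambda>S\<in>lcosets\<^bsub>G\<^esub> carrier G. S)"
    unfolding to_point_def G.lcosets_carrier_eq by (auto simp: fun_eq_iff)
  obtain e :: "nat \<Rightarrow> 'x" where "inj e" using inf infinite_countable_subset by blast
  then have "inj (e \<circ> (to_nat :: rat \<Rightarrow> nat))" by (rule inj_compose) (rule inj_to_nat)
  then obtain \<iota> :: "rat \<Rightarrow> 'x" where \<iota>: "inj \<iota>" by blast
  define \<rho> where "\<rho> = inv_into UNIV \<iota>"
  have \<rho>: "\<rho> (\<iota> c) = c" for c using \<iota> by (simp add: \<rho>_def)
  define line :: "rat set \<Rightarrow> 'x rat_space" where
    "line B = \<lparr>carrier = \<iota> ` B, monoid.mult = undefined, one = undefined, zero = \<iota> 0,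
       add = (\<lambda>x y. \<iota> (\<rho> x + \<rho> y)), smult = (\<lambda>c x. \<iota> (c * \<rho> x))\<rparr>" for B
  have line: "rational_space (line B)" if "B = UNIV \<or> B = {0}" for B
    using that by (intro rational_spaceI) (auto simp: line_def \<rho> algebra_simps)
  define X :: "('g, 'x graded_space, 'x) diagram" where
    "X = \<lparr>ob = (\<lambda>K m. line (if m = n \<and> K = carrier G then UNIV else {0})), mor = (\<lambda>_ _ _ _ x. x)\<rparr>"
  define Y :: "('g, 'x graded_space, 'x) diagram" where
    "Y = \<lparr>ob = (\<lambda>K m. line (if m = n then UNIV else {0})), mor = (\<lambda>_ _ _ _ x. x)\<rparr>"
  have id_lin: "(\<lambda>x. x) \<in> rat_linear (line B) (line B')" if "B \<subseteq> B'" for B B'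
    using that by (auto simp: rat_linear_def line_def)
  have X: "vec_diagram G X"
    unfolding vec_diagram_def rational_space_module[symmetric]
    using G.orbit_hom_from_point by (auto simp: X_def line intro!: id_lin)
  have Y: "vec_diagram G Y"
    unfolding vec_diagram_def rational_space_module[symmetric] by (auto simp: Y_def line intro!: id_lin)
  show ?thesis
  proof
    show "mor I H (carrier G) (to_point G H) n ` carrier (ob I H n) \<subseteq> carrier (ob I (carrier G) n)"
      using vec_diagram_closed[OF I H top pt[OF H]] by blast
    show "carrier (ob I (carrier G) n) \<subseteq> mor I H (carrier G) (to_point G H) n ` carrier (ob I H n)"
    proof
      fix y assume y: "y \<in> carrier (ob I (carrier G) n)"
      define g where "g K m x = (if m = n \<and> K = carrier G then \<rho> x \<odot>\<^bsub>ob I K m\<^esub> y else \<zero>\<^bsub>ob I K m\<^esub>)" for K m x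
      have sp: "rational_space (ob I K m)" if "subgroup K G" for K m using vec_diagram_space[OF I that] .
      have g: "g \<in> vec_hom G X I"
      proof (rule vec_homI)
        fix K m assume K: "subgroup K G"
        interpret K: rational_space "ob I K m" by (rule sp[OF K])
        show "g K m \<in> rat_linear (ob X K m) (ob I K m)"
        proof (cases "m = n \<and> K = carrier G")
          case True
          interpret T: rational_space "ob I (carrier G) n" by (rule sp[OF top])
          show ?thesis
            using True y
            by (intro rat_linearI) (auto simp: g_def X_def line_def \<rho> T.scale_add T.scale_scale)
        next
          case False
          then show ?thesis by (intro rat_linearI) (auto simp: g_def K.scale_zero_right)
        qed
      next
        fix K L \<phi> m x
        assume K: "subgroup K G" and L: "subgroup L G" and \<phi>: "\<phi> \<in> orbit_hom G K L" and x: "x \<in> carrier (ob X K m)"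
        interpret L: rational_space "ob I L m" by (rule sp[OF L])
        have zero: "mor I K L \<phi> m \<zero>\<^bsub>ob I K m\<^esub> = \<zero>\<^bsub>ob I L m\<^esub>"
          by (rule rat_linear_zero[OF sp[OF K] sp[OF L] vec_diagram_linear[OF I K L \<phi>]])
        show "g L m (mor X K L \<phi> m x) = mor I K L \<phi> m (g K m x)"
        proof (cases "m = n \<and> K = carrier G")
          case True
          then have "L = carrier G" using G.orbit_hom_from_point[OF L] \<phi> by simp
          moreover from this have "\<phi> = (\<lambda>S\<in>lcosets\<^bsub>G\<^esub> carrier G. S)"
            using \<phi> True G.orbit_hom_to_point[OF top] pt_top by simp
          ultimately show ?thesis
            using True y vec_diagram_id[OF I top] L.scale_closed[of y] by (simp add: g_def X_def)
        next
          case False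
          then have "x = \<iota> 0" using x by (simp add: X_def line_def split: if_splits)
          moreover have "0 \<odot>\<^bsub>ob I (carrier G) n\<^esub> y = \<zero>\<^bsub>ob I (carrier G) n\<^esub>"
            using rational_space.scale_zero_left[OF sp[OF top] y] .
          ultimately show ?thesis using False zero \<rho> by (auto simp: g_def X_def)
        qed
      qed
      have f: "(\<lambda>_ _ x. x) \<in> vec_hom G X Y"
        by (rule vec_homI) (auto simp: X_def Y_def intro!: id_lin)
      obtain h where h: "h \<in> vec_hom G Y I"
        and hg: "\<And>K m x. subgroup K G \<Longrightarrow> x \<in> carrier (ob X K m) \<Longrightarrow> h K m x = g K m x"
        using vec_injective_extend[OF inj X Y f _ g] by auto
      have one: "\<iota> 1 \<in> carrier (ob Y H n)" "\<iota> 1 \<in> carrier (ob X (carrier G) n)"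
        by (auto simp: Y_def X_def line_def)
      have "y = h (carrier G) n (\<iota> 1)"
        using hg[OF top one(2)] y \<rho> rational_space.scale_one[OF sp[OF top]] by (simp add: g_def)
      also have "\<dots> = mor I H (carrier G) (to_point G H) n (h H n (\<iota> 1))"
        using vec_hom_natural[OF h H top pt[OF H] one(1)] by (simp add: Y_def)
      finally show "y \<in> mor I H (carrier G) (to_point G H) n ` carrier (ob I H n)"
        using vec_hom_closed[OF h H one(1)] by blast
    qed
  qed
qed

lemma subgroup_of_prime_order_group:
  fixes C (structure)
  assumes "group C" "prime (order C)" "subgroup H C"
  shows "H = {\<one>} \<or> H = carrier C"
proof -
  interpret group C by fact
  have fin: "finite (carrier C)"
    using assms(2) prime_gt_0_nat unfolding order_def by (metis card_gt_0_iff)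
  have "card H dvd order C" using lagrange[OF assms(3)] by (metis dvd_triv_right)
  then have "card H = 1 \<or> card H = card (carrier C)"
    using assms(2) unfolding order_def by (simp add: prime_nat_iff)
  moreover have "H \<subseteq> carrier C" "\<one> \<in> H" using assms(3) by (simp_all add: subgroup.subset subgroup.one_closed)
  ultimately show ?thesis using fin card_subset_eq by (metis card_1_singletonE singletonD)
qed

text \<open>The automorphisms of the free orbit of an abelian group.\<close>

definition translation :: "('g, 'm) monoid_scheme \<Rightarrow> 'g \<Rightarrow> 'g set \<Rightarrow> 'g set" where
  "translation C a = (\<lambda>S\<in>lcosets\<^bsub>C\<^esub> {\<one>\<^bsub>C\<^esub>}. a <#\<^bsub>C\<^esub> S)"

context comm_group
begin

lemma lcosets_one: "lcosets {\<one>} = (\<lambda>c. {c}) ` carrier G"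
  by (auto simp: LCOSETS_def l_coset_def)

lemma l_coset_singleton: "a <# {c} = {a \<otimes> c}"
  by (auto simp: l_coset_def)

lemma translation_in_orbit_hom: "a \<in> carrier G \<Longrightarrow> translation G a \<in> orbit_hom G {\<one>} {\<one>}"
  unfolding orbit_hom_def translation_def lcosets_one by (auto simp: l_coset_singleton m_lcomm)

lemma orbit_hom_translation:
  assumes "\<phi> \<in> orbit_hom G {\<one>} {\<one>}"
  obtains a where "a \<in> carrier G" "\<phi> = translation G a"
proof -
  have "\<phi> {\<one>} \<in> lcosets {\<one>}" using assms one_closed by (auto simp: orbit_hom_def lcosets_one)
  then obtain a where a: "a \<in> carrier G" "\<phi> {\<one>} = {a}" by (auto simp: lcosets_one)
  have "\<phi> {c} = {a \<otimes> c}" if c: "c \<in> carrier G" for c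
  proof -
    have "\<phi> (c <# {\<one>}) = c <# \<phi> {\<one>}" using assms c one_closed by (auto simp: orbit_hom_def lcosets_one)
    then show ?thesis using a c by (simp add: l_coset_singleton m_comm)
  qed
  then have "\<phi> = translation G a"
    using assms by (auto simp: orbit_hom_def translation_def lcosets_one l_coset_singleton PiE_iff extensional_def fun_eq_iff)
  then show thesis using a that by blast
qed

lemma translation_compose:
  "a \<in> carrier G \<Longrightarrow> b \<in> carrier G \<Longrightarrow>
   compose (lcosets {\<one>}) (translation G a) (translation G b) = translation G (a \<otimes> b)"
  by (auto simp: compose_def translation_def lcosets_one l_coset_singleton m_assoc fun_eq_iff)

lemma translation_one: "translation G \<one> = (\<lambda>S\<in>lcosets {\<one>}. S)"
  by (auto simp: translation_def lcosets_one l_coset_singleton fun_eq_iff)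

end

text \<open>The values of an extension at \<open>C/C\<close> are chosen first. At \<open>C/1\<close> they are then chosen
  compatibly, which is possible by surjectivity, and made equivariant by averaging over \<open>C\<close>.\<close>

lemma vec_injective_if_surjective_to_point:
  fixes C (structure) and I :: "('c, 'v graded_space, 'v) diagram"
  assumes C: "comm_group C" and prime: "prime (order C)" and I: "vec_diagram C I"
    and sur: "\<And>n. mor I {\<one>} (carrier C) (to_point C {\<one>}) n ` carrier (ob I {\<one>} n) = carrier (ob I (carrier C) n)"
  shows "vec_injective TYPE('y) C I"
proof (rule vec_injectiveI[OF I])
  fix X Y :: "('c, 'y graded_space, 'y) diagram" and f g
  assume X: "vec_diagram C X" and Y: "vec_diagram C Y" and f: "f \<in> vec_hom C X Y"
    and f_inj: "\<And>H n. subgroup H C \<Longrightarrow> inj_on (f H n) (carrier (ob X H n))" and g: "g \<in> vec_hom C X I"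
  interpret C: comm_group C by fact
  let ?t = "carrier C" and ?p = "to_point C {\<one>}" and ?\<tau> = "translation C"
  have fin: "finite (carrier C)"
    using prime prime_gt_0_nat unfolding order_def by (metis card_gt_0_iff)
  have ne: "{\<one>} \<noteq> carrier C"
    using prime unfolding order_def by (metis is_singletonI is_singleton_altdef not_prime_1)
  have e: "subgroup {\<one>} C" and t: "subgroup ?t C" using C.triv_subgroup C.subgroup_self by auto
  have p: "?p \<in> orbit_hom C {\<one>} ?t" using C.orbit_hom_to_point[OF e] by simp
  note \<tau> = C.translation_in_orbit_hom
  have \<tau>_mult: "mor V {\<one>} {\<one>} (?\<tau> (a \<otimes> b)) n v = mor V {\<one>} {\<one>} (?\<tau> a) n (mor V {\<one>} {\<one>} (?\<tau> b) n v)"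
    if "vec_diagram C V" "a \<in> carrier C" "b \<in> carrier C" "v \<in> carrier (ob V {\<one>} n)"
    for V :: "('c, 'u graded_space, 'u) diagram" and a b n v
    using vec_diagram_comp[OF that(1) e e e \<tau>[OF that(3)] \<tau>[OF that(2)] that(4)] C.translation_compose that by simp
  have \<tau>_inv: "mor V {\<one>} {\<one>} (?\<tau> a) n (mor V {\<one>} {\<one>} (?\<tau> (inv a)) n v) = v"
    if "vec_diagram C V" "a \<in> carrier C" "v \<in> carrier (ob V {\<one>} n)"
    for V :: "('c, 'u graded_space, 'u) diagram" and a n v
    using \<tau>_mult[OF that(1,2) _ that(3), of "inv a"] vec_diagram_id[OF that(1) e that(3)] that C.translation_one by simp
  have p_\<tau>: "mor V {\<one>} ?t ?p n (mor V {\<one>} {\<one>} (?\<tau> a) n v) = mor V {\<one>} ?t ?p n v"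
    if "vec_diagram C V" "a \<in> carrier C" "v \<in> carrier (ob V {\<one>} n)"
    for V :: "('c, 'u graded_space, 'u) diagram" and a n v
    using vec_diagram_comp[OF that(1) e e t \<tau>[OF that(2)] p that(3)] C.compose_to_point[OF e \<tau>[OF that(2)]] by simp
  have "\<exists>ht he. ht \<in> rat_linear (ob Y ?t n) (ob I ?t n) \<and> he \<in> rat_linear (ob Y {\<one>} n) (ob I {\<one>} n) \<and>
      (\<forall>x\<in>carrier (ob X ?t n). ht (f ?t n x) = g ?t n x) \<and>
      (\<forall>x\<in>carrier (ob X {\<one>} n). he (f {\<one>} n x) = g {\<one>} n x) \<and>
      (\<forall>y\<in>carrier (ob Y {\<one>} n). mor I {\<one>} ?t ?p n (he y) = ht (mor Y {\<one>} ?t ?p n y)) \<and>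
      (\<forall>a\<in>carrier C. \<forall>y\<in>carrier (ob Y {\<one>} n).
         he (mor Y {\<one>} {\<one>} (?\<tau> a) n y) = mor I {\<one>} {\<one>} (?\<tau> a) n (he y))" for n
  proof -
    note sp = vec_diagram_space
    obtain ht where ht: "ht \<in> rat_linear (ob Y ?t n) (ob I ?t n)"
      and htg: "\<And>x. x \<in> carrier (ob X ?t n) \<Longrightarrow> ht (f ?t n x) = g ?t n x"
      using linear_extension[OF sp[OF X t] sp[OF Y t] sp[OF I t] vec_hom_linear[OF f t] f_inj[OF t] vec_hom_linear[OF g t]]
      by blast
    let ?\<beta> = "mor I {\<one>} ?t ?p n" and ?k = "\<lambda>y. ht (mor Y {\<one>} ?t ?p n y)"
    have \<beta>: "?\<beta> \<in> rat_linear (ob I {\<one>} n) (ob I ?t n)" by (rule vec_diagram_linear[OF I e t p])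
    have k: "?k \<in> rat_linear (ob Y {\<one>} n) (ob I ?t n)"
      by (rule rat_linear_comp[OF vec_diagram_linear[OF Y e t p] ht])
    have compat: "?\<beta> (g {\<one>} n x) = ?k (f {\<one>} n x)" if "x \<in> carrier (ob X {\<one>} n)" for x
      using vec_hom_natural[OF g e t p that] vec_hom_natural[OF f e t p that]
        htg[OF vec_diagram_closed[OF X e t p that]] by simp
    obtain h0 where h0: "h0 \<in> rat_linear (ob Y {\<one>} n) (ob I {\<one>} n)"
      and h0g: "\<And>x. x \<in> carrier (ob X {\<one>} n) \<Longrightarrow> h0 (f {\<one>} n x) = g {\<one>} n x"
      and h0k: "\<And>y. y \<in> carrier (ob Y {\<one>} n) \<Longrightarrow> ?\<beta> (h0 y) = ?k y"
      using extension_with_prescribed_image[OF sp[OF X e] sp[OF Y e] sp[OF I e] sp[OF I t]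
          vec_hom_linear[OF f e] f_inj[OF e] vec_hom_linear[OF g e] \<beta> sur k compat] by blast
    obtain he where he: "he \<in> rat_linear (ob Y {\<one>} n) (ob I {\<one>} n)"
      and he_eq: "\<And>a y. a \<in> carrier C \<Longrightarrow> y \<in> carrier (ob Y {\<one>} n) \<Longrightarrow>
        he (mor Y {\<one>} {\<one>} (?\<tau> a) n y) = mor I {\<one>} {\<one>} (?\<tau> a) n (he y)"
      and he_val: "\<And>y v. y \<in> carrier (ob Y {\<one>} n) \<Longrightarrow> v \<in> carrier (ob I {\<one>} n) \<Longrightarrow>
        (\<And>a. a \<in> carrier C \<Longrightarrow> mor I {\<one>} {\<one>} (?\<tau> a) n (h0 (mor Y {\<one>} {\<one>} (?\<tau> (inv a)) n y)) = v) \<Longrightarrow> he y = v"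
      and he_img: "\<And>y w. y \<in> carrier (ob Y {\<one>} n) \<Longrightarrow> w \<in> carrier (ob I ?t n) \<Longrightarrow>
        (\<And>a. a \<in> carrier C \<Longrightarrow> ?\<beta> (mor I {\<one>} {\<one>} (?\<tau> a) n (h0 (mor Y {\<one>} {\<one>} (?\<tau> (inv a)) n y))) = w) \<Longrightarrow> ?\<beta> (he y) = w"
    proof (rule equivariant_average[OF C.is_group fin sp[OF Y e] sp[OF I e]
            vec_diagram_linear[OF Y e e \<tau>] \<tau>_mult[OF Y] vec_diagram_linear[OF I e e \<tau>] \<tau>_mult[OF I] h0 sp[OF I t] \<beta>], assumption+, goal_cases)
      case (1 k)
      show ?thesis by (rule that[of k]) (fact 1)+
    qed
    have "he (f {\<one>} n x) = g {\<one>} n x" if x: "x \<in> carrier (ob X {\<one>} n)" for x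
    proof (rule he_val)
      fix a assume a: "a \<in> carrier C"
      then have a': "inv a \<in> carrier C" by simp
      have "h0 (mor Y {\<one>} {\<one>} (?\<tau> (inv a)) n (f {\<one>} n x)) = mor I {\<one>} {\<one>} (?\<tau> (inv a)) n (g {\<one>} n x)"
        using vec_hom_natural[OF f e e \<tau>[OF a'] x] vec_hom_natural[OF g e e \<tau>[OF a'] x]
          h0g[OF vec_diagram_closed[OF X e e \<tau>[OF a'] x]] by simp
      then show "mor I {\<one>} {\<one>} (?\<tau> a) n (h0 (mor Y {\<one>} {\<one>} (?\<tau> (inv a)) n (f {\<one>} n x))) = g {\<one>} n x"
        using \<tau>_inv[OF I a vec_hom_closed[OF g e x]] by simp
    qed (use vec_hom_closed[OF f e x] vec_hom_closed[OF g e x] in auto)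
    moreover have "?\<beta> (he y) = ?k y" if y: "y \<in> carrier (ob Y {\<one>} n)" for y
    proof (rule he_img[OF y])
      show "?k y \<in> carrier (ob I ?t n)" by (rule rat_linear_closed[OF k y])
      fix a assume a: "a \<in> carrier C"
      then have y': "mor Y {\<one>} {\<one>} (?\<tau> (inv a)) n y \<in> carrier (ob Y {\<one>} n)"
        by (intro vec_diagram_closed[OF Y e e \<tau>] y) simp
      show "?\<beta> (mor I {\<one>} {\<one>} (?\<tau> a) n (h0 (mor Y {\<one>} {\<one>} (?\<tau> (inv a)) n y))) = ?k y"
        using p_\<tau>[OF I a rat_linear_closed[OF h0 y']] h0k[OF y'] p_\<tau>[OF Y _ y, of "inv a"] a by simp
    qed
    ultimately show ?thesis using ht htg he he_eq by blast
  qed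
  then obtain ht he where ht: "\<And>n. ht n \<in> rat_linear (ob Y ?t n) (ob I ?t n)"
    and he: "\<And>n. he n \<in> rat_linear (ob Y {\<one>} n) (ob I {\<one>} n)"
    and htg: "\<And>n x. x \<in> carrier (ob X ?t n) \<Longrightarrow> ht n (f ?t n x) = g ?t n x"
    and heg: "\<And>n x. x \<in> carrier (ob X {\<one>} n) \<Longrightarrow> he n (f {\<one>} n x) = g {\<one>} n x"
    and hpt: "\<And>n y. y \<in> carrier (ob Y {\<one>} n) \<Longrightarrow> mor I {\<one>} ?t ?p n (he n y) = ht n (mor Y {\<one>} ?t ?p n y)"
    and h\<tau>: "\<And>n a y. a \<in> carrier C \<Longrightarrow> y \<in> carrier (ob Y {\<one>} n) \<Longrightarrow>
         he n (mor Y {\<one>} {\<one>} (?\<tau> a) n y) = mor I {\<one>} {\<one>} (?\<tau> a) n (he n y)"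
    by metis
  define h where "h H = (if H = ?t then ht else he)" for H
  have [simp]: "h ?t = ht" "h {\<one>} = he" using ne by (auto simp: h_def)
  have cases: "H = {\<one>} \<or> H = ?t" if "subgroup H C" for H
    by (rule subgroup_of_prime_order_group[OF C.is_group prime that])
  have pt_t: "to_point C ?t = (\<lambda>S\<in>lcosets ?t. S)"
    unfolding to_point_def C.lcosets_carrier_eq by (auto simp: fun_eq_iff)
  have "h \<in> vec_hom C Y I"
  proof (rule vec_homI)
    fix H n assume "subgroup H C"
    then show "h H n \<in> rat_linear (ob Y H n) (ob I H n)" using cases ht he by fastforce
  next
    fix H K \<phi> n y
    assume H: "subgroup H C" and K: "subgroup K C" and \<phi>: "\<phi> \<in> orbit_hom C H K" and y: "y \<in> carrier (ob Y H n)"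
    consider "H = ?t" "K = ?t" | "H = {\<one>}" "K = ?t" | "H = {\<one>}" "K = {\<one>}"
      using cases[OF H] cases[OF K] C.orbit_hom_from_point[OF K] \<phi> by blast
    then show "h K n (mor Y H K \<phi> n y) = mor I H K \<phi> n (h H n y)"
    proof cases
      case 1
      then have "\<phi> = (\<lambda>S\<in>lcosets ?t. S)" using \<phi> C.orbit_hom_to_point[OF t] pt_t by simp
      then show ?thesis
        using 1 y vec_diagram_id[OF Y t] vec_diagram_id[OF I t] rat_linear_closed[OF ht] by simp
    next
      case 2
      then have "\<phi> = ?p" using \<phi> C.orbit_hom_to_point[OF e] by simp
      then show ?thesis using 2 y hpt by simp
    next
      case 3
      then obtain a where "a \<in> carrier C" "\<phi> = ?\<tau> a" using \<phi> C.orbit_hom_translation by blast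
      then show ?thesis using 3 y h\<tau> by simp
    qed
  qed
  moreover have "h H n (f H n x) = g H n x" if "subgroup H C" "x \<in> carrier (ob X H n)" for H n x
    using cases[OF that(1)] that(2) htg heg by auto
  ultimately show "\<exists>h \<in> vec_hom C Y I. \<forall>H n. subgroup H C \<longrightarrow> (\<forall>x\<in>carrier (ob X H n). h H n (f H n x) = g H n x)"
    by blast
qed

text \<open>The surjectivity criterion does not mention the type of the test objects.\<close>

corollary vec_injective_change_of_type:
  fixes I :: "('c, 'v graded_space, 'v) diagram"
  assumes C: "comm_group C" and "prime (order C)"
    and "infinite (UNIV :: 'x set)" and inj: "vec_injective TYPE('x) C I"
  shows "vec_injective TYPE('y) C I"
proof -
  interpret C: comm_group C by fact
  show ?thesis
    using assms surjective_to_point_if_vec_injective[OF C.is_group assms(3) inj C.triv_subgroup]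
    by (intro vec_injective_if_surjective_to_point) (auto simp: vec_injective_def)
qed

section \<open>Diagrams pulled back along a surjection of groups\<close>

definition pullback_diagram ::
  "('c, 'n) monoid_scheme \<Rightarrow> ('g \<Rightarrow> 'c) \<Rightarrow> ('c, 'v graded_space, 'v) diagram \<Rightarrow> ('g, 'v graded_space, 'v) diagram" where
  "pullback_diagram C \<pi> I =
    \<lparr>ob = (\<lambda>H. ob I (\<pi> ` H)), mor = (\<lambda>H K \<phi>. mor I (\<pi> ` H) (\<pi> ` K) (orbit_component C \<pi> H \<phi>))\<rparr>"

text \<open>\<open>G/H \<mapsto> C/\<pi>(H)\<close> is a functor on orbits. It has a right adjoint \<open>C/K \<mapsto> G/\<pi>\<inverse>(K)\<close>, whose action on
  morphisms is \<open>lift\<close> below; the unit of the adjunction is the projection \<open>G/H \<rightarrow> G/\<pi>\<inverse>(\<pi>(H))\<close>.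
  In terms of cosets, both functors and the unit just take images and preimages of subsets.\<close>

locale abelian_surjection =
  G: group G + C: comm_group C for G :: "('g, 'm) monoid_scheme" and C :: "('c, 'n) monoid_scheme" +
  fixes \<pi> :: "'g \<Rightarrow> 'c"
  assumes hom: "\<pi> \<in> hom G C" and surj: "\<pi> ` carrier G = carrier C"
begin

sublocale h: group_hom G C \<pi>
  using hom by unfold_locales

definition preimage :: "'c set \<Rightarrow> 'g set" where
  "preimage T = {g \<in> carrier G. \<pi> g \<in> T}"

definition lift :: "'c set \<Rightarrow> ('c set \<Rightarrow> 'c set) \<Rightarrow> 'g set \<Rightarrow> 'g set" where
  "lift K \<psi> = (\<lambda>S\<in>lcosets\<^bsub>G\<^esub> (preimage K). preimage (\<psi> (\<pi> ` S)))"

definition saturate :: "'g set \<Rightarrow> 'g set \<Rightarrow> 'g set" where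
  "saturate H = (\<lambda>S\<in>lcosets\<^bsub>G\<^esub> H. preimage (\<pi> ` S))"

lemma image_preimage: "T \<subseteq> carrier C \<Longrightarrow> \<pi> ` preimage T = T"
  unfolding surj[symmetric] preimage_def by blast

lemma subgroup_image: "subgroup H G \<Longrightarrow> subgroup (\<pi> ` H) C"
  by (rule h.subgroup_img_is_subgroup)

lemma subgroup_preimage:
  assumes "subgroup K C"
  shows "subgroup (preimage K) G"
proof (rule G.subgroupI)
  have "\<one>\<^bsub>G\<^esub> \<in> preimage K" by (simp add: preimage_def subgroup.one_closed[OF assms])
  then show "preimage K \<noteq> {}" by blast
qed (auto simp: preimage_def subgroup.m_closed[OF assms] subgroup.m_inv_closed[OF assms])

lemma image_preimage_subgroup: "subgroup K C \<Longrightarrow> \<pi> ` preimage K = K"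
  by (rule image_preimage[OF subgroup.subset])

lemma l_coset_preimage:
  assumes g: "g \<in> carrier G" and T: "T \<subseteq> carrier C"
  shows "g <#\<^bsub>G\<^esub> preimage T = preimage (\<pi> g <#\<^bsub>C\<^esub> T)"
proof
  show "g <#\<^bsub>G\<^esub> preimage T \<subseteq> preimage (\<pi> g <#\<^bsub>C\<^esub> T)"
    using g by (auto simp: preimage_def l_coset_def)
  show "preimage (\<pi> g <#\<^bsub>C\<^esub> T) \<subseteq> g <#\<^bsub>G\<^esub> preimage T"
  proof
    fix y assume "y \<in> preimage (\<pi> g <#\<^bsub>C\<^esub> T)"
    then obtain t where y: "y \<in> carrier G" and t: "t \<in> T" "\<pi> y = \<pi> g \<otimes>\<^bsub>C\<^esub> t"
      by (auto simp: preimage_def l_coset_def)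
    have "\<pi> (inv\<^bsub>G\<^esub> g \<otimes>\<^bsub>G\<^esub> y) = t"
      using g y t T by (simp add: C.m_assoc[symmetric] subset_iff)
    then have "inv\<^bsub>G\<^esub> g \<otimes>\<^bsub>G\<^esub> y \<in> preimage T" using g y t by (simp add: preimage_def)
    moreover have "y = g \<otimes>\<^bsub>G\<^esub> (inv\<^bsub>G\<^esub> g \<otimes>\<^bsub>G\<^esub> y)" using g y by (simp add: G.m_assoc[symmetric])
    ultimately show "y \<in> g <#\<^bsub>G\<^esub> preimage T" unfolding l_coset_def by blast
  qed
qed

lemma image_lcosets:
  assumes H: "subgroup H G"
  shows "lcosets\<^bsub>C\<^esub> (\<pi> ` H) = (`) \<pi> ` (lcosets\<^bsub>G\<^esub> H)"
proof -
  have "lcosets\<^bsub>C\<^esub> (\<pi> ` H) = (\<lambda>c. c <#\<^bsub>C\<^esub> (\<pi> ` H)) ` \<pi> ` carrier G"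
    unfolding surj by (auto simp: LCOSETS_def)
  also have "\<dots> = (\<lambda>g. \<pi> ` (g <#\<^bsub>G\<^esub> H)) ` carrier G"
    unfolding image_image using image_l_coset[OF hom _ subgroup.subset[OF H]] by simp
  also have "\<dots> = (`) \<pi> ` (lcosets\<^bsub>G\<^esub> H)" by (auto simp: LCOSETS_def)
  finally show ?thesis .
qed

lemma image_in_lcosets: "subgroup H G \<Longrightarrow> S \<in> lcosets\<^bsub>G\<^esub> H \<Longrightarrow> \<pi> ` S \<in> lcosets\<^bsub>C\<^esub> (\<pi> ` H)"
  by (simp add: image_lcosets)

lemma preimage_in_lcosets:
  assumes "subgroup K C" "T \<in> lcosets\<^bsub>C\<^esub> K"
  shows "preimage T \<in> lcosets\<^bsub>G\<^esub> (preimage K)"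
proof -
  obtain g where "g \<in> carrier G" "T = \<pi> g <#\<^bsub>C\<^esub> K"
    using assms(2) unfolding LCOSETS_def surj[symmetric] by blast
  then show ?thesis using l_coset_preimage[OF _ subgroup.subset[OF assms(1)]] by (auto simp: LCOSETS_def)
qed

lemma image_in_lcosets_preimage:
  assumes "subgroup K C" "S \<in> lcosets\<^bsub>G\<^esub> (preimage K)"
  shows "\<pi> ` S \<in> lcosets\<^bsub>C\<^esub> K"
  using image_in_lcosets[OF subgroup_preimage[OF assms(1)] assms(2)] image_preimage_subgroup[OF assms(1)] by simp

lemma preimage_image_coset:
  assumes "subgroup K C" "S \<in> lcosets\<^bsub>G\<^esub> (preimage K)"
  shows "preimage (\<pi> ` S) = S"
proof -
  obtain g where g: "g \<in> carrier G" "S = g <#\<^bsub>G\<^esub> preimage K" using assms(2) by (auto simp: LCOSETS_def)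
  have "\<pi> ` S = \<pi> g <#\<^bsub>C\<^esub> K"
    using image_l_coset[OF hom g(1) subgroup.subset[OF subgroup_preimage[OF assms(1)]]] g(2)
      image_preimage_subgroup[OF assms(1)] by simp
  then show ?thesis using l_coset_preimage[OF g(1) subgroup.subset[OF assms(1)]] g(2) by simp
qed

lemma image_preimage_coset: "subgroup K C \<Longrightarrow> T \<in> lcosets\<^bsub>C\<^esub> K \<Longrightarrow> \<pi> ` preimage T = T"
  by (rule image_preimage[OF lcoset_subset_carrier[OF C.is_group]])

lemma lift_in_orbit_hom:
  assumes K: "subgroup K C" and L: "subgroup L C" and \<psi>: "\<psi> \<in> orbit_hom C K L"
  shows "lift K \<psi> \<in> orbit_hom G (preimage K) (preimage L)"
proof (rule orbit_homI)
  note K' = subgroup_preimage[OF K]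
  fix S assume S: "S \<in> lcosets\<^bsub>G\<^esub> (preimage K)"
  note img = image_in_lcosets_preimage[OF K S]
  show "lift K \<psi> S \<in> lcosets\<^bsub>G\<^esub> (preimage L)"
    using preimage_in_lcosets[OF L orbit_homD(1)[OF \<psi> img]] S by (simp add: lift_def)
  fix g assume g: "g \<in> carrier G"
  have "preimage (\<psi> (\<pi> ` (g <#\<^bsub>G\<^esub> S))) = preimage (\<pi> g <#\<^bsub>C\<^esub> \<psi> (\<pi> ` S))"
    using image_l_coset[OF hom g lcoset_subset_carrier[OF G.is_group K' S]] orbit_homD(2)[OF \<psi> _ img] g by simp
  also have "\<dots> = g <#\<^bsub>G\<^esub> preimage (\<psi> (\<pi> ` S))"
    using l_coset_preimage[OF g lcoset_subset_carrier[OF C.is_group L orbit_homD(1)[OF \<psi> img]]] by simp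
  finally show "lift K \<psi> (g <#\<^bsub>G\<^esub> S) = g <#\<^bsub>G\<^esub> lift K \<psi> S"
    using S G.l_coset_in_lcosets[OF K' g S] by (simp add: lift_def)
qed (simp add: lift_def)

lemma lift_id: "subgroup K C \<Longrightarrow> lift K (\<lambda>S\<in>lcosets\<^bsub>C\<^esub> K. S) = (\<lambda>S\<in>lcosets\<^bsub>G\<^esub> (preimage K). S)"
  unfolding lift_def by (rule restrict_ext) (simp add: image_in_lcosets_preimage preimage_image_coset)

lemma lift_compose:
  assumes K: "subgroup K C" and L: "subgroup L C"
    and \<phi>: "\<phi> \<in> orbit_hom C K L"
  shows "lift K (compose (lcosets\<^bsub>C\<^esub> K) \<psi> \<phi>) = compose (lcosets\<^bsub>G\<^esub> (preimage K)) (lift L \<psi>) (lift K \<phi>)"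
proof
  fix S
  show "lift K (compose (lcosets\<^bsub>C\<^esub> K) \<psi> \<phi>) S = compose (lcosets\<^bsub>G\<^esub> (preimage K)) (lift L \<psi>) (lift K \<phi>) S"
    using image_in_lcosets_preimage[OF K, of S] orbit_homD(1)[OF \<phi>, of "\<pi> ` S"]
      preimage_in_lcosets[OF L, of "\<phi> (\<pi> ` S)"] image_preimage_coset[OF L, of "\<phi> (\<pi> ` S)"]
    by (auto simp: lift_def compose_def)
qed

lemma saturate_in_orbit_hom:
  assumes H: "subgroup H G"
  shows "saturate H \<in> orbit_hom G H (preimage (\<pi> ` H))"
proof (rule orbit_homI)
  fix S assume S: "S \<in> lcosets\<^bsub>G\<^esub> H"
  note img = image_in_lcosets[OF H S]
  show "saturate H S \<in> lcosets\<^bsub>G\<^esub> (preimage (\<pi> ` H))"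
    using preimage_in_lcosets[OF subgroup_image[OF H] img] S by (simp add: saturate_def)
  fix g assume g: "g \<in> carrier G"
  have "preimage (\<pi> ` (g <#\<^bsub>G\<^esub> S)) = g <#\<^bsub>G\<^esub> preimage (\<pi> ` S)"
    using image_l_coset[OF hom g lcoset_subset_carrier[OF G.is_group H S]]
      l_coset_preimage[OF g lcoset_subset_carrier[OF C.is_group subgroup_image[OF H] img]] by simp
  then show "saturate H (g <#\<^bsub>G\<^esub> S) = g <#\<^bsub>G\<^esub> saturate H S"
    using S G.l_coset_in_lcosets[OF H g S] by (simp add: saturate_def)
qed (simp add: saturate_def)

lemmas component_image = orbit_component_image[OF G.is_group C.comm_group_axioms hom]

lemmas component_in_orbit_hom = orbit_component_in_orbit_hom[OF G.is_group C.comm_group_axioms hom surj]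

lemma component_eqI:
  assumes "subgroup H G" "\<psi> \<in> extensional (lcosets\<^bsub>C\<^esub> (\<pi> ` H))"
    and "\<And>S. S \<in> lcosets\<^bsub>G\<^esub> H \<Longrightarrow> orbit_component C \<pi> H \<phi> (\<pi> ` S) = \<psi> (\<pi> ` S)"
  shows "orbit_component C \<pi> H \<phi> = \<psi>"
proof (rule extensionalityI[OF _ assms(2)])
  show "orbit_component C \<pi> H \<phi> \<in> extensional (lcosets\<^bsub>C\<^esub> (\<pi> ` H))" by (simp add: orbit_component_def)
  show "orbit_component C \<pi> H \<phi> T = \<psi> T" if "T \<in> lcosets\<^bsub>C\<^esub> (\<pi> ` H)" for T
    using that assms(3) unfolding image_lcosets[OF assms(1)] by blast
qed

lemma component_id:
  assumes "subgroup H G"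
  shows "orbit_component C \<pi> H (\<lambda>S\<in>lcosets\<^bsub>G\<^esub> H. S) = (\<lambda>T\<in>lcosets\<^bsub>C\<^esub> (\<pi> ` H). T)"
  by (rule component_eqI[OF assms])
    (simp_all add: component_image[OF assms assms orbit_hom_id[OF G.is_group assms]] image_in_lcosets[OF assms])

lemma component_compose:
  assumes H: "subgroup H G" and K: "subgroup K G" and L: "subgroup L G"
    and \<phi>: "\<phi> \<in> orbit_hom G H K" and \<psi>: "\<psi> \<in> orbit_hom G K L"
  shows "orbit_component C \<pi> H (compose (lcosets\<^bsub>G\<^esub> H) \<psi> \<phi>) =
    compose (lcosets\<^bsub>C\<^esub> (\<pi> ` H)) (orbit_component C \<pi> K \<psi>) (orbit_component C \<pi> H \<phi>)"
proof (rule component_eqI[OF H])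
  fix S assume S: "S \<in> lcosets\<^bsub>G\<^esub> H"
  show "orbit_component C \<pi> H (compose (lcosets\<^bsub>G\<^esub> H) \<psi> \<phi>) (\<pi> ` S) =
      compose (lcosets\<^bsub>C\<^esub> (\<pi> ` H)) (orbit_component C \<pi> K \<psi>) (orbit_component C \<pi> H \<phi>) (\<pi> ` S)"
    using S component_image[OF H L orbit_hom_compose[OF G.is_group H \<phi> \<psi>] S] component_image[OF H K \<phi> S]
      component_image[OF K L \<psi> orbit_homD(1)[OF \<phi> S]] image_in_lcosets[OF H S]
    by (simp add: compose_def)
qed (simp add: compose_def)

lemma component_lift:
  assumes K: "subgroup K C" and L: "subgroup L C" and \<psi>: "\<psi> \<in> orbit_hom C K L"
  shows "orbit_component C \<pi> (preimage K) (lift K \<psi>) = \<psi>"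
proof (rule component_eqI[OF subgroup_preimage[OF K]])
  show "\<psi> \<in> extensional (lcosets\<^bsub>C\<^esub> (\<pi> ` preimage K))"
    using orbit_homD(3)[OF \<psi>] by (simp add: image_preimage_subgroup[OF K])
  fix S assume S: "S \<in> lcosets\<^bsub>G\<^esub> (preimage K)"
  show "orbit_component C \<pi> (preimage K) (lift K \<psi>) (\<pi> ` S) = \<psi> (\<pi> ` S)"
    using component_image[OF subgroup_preimage[OF K] subgroup_preimage[OF L] lift_in_orbit_hom[OF K L \<psi>] S]
      image_preimage_coset[OF L orbit_homD(1)[OF \<psi> image_in_lcosets_preimage[OF K S]]] S
    by (simp add: lift_def)
qed

lemma component_saturate:
  assumes H: "subgroup H G"
  shows "orbit_component C \<pi> H (saturate H) = (\<lambda>T\<in>lcosets\<^bsub>C\<^esub> (\<pi> ` H). T)"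
proof (rule component_eqI[OF H])
  fix S assume S: "S \<in> lcosets\<^bsub>G\<^esub> H"
  note H' = subgroup_image[OF H]
  show "orbit_component C \<pi> H (saturate H) (\<pi> ` S) = (\<lambda>T\<in>lcosets\<^bsub>C\<^esub> (\<pi> ` H). T) (\<pi> ` S)"
    using component_image[OF H subgroup_preimage[OF H'] saturate_in_orbit_hom[OF H] S] S
      image_preimage_coset[OF H' image_in_lcosets[OF H S]] image_in_lcosets[OF H S]
    by (simp add: saturate_def)
qed simp

lemma saturate_natural:
  assumes H: "subgroup H G" and K: "subgroup K G" and \<phi>: "\<phi> \<in> orbit_hom G H K"
  shows "compose (lcosets\<^bsub>G\<^esub> H) (saturate K) \<phi> =
    compose (lcosets\<^bsub>G\<^esub> H) (lift (\<pi> ` H) (orbit_component C \<pi> H \<phi>)) (saturate H)"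
proof
  fix S
  show "compose (lcosets\<^bsub>G\<^esub> H) (saturate K) \<phi> S =
    compose (lcosets\<^bsub>G\<^esub> H) (lift (\<pi> ` H) (orbit_component C \<pi> H \<phi>)) (saturate H) S"
  proof (cases "S \<in> lcosets\<^bsub>G\<^esub> H")
    case S: True
    note H' = subgroup_image[OF H]
    show ?thesis
      using S orbit_homD(1)[OF \<phi> S] component_image[OF H K \<phi> S] image_preimage_coset[OF H' image_in_lcosets[OF H S]]
        preimage_in_lcosets[OF H' image_in_lcosets[OF H S]]
      by (simp add: compose_def saturate_def lift_def)
  qed (simp add: compose_def)
qed

lemma vec_diagram_pullback:
  assumes I: "vec_diagram C I"
  shows "vec_diagram G (pullback_diagram C \<pi> I)"
  unfolding vec_diagram_def
proof (intro conjI allI impI ballI)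
  fix H n assume H: "subgroup H G"
  show "module rat_field (ob (pullback_diagram C \<pi> I) H n)"
    using vec_diagram_space[OF I subgroup_image[OF H]] by (simp add: pullback_diagram_def rational_space_module)
  show "mor (pullback_diagram C \<pi> I) H H (\<lambda>S\<in>lcosets\<^bsub>G\<^esub> H. S) n x = x"
    if "x \<in> carrier (ob (pullback_diagram C \<pi> I) H n)" for x
    using that vec_diagram_id[OF I subgroup_image[OF H]] by (simp add: pullback_diagram_def component_id[OF H])
next
  fix H K \<phi> n assume "subgroup H G" "subgroup K G" "\<phi> \<in> orbit_hom G H K"
  then show "mor (pullback_diagram C \<pi> I) H K \<phi> n \<in>
      rat_linear (ob (pullback_diagram C \<pi> I) H n) (ob (pullback_diagram C \<pi> I) K n)"
    unfolding pullback_diagram_def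
    by (simp add: vec_diagram_linear[OF I] subgroup_image component_in_orbit_hom)
next
  fix H K L \<phi> \<psi> n x
  assume H: "subgroup H G" and K: "subgroup K G" and L: "subgroup L G"
    and \<phi>: "\<phi> \<in> orbit_hom G H K" and \<psi>: "\<psi> \<in> orbit_hom G K L"
    and x: "x \<in> carrier (ob (pullback_diagram C \<pi> I) H n)"
  show "mor (pullback_diagram C \<pi> I) H L (compose (lcosets\<^bsub>G\<^esub> H) \<psi> \<phi>) n x =
      mor (pullback_diagram C \<pi> I) K L \<psi> n (mor (pullback_diagram C \<pi> I) H K \<phi> n x)"
    using x vec_diagram_comp[OF I subgroup_image[OF H] subgroup_image[OF K] subgroup_image[OF L]
        component_in_orbit_hom[OF H K \<phi>] component_in_orbit_hom[OF K L \<psi>]]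
    by (simp add: pullback_diagram_def component_compose[OF H K L \<phi> \<psi>])
qed

definition restrict_diagram :: "('g, 'x graded_space, 'x) diagram \<Rightarrow> ('c, 'x graded_space, 'x) diagram" where
  "restrict_diagram X =
    \<lparr>ob = (\<lambda>K. ob X (preimage K)), mor = (\<lambda>K L \<psi>. mor X (preimage K) (preimage L) (lift K \<psi>))\<rparr>"

lemma vec_diagram_restrict:
  assumes X: "vec_diagram G X"
  shows "vec_diagram C (restrict_diagram X)"
  unfolding vec_diagram_def
proof (intro conjI allI impI ballI)
  fix K n assume K: "subgroup K C"
  show "module rat_field (ob (restrict_diagram X) K n)"
    using vec_diagram_space[OF X subgroup_preimage[OF K]] by (simp add: restrict_diagram_def rational_space_module)
  show "mor (restrict_diagram X) K K (\<lambda>S\<in>lcosets\<^bsub>C\<^esub> K. S) n x = x"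
    if "x \<in> carrier (ob (restrict_diagram X) K n)" for x
    using that vec_diagram_id[OF X subgroup_preimage[OF K]] by (simp add: restrict_diagram_def lift_id[OF K])
next
  fix K L \<phi> n assume "subgroup K C" "subgroup L C" "\<phi> \<in> orbit_hom C K L"
  then show "mor (restrict_diagram X) K L \<phi> n \<in> rat_linear (ob (restrict_diagram X) K n) (ob (restrict_diagram X) L n)"
    unfolding restrict_diagram_def
    by (simp add: vec_diagram_linear[OF X] subgroup_preimage lift_in_orbit_hom)
next
  fix K L M \<phi> \<psi> n x
  assume K: "subgroup K C" and L: "subgroup L C" and M: "subgroup M C"
    and \<phi>: "\<phi> \<in> orbit_hom C K L" and \<psi>: "\<psi> \<in> orbit_hom C L M"
    and x: "x \<in> carrier (ob (restrict_diagram X) K n)"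
  show "mor (restrict_diagram X) K M (compose (lcosets\<^bsub>C\<^esub> K) \<psi> \<phi>) n x =
      mor (restrict_diagram X) L M \<psi> n (mor (restrict_diagram X) K L \<phi> n x)"
    using x vec_diagram_comp[OF X subgroup_preimage[OF K] subgroup_preimage[OF L] subgroup_preimage[OF M]
        lift_in_orbit_hom[OF K L \<phi>] lift_in_orbit_hom[OF L M \<psi>]]
    by (simp add: restrict_diagram_def lift_compose[OF K L \<phi>])
qed

text \<open>Pullback is right adjoint to restriction along \<open>C/K \<mapsto> G/\<pi>\<inverse>(K)\<close>, and restriction preserves
  injective morphisms, as these are tested orbit by orbit. Hence pullback preserves injective objects:
  an extension is found over \<open>C\<close> and transported back along the unit \<open>saturate\<close>.\<close>

lemma vec_injective_pullback:
  assumes inj: "vec_injective TYPE('y) C I"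
  shows "vec_injective TYPE('y) G (pullback_diagram C \<pi> I)"
proof (rule vec_injectiveI)
  have I: "vec_diagram C I" using inj by (simp add: vec_injective_def)
  let ?P = "pullback_diagram C \<pi> I"
  show P: "vec_diagram G ?P" by (rule vec_diagram_pullback[OF I])
  fix X Y :: "('g, 'y graded_space, 'y) diagram" and f g
  assume X: "vec_diagram G X" and Y: "vec_diagram G Y" and f: "f \<in> vec_hom G X Y"
    and f_inj: "\<And>H n. subgroup H G \<Longrightarrow> inj_on (f H n) (carrier (ob X H n))" and g: "g \<in> vec_hom G X ?P"
  note pre = subgroup_preimage and img = subgroup_image
  have f': "(\<lambda>K. f (preimage K)) \<in> vec_hom C (restrict_diagram X) (restrict_diagram Y)"
    by (rule vec_homI)
      (simp_all add: restrict_diagram_def vec_hom_linear[OF f pre] vec_hom_natural[OF f pre pre lift_in_orbit_hom])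
  have g': "(\<lambda>K. g (preimage K)) \<in> vec_hom C (restrict_diagram X) I"
  proof (rule vec_homI)
    show "g (preimage K) n \<in> rat_linear (ob (restrict_diagram X) K n) (ob I K n)" if K: "subgroup K C" for K n
      using vec_hom_linear[OF g pre[OF K]]
      by (simp add: restrict_diagram_def pullback_diagram_def image_preimage_subgroup[OF K])
    show "g (preimage L) n (mor (restrict_diagram X) K L \<psi> n x) = mor I K L \<psi> n (g (preimage K) n x)"
      if K: "subgroup K C" and L: "subgroup L C" and \<psi>: "\<psi> \<in> orbit_hom C K L"
        and x: "x \<in> carrier (ob (restrict_diagram X) K n)" for K L \<psi> n x
      using vec_hom_natural[OF g pre[OF K] pre[OF L] lift_in_orbit_hom[OF K L \<psi>]] x
      by (simp add: restrict_diagram_def pullback_diagram_def image_preimage_subgroup[OF K]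
          image_preimage_subgroup[OF L] component_lift[OF K L \<psi>])
  qed
  obtain h' where h': "h' \<in> vec_hom C (restrict_diagram Y) I"
    and h'g: "\<And>K n x. subgroup K C \<Longrightarrow> x \<in> carrier (ob X (preimage K) n) \<Longrightarrow>
      h' K n (f (preimage K) n x) = g (preimage K) n x"
    using vec_injective_extend[OF inj vec_diagram_restrict[OF X] vec_diagram_restrict[OF Y] f' _ g'] f_inj[OF pre]
    by (auto simp: restrict_diagram_def)
  define unit where "unit Z H n = mor Z H (preimage (\<pi> ` H)) (saturate H) n"
    for Z :: "('g, 'y graded_space, 'y) diagram" and H n
  define h where "h H n y = h' (\<pi> ` H) n (unit Y H n y)" for H n y
  have unit: "unit Z H n \<in> rat_linear (ob Z H n) (ob (restrict_diagram Z) (\<pi> ` H) n)"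
    if "vec_diagram G Z" "subgroup H G" for Z H n
    using vec_diagram_linear[OF that(1) that(2) pre[OF img[OF that(2)]] saturate_in_orbit_hom[OF that(2)]]
    by (simp add: unit_def[abs_def] restrict_diagram_def)
  have "h \<in> vec_hom G Y ?P"
  proof (rule vec_homI)
    fix H n assume H: "subgroup H G"
    show "h H n \<in> rat_linear (ob Y H n) (ob ?P H n)"
      using rat_linear_comp[OF unit[OF Y H] vec_hom_linear[OF h' img[OF H]]]
      by (simp add: h_def[abs_def] pullback_diagram_def)
  next
    fix H K \<phi> n y
    assume H: "subgroup H G" and K: "subgroup K G" and \<phi>: "\<phi> \<in> orbit_hom G H K" and y: "y \<in> carrier (ob Y H n)"
    let ?\<psi> = "orbit_component C \<pi> H \<phi>"
    note \<psi> = component_in_orbit_hom[OF H K \<phi>]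
    have "unit Y K n (mor Y H K \<phi> n y) = mor (restrict_diagram Y) (\<pi> ` H) (\<pi> ` K) ?\<psi> n (unit Y H n y)"
      using vec_diagram_comp[OF Y H K pre[OF img[OF K]] \<phi> saturate_in_orbit_hom[OF K] y]
        vec_diagram_comp[OF Y H pre[OF img[OF H]] pre[OF img[OF K]] saturate_in_orbit_hom[OF H]
          lift_in_orbit_hom[OF img[OF H] img[OF K] \<psi>] y]
      by (simp add: unit_def restrict_diagram_def saturate_natural[OF H K \<phi>])
    then show "h K n (mor Y H K \<phi> n y) = mor ?P H K \<phi> n (h H n y)"
      using vec_hom_natural[OF h' img[OF H] img[OF K] \<psi> rat_linear_closed[OF unit[OF Y H] y]]
      by (simp add: h_def pullback_diagram_def)
  qed
  moreover have "h H n (f H n x) = g H n x" if H: "subgroup H G" and x: "x \<in> carrier (ob X H n)" for H n x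
  proof -
    let ?K = "preimage (\<pi> ` H)"
    note K = pre[OF img[OF H]] and s = saturate_in_orbit_hom[OF H]
    have "h H n (f H n x) = h' (\<pi> ` H) n (f ?K n (unit X H n x))"
      using vec_hom_natural[OF f H K s x] by (simp add: h_def unit_def)
    also have "\<dots> = g ?K n (unit X H n x)"
      using h'g[OF img[OF H]] rat_linear_closed[OF unit[OF X H] x] by (simp add: restrict_diagram_def)
    also have "\<dots> = mor ?P H ?K (saturate H) n (g H n x)"
      using vec_hom_natural[OF g H K s x] by (simp add: unit_def)
    also have "\<dots> = g H n x"
      using vec_diagram_id[OF I img[OF H]] vec_hom_closed[OF g H x]
      by (simp add: pullback_diagram_def component_saturate[OF H] image_preimage_subgroup[OF img[OF H]])
    finally show ?thesis .
  qed
  ultimately show "\<exists>h \<in> vec_hom G Y ?P. \<forall>H n. subgroup H G \<longrightarrow> (\<forall>x\<in>carrier (ob X H n). h H n (f H n x) = g H n x)"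
    by blast
qed

end

text \<open>The four morphisms exhibit \<open>J\<close> as a retract of \<open>I\<^sub>1 \<oplus> I\<^sub>2\<close>. Working with the components of a map into
  the sum, each of them is extended separately, and the retraction recombines the two extensions.\<close>

lemma vec_injective_retract_of_two:
  assumes J: "vec_diagram G J"
    and I1: "vec_injective TYPE('y) G I1" and I2: "vec_injective TYPE('y) G I2"
    and s1: "s1 \<in> vec_hom G J I1" and s2: "s2 \<in> vec_hom G J I2"
    and r1: "r1 \<in> vec_hom G I1 J" and r2: "r2 \<in> vec_hom G I2 J"
    and retract: "\<And>H n x. subgroup H G \<Longrightarrow> x \<in> carrier (ob J H n) \<Longrightarrow>
      r1 H n (s1 H n x) \<oplus>\<^bsub>ob J H n\<^esub> r2 H n (s2 H n x) = x"
  shows "vec_injective TYPE('y) G J"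
proof (rule vec_injectiveI[OF J])
  fix X Y :: "('a, 'y graded_space, 'y) diagram" and f g
  assume X: "vec_diagram G X" and Y: "vec_diagram G Y" and f: "f \<in> vec_hom G X Y"
    and f_inj: "\<And>H n. subgroup H G \<Longrightarrow> inj_on (f H n) (carrier (ob X H n))" and g: "g \<in> vec_hom G X J"
  have comp: "(\<lambda>H n x. v H n (u H n x)) \<in> vec_hom G A B"
    if "u \<in> vec_hom G A D" "v \<in> vec_hom G D B" for u v and A :: "('a, 't graded_space, 't) diagram"
      and D :: "('a, 'u graded_space, 'u) diagram" and B :: "('a, 'w graded_space, 'w) diagram"
    by (rule vec_homI)
      (simp_all add: rat_linear_comp[OF vec_hom_linear[OF that(1)] vec_hom_linear[OF that(2)]]
        vec_hom_natural[OF that(1)] vec_hom_natural[OF that(2)] vec_hom_closed[OF that(1)])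
  obtain h1 where h1: "h1 \<in> vec_hom G Y I1"
    and h1g: "\<And>H n x. subgroup H G \<Longrightarrow> x \<in> carrier (ob X H n) \<Longrightarrow> h1 H n (f H n x) = s1 H n (g H n x)"
  proof (rule vec_injective_extend[OF I1 X Y f f_inj comp[OF g s1]], assumption)
    fix h assume "h \<in> vec_hom G Y I1"
      and "\<And>H n x. subgroup H G \<Longrightarrow> x \<in> carrier (ob X H n) \<Longrightarrow> h H n (f H n x) = s1 H n (g H n x)"
    then show thesis by (rule that)
  qed
  obtain h2 where h2: "h2 \<in> vec_hom G Y I2"
    and h2g: "\<And>H n x. subgroup H G \<Longrightarrow> x \<in> carrier (ob X H n) \<Longrightarrow> h2 H n (f H n x) = s2 H n (g H n x)"
  proof (rule vec_injective_extend[OF I2 X Y f f_inj comp[OF g s2]], assumption)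
    fix h assume "h \<in> vec_hom G Y I2"
      and "\<And>H n x. subgroup H G \<Longrightarrow> x \<in> carrier (ob X H n) \<Longrightarrow> h H n (f H n x) = s2 H n (g H n x)"
    then show thesis by (rule that)
  qed
  note k1 = comp[OF h1 r1] and k2 = comp[OF h2 r2]
  define h where "h H n y = r1 H n (h1 H n y) \<oplus>\<^bsub>ob J H n\<^esub> r2 H n (h2 H n y)" for H n y
  have "h \<in> vec_hom G Y J"
  proof (rule vec_homI)
    fix H n assume H: "subgroup H G"
    show "h H n \<in> rat_linear (ob Y H n) (ob J H n)"
      using rat_linear_plus[OF vec_diagram_space[OF J H] vec_hom_linear[OF k1 H] vec_hom_linear[OF k2 H]]
      by (simp add: h_def[abs_def])
  next
    fix H K \<phi> n y
    assume H: "subgroup H G" and K: "subgroup K G" and \<phi>: "\<phi> \<in> orbit_hom G H K" and y: "y \<in> carrier (ob Y H n)"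
    show "h K n (mor Y H K \<phi> n y) = mor J H K \<phi> n (h H n y)"
      using vec_hom_natural[OF k1 H K \<phi> y] vec_hom_natural[OF k2 H K \<phi> y]
        rat_linear_add[OF vec_diagram_linear[OF J H K \<phi>] vec_hom_closed[OF k1 H y] vec_hom_closed[OF k2 H y]]
      by (simp add: h_def)
  qed
  moreover have "h H n (f H n x) = g H n x" if "subgroup H G" "x \<in> carrier (ob X H n)" for H n x
    using h1g[OF that] h2g[OF that] retract[OF that(1) vec_hom_closed[OF g that]] by (simp add: h_def)
  ultimately show "\<exists>h \<in> vec_hom G Y J. \<forall>H n. subgroup H G \<longrightarrow> (\<forall>x\<in>carrier (ob X H n). h H n (f H n x) = g H n x)"
    by blast
qed

section \<open>Differential graded algebras\<close>

lemma (in dga) space: "rational_space (gr A n)"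
  by (simp add: rational_space_module gr_module)

lemma (in dga) mul_closed:
  "x \<in> carrier (gr A m) \<Longrightarrow> y \<in> carrier (gr A n) \<Longrightarrow> mul A m n x y \<in> carrier (gr A (m + n))"
  using rat_linear_closed[OF mul_linear_right] by blast

lemma (in dga) diff_closed: "x \<in> carrier (gr A n) \<Longrightarrow> diff A n x \<in> carrier (gr A (Suc n))"
  by (rule rat_linear_closed[OF diff_linear])

text \<open>The Leibniz rule for \<open>1 \<cdot> 1 = 1\<close> says \<open>d 1 = d 1 + d 1\<close>.\<close>

lemma (in dga) diff_unit: "diff A 0 (unit A) = \<zero>\<^bsub>gr A (Suc 0)\<^esub>"
proof -
  interpret A: rational_space "gr A (Suc 0)" by (rule space)
  let ?d = "diff A 0 (unit A)"
  have d: "?d \<in> carrier (gr A (Suc 0))" by (rule diff_closed[OF unit_closed])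
  have "?d = mul A (Suc 0) 0 ?d (unit A) \<oplus>\<^bsub>gr A (Suc 0)\<^esub> mul A 0 (Suc 0) (unit A) ?d"
    using diff_mul[OF unit_closed unit_closed] mul_closed[OF unit_closed d]
    by (simp add: mul_unit[OF unit_closed] A.scale_one)
  also have "mul A (Suc 0) 0 ?d (unit A) = ?d"
    using mul_comm[OF d unit_closed] d by (simp add: mul_unit[OF d] A.scale_one)
  also have "mul A 0 (Suc 0) (unit A) ?d = ?d" by (rule mul_unit[OF d])
  finally show ?thesis using d by (simp add: A.M.add.r_cancel_one')
qed

text \<open>All axioms of a DGA are equations between elements of one degree, so they can be tested after two
  homomorphisms that are jointly injective.\<close>

lemma dga_of_jointly_injective:
  fixes D :: "('d, 'y) dga_scheme" and A :: "('a, 'z) dga_scheme" and B :: "('b, 'x) dga_scheme"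
  assumes A: "dga A" and B: "dga B" and f: "f \<in> dga_hom D A" and g: "g \<in> dga_hom D B"
    and f_zero: "\<And>n. f n \<zero>\<^bsub>gr D n\<^esub> = \<zero>\<^bsub>gr A n\<^esub>" and g_zero: "\<And>n. g n \<zero>\<^bsub>gr D n\<^esub> = \<zero>\<^bsub>gr B n\<^esub>"
    and eqI: "\<And>n x y. x \<in> carrier (gr D n) \<Longrightarrow> y \<in> carrier (gr D n) \<Longrightarrow> f n x = f n y \<Longrightarrow> g n x = g n y \<Longrightarrow> x = y"
    and zero: "\<And>n. \<zero>\<^bsub>gr D n\<^esub> \<in> carrier (gr D n)"
    and add: "\<And>n x y. x \<in> carrier (gr D n) \<Longrightarrow> y \<in> carrier (gr D n) \<Longrightarrow> x \<oplus>\<^bsub>gr D n\<^esub> y \<in> carrier (gr D n)"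
    and scale: "\<And>n c x. x \<in> carrier (gr D n) \<Longrightarrow> c \<odot>\<^bsub>gr D n\<^esub> x \<in> carrier (gr D n)"
    and mul: "\<And>m n x y. x \<in> carrier (gr D m) \<Longrightarrow> y \<in> carrier (gr D n) \<Longrightarrow> mul D m n x y \<in> carrier (gr D (m + n))"
    and unit: "unit D \<in> carrier (gr D 0)"
    and diff: "\<And>n x. x \<in> carrier (gr D n) \<Longrightarrow> diff D n x \<in> carrier (gr D (Suc n))"
  shows "dga D"
proof -
  interpret A: dga A by fact
  interpret B: dga B by fact
  have fl: "f n \<in> rat_linear (gr D n) (gr A n)" and gl: "g n \<in> rat_linear (gr D n) (gr B n)" for n
    using f g by (auto simp: dga_hom_def)
  note f_simps = rat_linear_closed[OF fl] rat_linear_add[OF fl] rat_linear_scale[OF fl]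
    and g_simps = rat_linear_closed[OF gl] rat_linear_add[OF gl] rat_linear_scale[OF gl]
  have f_mul: "f (m + n) (mul D m n x y) = mul A m n (f m x) (f n y)"
    and g_mul: "g (m + n) (mul D m n x y) = mul B m n (g m x) (g n y)"
    if "x \<in> carrier (gr D m)" "y \<in> carrier (gr D n)" for m n x y
    using that f g by (auto simp: dga_hom_def)
  have f_diff: "f (Suc n) (diff D n x) = diff A n (f n x)" and g_diff: "g (Suc n) (diff D n x) = diff B n (g n x)"
    if "x \<in> carrier (gr D n)" for n x
    using that f g by (auto simp: dga_hom_def)
  have f_unit: "f 0 (unit D) = unit A" and g_unit: "g 0 (unit D) = unit B" using f g by (auto simp: dga_hom_def)
  have space: "rational_space (gr D n)" for n
  proof -
    interpret An: rational_space "gr A n" by (rule A.space)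
    interpret Bn: rational_space "gr B n" by (rule B.space)
    note s = zero add scale f_zero g_zero f_simps g_simps
    show ?thesis
    proof (rule rational_spaceI)
      fix x y z a b c
      assume x: "x \<in> carrier (gr D n)"
      show "(- 1) \<odot>\<^bsub>gr D n\<^esub> x \<oplus>\<^bsub>gr D n\<^esub> x = \<zero>\<^bsub>gr D n\<^esub>"
        by (rule eqI[of _ n]) (simp_all add: s x An.neg_scale_add Bn.neg_scale_add)
      show "\<zero>\<^bsub>gr D n\<^esub> \<oplus>\<^bsub>gr D n\<^esub> x = x" by (rule eqI[of _ n]) (simp_all add: s x)
      show "(a + b) \<odot>\<^bsub>gr D n\<^esub> x = a \<odot>\<^bsub>gr D n\<^esub> x \<oplus>\<^bsub>gr D n\<^esub> b \<odot>\<^bsub>gr D n\<^esub> x"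
        by (rule eqI[of _ n]) (simp_all add: s x An.scale_add Bn.scale_add)
      show "(a * b) \<odot>\<^bsub>gr D n\<^esub> x = a \<odot>\<^bsub>gr D n\<^esub> (b \<odot>\<^bsub>gr D n\<^esub> x)"
        by (rule eqI[of _ n]) (simp_all add: s x An.scale_scale Bn.scale_scale)
      show "1 \<odot>\<^bsub>gr D n\<^esub> x = x" by (rule eqI[of _ n]) (simp_all add: s x An.scale_one Bn.scale_one)
      assume y: "y \<in> carrier (gr D n)"
      show "x \<oplus>\<^bsub>gr D n\<^esub> y = y \<oplus>\<^bsub>gr D n\<^esub> x" by (rule eqI[of _ n]) (simp_all add: s x y An.M.a_comm Bn.M.a_comm)
      show "c \<odot>\<^bsub>gr D n\<^esub> (x \<oplus>\<^bsub>gr D n\<^esub> y) = c \<odot>\<^bsub>gr D n\<^esub> x \<oplus>\<^bsub>gr D n\<^esub> c \<odot>\<^bsub>gr D n\<^esub> y"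
        by (rule eqI[of _ n]) (simp_all add: s x y An.add_scale Bn.add_scale)
      assume z: "z \<in> carrier (gr D n)"
      show "x \<oplus>\<^bsub>gr D n\<^esub> y \<oplus>\<^bsub>gr D n\<^esub> z = x \<oplus>\<^bsub>gr D n\<^esub> (y \<oplus>\<^bsub>gr D n\<^esub> z)"
        by (rule eqI[of _ n]) (simp_all add: s x y z An.M.a_assoc Bn.M.a_assoc)
    qed (simp_all add: s)
  qed
  show ?thesis
  proof (rule dga.intro)
    show "module rat_field (gr D n)" for n using space by (simp add: rational_space_module)
    show "(\<lambda>x. mul D m n x y) \<in> rat_linear (gr D m) (gr D (m + n))" if y: "y \<in> carrier (gr D n)" for m n y
    proof (rule rat_linearI)
      fix c x x' assume x: "x \<in> carrier (gr D m)"
      show "mul D m n x y \<in> carrier (gr D (m + n))" by (rule mul[OF x y])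
      show "mul D m n (c \<odot>\<^bsub>gr D m\<^esub> x) y = c \<odot>\<^bsub>gr D (m + n)\<^esub> mul D m n x y"
        by (rule eqI[of _ "m + n"]) (simp_all add: x y mul scale f_mul g_mul f_simps g_simps
            rat_linear_scale[OF A.mul_linear_left] rat_linear_scale[OF B.mul_linear_left])
      assume x': "x' \<in> carrier (gr D m)"
      show "mul D m n (x \<oplus>\<^bsub>gr D m\<^esub> x') y = mul D m n x y \<oplus>\<^bsub>gr D (m + n)\<^esub> mul D m n x' y"
        by (rule eqI[of _ "m + n"]) (simp_all add: x x' y mul add f_mul g_mul f_simps g_simps
            rat_linear_add[OF A.mul_linear_left] rat_linear_add[OF B.mul_linear_left])
    qed
    show "(\<lambda>y. mul D m n x y) \<in> rat_linear (gr D n) (gr D (m + n))" if x: "x \<in> carrier (gr D m)" for m n x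
    proof (rule rat_linearI)
      fix c y y' assume y: "y \<in> carrier (gr D n)"
      show "mul D m n x y \<in> carrier (gr D (m + n))" by (rule mul[OF x y])
      show "mul D m n x (c \<odot>\<^bsub>gr D n\<^esub> y) = c \<odot>\<^bsub>gr D (m + n)\<^esub> mul D m n x y"
        by (rule eqI[of _ "m + n"]) (simp_all add: x y mul scale f_mul g_mul f_simps g_simps
            rat_linear_scale[OF A.mul_linear_right] rat_linear_scale[OF B.mul_linear_right])
      assume y': "y' \<in> carrier (gr D n)"
      show "mul D m n x (y \<oplus>\<^bsub>gr D n\<^esub> y') = mul D m n x y \<oplus>\<^bsub>gr D (m + n)\<^esub> mul D m n x y'"
        by (rule eqI[of _ "m + n"]) (simp_all add: x y y' mul add f_mul g_mul f_simps g_simps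
            rat_linear_add[OF A.mul_linear_right] rat_linear_add[OF B.mul_linear_right])
    qed
    show "mul D (l + m) n (mul D l m x y) z = mul D l (m + n) x (mul D m n y z)"
      if x: "x \<in> carrier (gr D l)" and y: "y \<in> carrier (gr D m)" and z: "z \<in> carrier (gr D n)" for l m n x y z
    proof (rule eqI[of _ "l + m + n"])
      note xy = mul[OF x y] and yz = mul[OF y z]
      show "mul D (l + m) n (mul D l m x y) z \<in> carrier (gr D (l + m + n))" by (rule mul[OF xy z])
      show "mul D l (m + n) x (mul D m n y z) \<in> carrier (gr D (l + m + n))"
        using mul[OF x yz] by (simp add: add.assoc)
      show "f (l + m + n) (mul D (l + m) n (mul D l m x y) z) = f (l + m + n) (mul D l (m + n) x (mul D m n y z))"
        using f_mul[OF xy z] f_mul[OF x y] f_mul[OF x yz] f_mul[OF y z]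
          A.mul_assoc[OF f_simps(1)[OF x] f_simps(1)[OF y] f_simps(1)[OF z]] by (simp add: add.assoc)
      show "g (l + m + n) (mul D (l + m) n (mul D l m x y) z) = g (l + m + n) (mul D l (m + n) x (mul D m n y z))"
        using g_mul[OF xy z] g_mul[OF x y] g_mul[OF x yz] g_mul[OF y z]
          B.mul_assoc[OF g_simps(1)[OF x] g_simps(1)[OF y] g_simps(1)[OF z]] by (simp add: add.assoc)
    qed
    show "mul D m n x y = (- 1) ^ (m * n) \<odot>\<^bsub>gr D (m + n)\<^esub> mul D n m y x"
      if x: "x \<in> carrier (gr D m)" and y: "y \<in> carrier (gr D n)" for m n x y
    proof (rule eqI[OF mul[OF x y]])
      have yx: "mul D n m y x \<in> carrier (gr D (m + n))" using mul[OF y x] by (simp add: add.commute)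
      then show "(- 1) ^ (m * n) \<odot>\<^bsub>gr D (m + n)\<^esub> mul D n m y x \<in> carrier (gr D (m + n))" by (rule scale)
      show "f (m + n) (mul D m n x y) = f (m + n) ((- 1) ^ (m * n) \<odot>\<^bsub>gr D (m + n)\<^esub> mul D n m y x)"
        using f_mul[OF x y] f_mul[OF y x] f_simps(3)[OF yx] A.mul_comm[OF f_simps(1)[OF x] f_simps(1)[OF y]]
        by (simp add: add.commute)
      show "g (m + n) (mul D m n x y) = g (m + n) ((- 1) ^ (m * n) \<odot>\<^bsub>gr D (m + n)\<^esub> mul D n m y x)"
        using g_mul[OF x y] g_mul[OF y x] g_simps(3)[OF yx] B.mul_comm[OF g_simps(1)[OF x] g_simps(1)[OF y]]
        by (simp add: add.commute)
    qed
    show "unit D \<in> carrier (gr D 0)" by (rule unit)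
    show "mul D 0 n (unit D) x = x" if x: "x \<in> carrier (gr D n)" for n x
      using mul[OF unit x] x f_mul[OF unit x] g_mul[OF unit x] A.mul_unit[OF f_simps(1)[OF x]]
        B.mul_unit[OF g_simps(1)[OF x]] by (intro eqI[of _ n]) (simp_all add: f_unit g_unit)
    show "diff D n \<in> rat_linear (gr D n) (gr D (Suc n))" for n
    proof (rule rat_linearI)
      fix c x y assume x: "x \<in> carrier (gr D n)"
      show "diff D n x \<in> carrier (gr D (Suc n))" by (rule diff[OF x])
      show "diff D n (c \<odot>\<^bsub>gr D n\<^esub> x) = c \<odot>\<^bsub>gr D (Suc n)\<^esub> diff D n x"
        by (rule eqI[of _ "Suc n"]) (simp_all add: x diff scale f_diff g_diff f_simps g_simps
            rat_linear_scale[OF A.diff_linear] rat_linear_scale[OF B.diff_linear])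
      assume y: "y \<in> carrier (gr D n)"
      show "diff D n (x \<oplus>\<^bsub>gr D n\<^esub> y) = diff D n x \<oplus>\<^bsub>gr D (Suc n)\<^esub> diff D n y"
        by (rule eqI[of _ "Suc n"]) (simp_all add: x y diff add f_diff g_diff f_simps g_simps
            rat_linear_add[OF A.diff_linear] rat_linear_add[OF B.diff_linear])
    qed
    show "diff D (Suc n) (diff D n x) = \<zero>\<^bsub>gr D (Suc (Suc n))\<^esub>" if x: "x \<in> carrier (gr D n)" for n x
      by (rule eqI[of _ "Suc (Suc n)"]) (simp_all add: x diff zero f_diff g_diff f_zero g_zero A.diff_diff[OF f_simps(1)]
          B.diff_diff[OF g_simps(1)])
    show "diff D (m + n) (mul D m n x y) =
        mul D (Suc m) n (diff D m x) y \<oplus>\<^bsub>gr D (Suc (m + n))\<^esub>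
        (- 1) ^ m \<odot>\<^bsub>gr D (Suc (m + n))\<^esub> mul D m (Suc n) x (diff D n y)"
      if x: "x \<in> carrier (gr D m)" and y: "y \<in> carrier (gr D n)" for m n x y
    proof -
      note dx = diff[OF x] and dy = diff[OF y]
      have 1: "mul D (Suc m) n (diff D m x) y \<in> carrier (gr D (Suc (m + n)))" using mul[OF dx y] by simp
      have 2: "mul D m (Suc n) x (diff D n y) \<in> carrier (gr D (Suc (m + n)))" using mul[OF x dy] by simp
      show ?thesis
      proof (rule eqI[OF diff[OF mul[OF x y]] add[OF 1 scale[OF 2]]])
        show "f (Suc (m + n)) (diff D (m + n) (mul D m n x y)) = f (Suc (m + n))
            (mul D (Suc m) n (diff D m x) y \<oplus>\<^bsub>gr D (Suc (m + n))\<^esub>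
             (- 1) ^ m \<odot>\<^bsub>gr D (Suc (m + n))\<^esub> mul D m (Suc n) x (diff D n y))"
          using f_simps(2)[OF 1 scale[OF 2]] f_simps(3)[OF 2] f_mul[OF dx y] f_mul[OF x dy]
            f_diff[OF mul[OF x y]] f_mul[OF x y] f_diff[OF x] f_diff[OF y]
            A.diff_mul[OF f_simps(1)[OF x] f_simps(1)[OF y]] by simp
        show "g (Suc (m + n)) (diff D (m + n) (mul D m n x y)) = g (Suc (m + n))
            (mul D (Suc m) n (diff D m x) y \<oplus>\<^bsub>gr D (Suc (m + n))\<^esub>
             (- 1) ^ m \<odot>\<^bsub>gr D (Suc (m + n))\<^esub> mul D m (Suc n) x (diff D n y))"
          using g_simps(2)[OF 1 scale[OF 2]] g_simps(3)[OF 2] g_mul[OF dx y] g_mul[OF x dy]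
            g_diff[OF mul[OF x y]] g_mul[OF x y] g_diff[OF x] g_diff[OF y]
            B.diff_mul[OF g_simps(1)[OF x] g_simps(1)[OF y]] by simp
      qed
    qed
  qed
qed

section \<open>The wedge as a fibre product\<close>

text \<open>The augmentation of \<open>A\<close> followed by the unit map of \<open>B\<close>. Because it is zero in positive degrees, the
  maps \<open>collapse_right\<close> and \<open>collapse_left\<close> are \<open>(a, b) \<mapsto> a + \<epsilon>(b) \<cdot> 1\<close> and \<open>(a, b) \<mapsto> b + \<epsilon>(a) \<cdot> 1\<close> in all degrees
  alike.\<close>

definition scalar_part :: "'a aug_dga \<Rightarrow> 'b aug_dga \<Rightarrow> nat \<Rightarrow> 'a \<Rightarrow> 'b" where
  "scalar_part A B n a = (if n = 0 then aug A a \<odot>\<^bsub>gr B 0\<^esub> unit B else \<zero>\<^bsub>gr B n\<^esub>)"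

definition fibre_product :: "'a aug_dga \<Rightarrow> 'b aug_dga \<Rightarrow> nat \<Rightarrow> ('a \<times> 'b) set" where
  "fibre_product A B n =
    {u \<in> carrier (gr A n) \<times> carrier (gr B n). n = 0 \<longrightarrow> aug A (fst u) = aug B (snd u)}"

text \<open>The elements of \<open>A \<or> B\<close> are the nonempty fibres of the pair of collapse maps, since the common kernel of these maps is
  the subspace \<open>wedge_rel\<close> that is divided out. A fibre is nonempty for the points \<open>u\<close> of the fibre product.\<close>

definition wedge_coset :: "'a aug_dga \<Rightarrow> 'b aug_dga \<Rightarrow> nat \<Rightarrow> 'a \<times> 'b \<Rightarrow> ('a \<times> 'b) set" where
  "wedge_coset A B n u =
    {x \<in> carrier (gr A n) \<times> carrier (gr B n). collapse_right A B n x = fst u \<and> collapse_left A B n x = snd u}"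

context aug_dga
begin

lemma aug_zero: "aug A \<zero>\<^bsub>gr A 0\<^esub> = 0"
proof -
  interpret A0: rational_space "gr A 0" by (rule space)
  show ?thesis using aug_smult[OF A0.M.zero_closed, of 0] by (simp add: A0.scale_zero_right)
qed

end

lemma scalar_part_linear:
  assumes "aug_dga A" "aug_dga B"
  shows "scalar_part A B n \<in> rat_linear (gr A n) (gr B n)"
proof -
  interpret A: aug_dga A by fact
  interpret B: aug_dga B by fact
  interpret B0: rational_space "gr B 0" by (rule B.space)
  interpret Bn: rational_space "gr B n" by (rule B.space)
  show ?thesis
    by (rule rat_linearI)
      (auto simp: scalar_part_def A.aug_add A.aug_smult B.unit_closed B0.scale_add B0.scale_scale Bn.scale_zero_right)
qed

lemma scalar_part_scalar_part:
  assumes "aug_dga B" "b \<in> carrier (gr A n)"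
  shows "scalar_part B C n (scalar_part A B n b) = scalar_part A C n b"
proof -
  interpret B: aug_dga B by fact
  show ?thesis by (simp add: scalar_part_def B.aug_smult B.unit_closed B.aug_unit)
qed

lemma diff_scalar_part:
  assumes "aug_dga B"
  shows "diff B n (scalar_part A B n a) = \<zero>\<^bsub>gr B (Suc n)\<^esub>"
proof -
  interpret B: aug_dga B by fact
  interpret B1: rational_space "gr B (Suc 0)" by (rule B.space)
  show ?thesis
    using rat_linear_zero[OF B.space B.space B.diff_linear]
    by (auto simp: scalar_part_def rat_linear_scale[OF B.diff_linear B.unit_closed] B.diff_unit B1.scale_zero_right)
qed

locale wedge_pair = A: aug_dga A + B: aug_dga B for A :: "'a aug_dga" and B :: "'b aug_dga"
begin

abbreviation "P n \<equiv> direct_sum (gr A n) (gr B n)"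
abbreviation "F \<equiv> fibre_product A B"
abbreviation "coset \<equiv> wedge_coset A B"
abbreviation "right \<equiv> collapse_right A B"
abbreviation "left \<equiv> collapse_left A B"

lemma sum_simps:
  "carrier (P n) = carrier (gr A n) \<times> carrier (gr B n)"
  "\<zero>\<^bsub>P n\<^esub> = (\<zero>\<^bsub>gr A n\<^esub>, \<zero>\<^bsub>gr B n\<^esub>)"
  "x \<oplus>\<^bsub>P n\<^esub> y = (fst x \<oplus>\<^bsub>gr A n\<^esub> fst y, snd x \<oplus>\<^bsub>gr B n\<^esub> snd y)"
  "c \<odot>\<^bsub>P n\<^esub> x = (c \<odot>\<^bsub>gr A n\<^esub> fst x, c \<odot>\<^bsub>gr B n\<^esub> snd x)"
  by (simp_all add: direct_sum_def)

lemma sum_space: "rational_space (P n)"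
proof -
  interpret An: rational_space "gr A n" by (rule A.space)
  interpret Bn: rational_space "gr B n" by (rule B.space)
  show ?thesis
    by (rule rational_spaceI)
      (auto simp: sum_simps An.M.a_ac Bn.M.a_ac An.add_neg_scale Bn.add_neg_scale An.scale_add Bn.scale_add
        An.add_scale Bn.add_scale An.scale_scale Bn.scale_scale An.scale_one Bn.scale_one)
qed

lemmas scBA = scalar_part_linear[OF B.aug_dga_axioms A.aug_dga_axioms]
  and scAB = scalar_part_linear[OF A.aug_dga_axioms B.aug_dga_axioms]
  and scBB = scalar_part_linear[OF B.aug_dga_axioms B.aug_dga_axioms]

lemma right_eq: "x \<in> carrier (P n) \<Longrightarrow> right n x = fst x \<oplus>\<^bsub>gr A n\<^esub> scalar_part B A n (snd x)"
  using abelian_group.axioms(1)[OF module.axioms(2)[OF A.gr_module]]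
  by (auto simp: collapse_right_def scalar_part_def sum_simps abelian_monoid.r_zero)

lemma left_eq: "x \<in> carrier (P n) \<Longrightarrow> left n x = snd x \<oplus>\<^bsub>gr B n\<^esub> scalar_part A B n (fst x)"
  using abelian_group.axioms(1)[OF module.axioms(2)[OF B.gr_module]]
  by (auto simp: collapse_left_def scalar_part_def sum_simps abelian_monoid.r_zero)

lemma fst_linear: "fst \<in> rat_linear (P n) (gr A n)" and snd_linear: "snd \<in> rat_linear (P n) (gr B n)"
  by (auto simp: rat_linear_def sum_simps)

lemma right_linear: "right n \<in> rat_linear (P n) (gr A n)"
  by (rule rat_linear_cong[OF sum_space right_eq
        rat_linear_plus[OF A.space fst_linear rat_linear_comp[OF snd_linear scBA]]])

lemma left_linear: "left n \<in> rat_linear (P n) (gr B n)"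
  by (rule rat_linear_cong[OF sum_space left_eq
        rat_linear_plus[OF B.space snd_linear rat_linear_comp[OF fst_linear scAB]]])

lemma scalar_part_fibre_product:
  "u \<in> F n \<Longrightarrow> scalar_part A C n (fst u) = scalar_part B C n (snd u)"
  by (auto simp: fibre_product_def scalar_part_def)

lemma fibre_product_closed: "u \<in> F n \<Longrightarrow> fst u \<in> carrier (gr A n)" "u \<in> F n \<Longrightarrow> snd u \<in> carrier (gr B n)"
  by (auto simp: fibre_product_def)

lemma collapse_in_fibre_product:
  assumes x: "x \<in> carrier (P n)"
  shows "(right n x, left n x) \<in> F n"
proof -
  obtain a b where ab: "x = (a, b)" "a \<in> carrier (gr A n)" "b \<in> carrier (gr B n)"
    using x by (auto simp: sum_simps)
  show ?thesis
    using rat_linear_closed[OF right_linear x] rat_linear_closed[OF left_linear x] ab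
      module.smult_closed[OF A.gr_module _ A.unit_closed] module.smult_closed[OF B.gr_module _ B.unit_closed]
    by (auto simp: fibre_product_def collapse_right_def collapse_left_def A.aug_add B.aug_add A.aug_smult B.aug_smult
        A.aug_unit B.aug_unit A.unit_closed B.unit_closed)
qed

lemma collapse_surjective:
  assumes u: "u \<in> F n"
  obtains x where "x \<in> carrier (P n)" "right n x = fst u" "left n x = snd u"
proof -
  interpret An: rational_space "gr A n" by (rule A.space)
  interpret Bn: rational_space "gr B n" by (rule B.space)
  note cl = fibre_product_closed[OF u]
  note sc = rat_linear_closed[OF scBB cl(2)]
  \<comment> \<open>the constant common to both entries is kept in the first one only\<close>
  let ?x = "(fst u, snd u \<oplus>\<^bsub>gr B n\<^esub> (- 1) \<odot>\<^bsub>gr B n\<^esub> scalar_part B B n (snd u))"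
  have x: "?x \<in> carrier (P n)" using cl sc by (simp add: sum_simps)
  have "right n ?x = fst u"
    using cl sc rat_linear_closed[OF scBA cl(2)]
    by (simp add: right_eq[OF x] rat_linear_add[OF scBA] rat_linear_scale[OF scBA]
        scalar_part_scalar_part[OF B.aug_dga_axioms] An.add_neg_scale)
  moreover have "left n ?x = snd u"
    using cl sc
    by (simp add: left_eq[OF x] scalar_part_fibre_product[OF u] Bn.M.a_assoc Bn.neg_scale_add)
  ultimately show thesis using that x by blast
qed

text \<open>If both collapse maps vanish at \<open>(a, b)\<close> in degree \<open>0\<close>, then \<open>a = - \<epsilon>(b) \<cdot> 1\<close> and \<open>b = - \<epsilon>(a) \<cdot> 1\<close>, and
  applying \<open>\<epsilon>\<close> to the first equation gives \<open>\<epsilon>(a) = - \<epsilon>(b)\<close>, so the two coefficients are opposite.\<close>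

lemma wedge_rel_eq: "wedge_rel A B n = coset n (\<zero>\<^bsub>gr A n\<^esub>, \<zero>\<^bsub>gr B n\<^esub>)"
proof (cases "n = 0")
  case True
  interpret A0: rational_space "gr A 0" by (rule A.space)
  interpret B0: rational_space "gr B 0" by (rule B.space)
  note units = A.unit_closed B.unit_closed A.aug_unit B.aug_unit A.aug_smult B.aug_smult
  show ?thesis
  proof
    show "wedge_rel A B n \<subseteq> coset n (\<zero>\<^bsub>gr A n\<^esub>, \<zero>\<^bsub>gr B n\<^esub>)"
      using True by (auto simp: wedge_rel_def wedge_coset_def collapse_right_def collapse_left_def units
          A0.scale_add[symmetric] B0.scale_add[symmetric] A0.scale_zero_left B0.scale_zero_left)
    show "coset n (\<zero>\<^bsub>gr A n\<^esub>, \<zero>\<^bsub>gr B n\<^esub>) \<subseteq> wedge_rel A B n"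
    proof
      fix x assume x: "x \<in> coset n (\<zero>\<^bsub>gr A n\<^esub>, \<zero>\<^bsub>gr B n\<^esub>)"
      obtain a b where ab: "x = (a, b)" "a \<in> carrier (gr A 0)" "b \<in> carrier (gr B 0)"
        using x True by (auto simp: wedge_coset_def)
      have 0: "a \<oplus>\<^bsub>gr A 0\<^esub> aug B b \<odot>\<^bsub>gr A 0\<^esub> unit A = \<zero>\<^bsub>gr A 0\<^esub>"
        "b \<oplus>\<^bsub>gr B 0\<^esub> aug A a \<odot>\<^bsub>gr B 0\<^esub> unit B = \<zero>\<^bsub>gr B 0\<^esub>"
        using x ab True by (auto simp: wedge_coset_def collapse_right_def collapse_left_def)
      have a: "a = (- aug B b) \<odot>\<^bsub>gr A 0\<^esub> unit A"
        by (rule A0.eq_if_diff_zero) (use 0 ab in \<open>simp_all add: units A0.scale_scale\<close>)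
      have aa: "aug A a = - aug B b" unfolding a using A.unit_closed by (simp add: units)
      have "b = aug B b \<odot>\<^bsub>gr B 0\<^esub> unit B"
        by (rule B0.eq_if_diff_zero) (use 0 ab aa in \<open>simp_all add: units B0.scale_scale\<close>)
      then show "x \<in> wedge_rel A B n"
        using a ab True unfolding wedge_rel_def by (auto intro!: image_eqI[of _ _ "- aug B b"])
    qed
  qed
next
  case False
  then show ?thesis
    using module.axioms(2)[OF A.gr_module, of n] module.axioms(2)[OF B.gr_module, of n]
    by (auto simp: wedge_rel_def wedge_coset_def collapse_right_def collapse_left_def abelian_group_def
        abelian_monoid.zero_closed)
qed

lemma coset_mem: "x \<in> coset n u \<longleftrightarrow> x \<in> carrier (P n) \<and> right n x = fst u \<and> left n x = snd u"
  by (auto simp: wedge_coset_def sum_simps)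

lemma coset_nonempty:
  assumes "u \<in> F n"
  shows "coset n u \<noteq> {}"
proof -
  obtain x where "x \<in> coset n u" using collapse_surjective[OF assms] unfolding coset_mem by blast
  then show ?thesis by blast
qed

text \<open>A nonempty part \<open>T\<close> of the second coset suffices because the first summand is a whole coset. All
  operations of the wedge add \<open>wedge_rel\<close> to a set of values on representatives, so they are evaluated
  by showing that these values lie in the expected coset.\<close>

lemma coset_add:
  assumes u: "u \<in> F n" and v: "v \<in> F n" and T: "T \<subseteq> coset n v" "T \<noteq> {}"
  shows "coset n u <+>\<^bsub>P n\<^esub> T = coset n (fst u \<oplus>\<^bsub>gr A n\<^esub> fst v, snd u \<oplus>\<^bsub>gr B n\<^esub> snd v)"
proof
  interpret Pn: rational_space "P n" by (rule sum_space)
  interpret An: rational_space "gr A n" by (rule A.space)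
  interpret Bn: rational_space "gr B n" by (rule B.space)
  note cl = fibre_product_closed[OF u] fibre_product_closed[OF v]
  show "coset n u <+>\<^bsub>P n\<^esub> T \<subseteq> coset n (fst u \<oplus>\<^bsub>gr A n\<^esub> fst v, snd u \<oplus>\<^bsub>gr B n\<^esub> snd v)"
    using T(1) by (auto simp: set_add_def' coset_mem subset_iff rat_linear_add[OF right_linear] rat_linear_add[OF left_linear])
  show "coset n (fst u \<oplus>\<^bsub>gr A n\<^esub> fst v, snd u \<oplus>\<^bsub>gr B n\<^esub> snd v) \<subseteq> coset n u <+>\<^bsub>P n\<^esub> T"
  proof
    fix z assume z: "z \<in> coset n (fst u \<oplus>\<^bsub>gr A n\<^esub> fst v, snd u \<oplus>\<^bsub>gr B n\<^esub> snd v)"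
    obtain t where t: "t \<in> T" "t \<in> coset n v" using T by blast
    have zP: "z \<in> carrier (P n)" and tP: "t \<in> carrier (P n)" using z t by (auto simp: coset_mem)
    let ?x = "z \<oplus>\<^bsub>P n\<^esub> (- 1) \<odot>\<^bsub>P n\<^esub> t"
    have "?x \<in> coset n u"
      using z t zP tP cl
      by (auto simp: coset_mem rat_linear_add[OF right_linear] rat_linear_add[OF left_linear]
          rat_linear_scale[OF right_linear] rat_linear_scale[OF left_linear] An.M.a_assoc Bn.M.a_assoc
          An.add_neg_scale Bn.add_neg_scale)
    moreover have "z = ?x \<oplus>\<^bsub>P n\<^esub> t" using zP tP by (simp add: Pn.M.a_assoc Pn.neg_scale_add)
    ultimately show "z \<in> coset n u <+>\<^bsub>P n\<^esub> T" using t unfolding set_add_def' by blast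
  qed
qed

lemma zero_in_fibre_product: "(\<zero>\<^bsub>gr A n\<^esub>, \<zero>\<^bsub>gr B n\<^esub>) \<in> F n"
  using module.axioms(2)[OF A.gr_module, of n] module.axioms(2)[OF B.gr_module, of n]
  by (auto simp: fibre_product_def A.aug_zero B.aug_zero abelian_group_def abelian_monoid.zero_closed)

lemma wedge_rel_add:
  assumes u: "u \<in> F n" and T: "T \<subseteq> coset n u" "T \<noteq> {}"
  shows "wedge_rel A B n <+>\<^bsub>P n\<^esub> T = coset n u"
proof -
  interpret An: rational_space "gr A n" by (rule A.space)
  interpret Bn: rational_space "gr B n" by (rule B.space)
  show ?thesis
    unfolding wedge_rel_eq coset_add[OF zero_in_fibre_product u T] using fibre_product_closed[OF u] by simp
qed

lemma wedge_rel_r_coset: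
  assumes "x \<in> carrier (P n)"
  shows "wedge_rel A B n +>\<^bsub>P n\<^esub> x = coset n (right n x, left n x)"
proof -
  have "wedge_rel A B n +>\<^bsub>P n\<^esub> x = wedge_rel A B n <+>\<^bsub>P n\<^esub> {x}"
    by (auto simp: a_r_coset_def' set_add_def')
  then show ?thesis
    using wedge_rel_add[OF collapse_in_fibre_product[OF assms], of "{x}"] assms by (simp add: coset_mem)
qed

lemma wedge_carrier: "carrier (gr (wedge A B) n) = coset n ` F n"
proof -
  have "carrier (gr (wedge A B) n) = (\<lambda>x. wedge_rel A B n +>\<^bsub>P n\<^esub> x) ` carrier (P n)"
    by (auto simp: wedge_def quotient_space_def A_RCOSETS_def')
  also have "\<dots> = coset n ` (\<lambda>x. (right n x, left n x)) ` carrier (P n)"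
    unfolding image_image by (intro image_cong refl wedge_rel_r_coset)
  also have "(\<lambda>x. (right n x, left n x)) ` carrier (P n) = F n"
  proof
    show "(\<lambda>x. (right n x, left n x)) ` carrier (P n) \<subseteq> F n" using collapse_in_fibre_product by blast
    show "F n \<subseteq> (\<lambda>x. (right n x, left n x)) ` carrier (P n)"
    proof
      fix u assume "u \<in> F n"
      then obtain x where "x \<in> carrier (P n)" "right n x = fst u" "left n x = snd u" by (rule collapse_surjective)
      then show "u \<in> (\<lambda>x. (right n x, left n x)) ` carrier (P n)" by (intro image_eqI[of _ _ x]) auto
    qed
  qed
  finally show ?thesis .
qed

lemma fibre_product_add:
  "u \<in> F n \<Longrightarrow> v \<in> F n \<Longrightarrow> (fst u \<oplus>\<^bsub>gr A n\<^esub> fst v, snd u \<oplus>\<^bsub>gr B n\<^esub> snd v) \<in> F n"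
  using module.axioms(2)[OF A.gr_module, of n] module.axioms(2)[OF B.gr_module, of n]
  by (auto simp: fibre_product_def A.aug_add B.aug_add abelian_group_def abelian_monoid.a_closed)

lemma fibre_product_scale:
  "u \<in> F n \<Longrightarrow> (c \<odot>\<^bsub>gr A n\<^esub> fst u, c \<odot>\<^bsub>gr B n\<^esub> snd u) \<in> F n"
  using rational_space.scale_closed[OF A.space] rational_space.scale_closed[OF B.space]
  by (auto simp: fibre_product_def A.aug_smult B.aug_smult)

lemma fibre_product_mul:
  "u \<in> F m \<Longrightarrow> v \<in> F n \<Longrightarrow> (mul A m n (fst u) (fst v), mul B m n (snd u) (snd v)) \<in> F (m + n)"
  using A.mul_closed B.mul_closed by (auto simp: fibre_product_def A.aug_mul B.aug_mul)

lemma fibre_product_unit: "(unit A, unit B) \<in> F 0"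
  by (auto simp: fibre_product_def A.unit_closed B.unit_closed A.aug_unit B.aug_unit)

lemma fibre_product_diff:
  "u \<in> F n \<Longrightarrow> (diff A n (fst u), diff B n (snd u)) \<in> F (Suc n)"
  by (auto simp: fibre_product_def A.diff_closed B.diff_closed)

lemma wedge_zero: "\<zero>\<^bsub>gr (wedge A B) n\<^esub> = coset n (\<zero>\<^bsub>gr A n\<^esub>, \<zero>\<^bsub>gr B n\<^esub>)"
  by (simp add: wedge_def quotient_space_def wedge_rel_eq)

lemma wedge_add:
  "u \<in> F n \<Longrightarrow> v \<in> F n \<Longrightarrow>
   coset n u \<oplus>\<^bsub>gr (wedge A B) n\<^esub> coset n v = coset n (fst u \<oplus>\<^bsub>gr A n\<^esub> fst v, snd u \<oplus>\<^bsub>gr B n\<^esub> snd v)"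
  by (simp add: wedge_def quotient_space_def coset_add coset_nonempty)

lemma wedge_scale:
  assumes u: "u \<in> F n"
  shows "c \<odot>\<^bsub>gr (wedge A B) n\<^esub> coset n u = coset n (c \<odot>\<^bsub>gr A n\<^esub> fst u, c \<odot>\<^bsub>gr B n\<^esub> snd u)"
proof -
  interpret Pn: rational_space "P n" by (rule sum_space)
  have "(\<lambda>x. c \<odot>\<^bsub>P n\<^esub> x) ` coset n u \<subseteq> coset n (c \<odot>\<^bsub>gr A n\<^esub> fst u, c \<odot>\<^bsub>gr B n\<^esub> snd u)"
    by (auto simp: coset_mem rat_linear_scale[OF right_linear] rat_linear_scale[OF left_linear] Pn.scale_closed)
  then show ?thesis
    using wedge_rel_add[OF fibre_product_scale[OF u]] coset_nonempty[OF u]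
    by (simp add: wedge_def quotient_space_def)
qed

lemma wedge_unit: "unit (wedge A B) = coset 0 (unit A, unit B)"
proof -
  interpret A0: rational_space "gr A 0" by (rule A.space)
  interpret B0: rational_space "gr B 0" by (rule B.space)
  have x: "(unit A, \<zero>\<^bsub>gr B 0\<^esub>) \<in> carrier (P 0)" by (simp add: sum_simps A.unit_closed)
  show ?thesis
    using wedge_rel_r_coset[OF x]
    by (simp add: wedge_def collapse_right_def collapse_left_def A.aug_unit B.aug_zero A.unit_closed B.unit_closed
        A0.scale_zero_left B0.scale_one)
qed

text \<open>The differential commutes with the collapse maps as it kills the constants, which are the only
  difference between an element and its collapse.\<close>

lemma wedge_diff:
  assumes u: "u \<in> F n"
  shows "diff (wedge A B) n (coset n u) = coset (Suc n) (diff A n (fst u), diff B n (snd u))"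
proof -
  interpret A1: rational_space "gr A (Suc n)" by (rule A.space)
  interpret B1: rational_space "gr B (Suc n)" by (rule B.space)
  have "map_prod (diff A n) (diff B n) ` coset n u \<subseteq> coset (Suc n) (diff A n (fst u), diff B n (snd u))"
  proof
    fix z assume "z \<in> map_prod (diff A n) (diff B n) ` coset n u"
    then obtain x where x: "x \<in> coset n u" "z = (diff A n (fst x), diff B n (snd x))" by (auto simp: map_prod_def split_beta)
    have xP: "x \<in> carrier (P n)" and cl: "fst x \<in> carrier (gr A n)" "snd x \<in> carrier (gr B n)"
      using x(1) by (auto simp: coset_mem sum_simps)
    have "diff A n (right n x) = diff A n (fst x)"
      unfolding right_eq[OF xP] using cl A.diff_closed[OF cl(1)] rat_linear_closed[OF scBA cl(2)]
      by (simp add: rat_linear_add[OF A.diff_linear] diff_scalar_part[OF A.aug_dga_axioms])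
    moreover have "diff B n (left n x) = diff B n (snd x)"
      unfolding left_eq[OF xP] using cl B.diff_closed[OF cl(2)] rat_linear_closed[OF scAB cl(1)]
      by (simp add: rat_linear_add[OF B.diff_linear] diff_scalar_part[OF B.aug_dga_axioms])
    ultimately show "z \<in> coset (Suc n) (diff A n (fst u), diff B n (snd u))"
      using x A.diff_closed[OF cl(1)] B.diff_closed[OF cl(2)]
      by (simp add: coset_mem sum_simps collapse_right_def collapse_left_def)
  qed
  then show ?thesis
    using wedge_rel_add[OF fibre_product_diff[OF u]] coset_nonempty[OF u] by (simp add: wedge_def)
qed

text \<open>In degree \<open>0\<close> the products in \<open>A\<close> and in \<open>B\<close> have the same constant term \<open>\<epsilon>(u) \<epsilon>(v)\<close>. The correction term
  in \<open>wedge_mul_rep\<close> removes it from the second entry, and the collapse map to \<open>B\<close> puts it back.\<close>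

lemma wedge_mul_rep_in_coset:
  assumes u: "u \<in> F m" and v: "v \<in> F n" and x: "x \<in> coset m u" and y: "y \<in> coset n v"
  shows "wedge_mul_rep A B m n x y \<in> coset (m + n) (mul A m n (fst u) (fst v), mul B m n (snd u) (snd v))"
proof -
  let ?a = "mul A m n (fst u) (fst v)" and ?b = "mul B m n (snd u) (snd v)"
  note cl = fibre_product_closed[OF u] fibre_product_closed[OF v]
  have ab: "?a \<in> carrier (gr A (m + n))" "?b \<in> carrier (gr B (m + n))"
    using cl A.mul_closed B.mul_closed by auto
  have xy: "right m x = fst u" "left m x = snd u" "right n y = fst v" "left n y = snd v"
    using x y by (auto simp: coset_mem)
  show ?thesis
  proof (cases "m = 0 \<and> n = 0")
    case True
    interpret A0: rational_space "gr A 0" by (rule A.space)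
    interpret B0: rational_space "gr B 0" by (rule B.space)
    have wa: "wedge_aug A B 0 z = aug A (right 0 z)" if "z \<in> carrier (P 0)" for z
      using that by (auto simp: wedge_aug_def collapse_right_def A.aug_add A.aug_smult A.aug_unit A.unit_closed sum_simps)
    let ?e = "aug A (fst u) * aug A (fst v)"
    have e: "aug A ?a = ?e" "aug B ?b = ?e"
      using True cl u v by (auto simp: A.aug_mul B.aug_mul fibre_product_def)
    have "wedge_mul_rep A B m n x y = (?a, ?b \<oplus>\<^bsub>gr B 0\<^esub> (- ?e) \<odot>\<^bsub>gr B 0\<^esub> unit B)"
      using True x y xy wa by (simp add: wedge_mul_rep_def coset_mem)
    then show ?thesis
      using True ab e
      by (simp add: coset_mem sum_simps collapse_right_def collapse_left_def B.aug_add B.aug_smult B.aug_unit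
          B.unit_closed A.unit_closed A0.scale_zero_left B0.M.a_assoc B0.scale_add[symmetric] B0.scale_zero_left)
  next
    case False
    then have "wedge_mul_rep A B m n x y = (?a, ?b)" using xy by (auto simp: wedge_mul_rep_def Let_def)
    then show ?thesis
      using False ab by (auto simp: coset_mem sum_simps collapse_right_def collapse_left_def)
  qed
qed

lemma wedge_mul:
  assumes u: "u \<in> F m" and v: "v \<in> F n"
  shows "mul (wedge A B) m n (coset m u) (coset n v) =
    coset (m + n) (mul A m n (fst u) (fst v), mul B m n (snd u) (snd v))"
proof -
  have "{wedge_mul_rep A B m n x y | x y. x \<in> coset m u \<and> y \<in> coset n v}
      \<subseteq> coset (m + n) (mul A m n (fst u) (fst v), mul B m n (snd u) (snd v))"
    using wedge_mul_rep_in_coset[OF u v] by blast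
  moreover have "{wedge_mul_rep A B m n x y | x y. x \<in> coset m u \<and> y \<in> coset n v} \<noteq> {}"
    using coset_nonempty[OF u] coset_nonempty[OF v] by blast
  ultimately show ?thesis
    using wedge_rel_add[OF fibre_product_mul[OF u v]] by (simp add: wedge_def)
qed

end

text \<open>The inverse of \<open>wedge_coset A B n\<close>.\<close>

definition wedge_components :: "'a aug_dga \<Rightarrow> 'b aug_dga \<Rightarrow> nat \<Rightarrow> ('a \<times> 'b) set \<Rightarrow> 'a \<times> 'b" where
  "wedge_components A B n S = (let x = (SOME x. x \<in> S) in (collapse_right A B n x, collapse_left A B n x))"

context wedge_pair
begin

abbreviation "comps \<equiv> wedge_components A B"

lemma components_coset:
  assumes "u \<in> F n"
  shows "comps n (coset n u) = u"
proof -
  have "(SOME x. x \<in> coset n u) \<in> coset n u" using coset_nonempty[OF assms] by (rule some_in_eq[THEN iffD2])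
  then show ?thesis unfolding wedge_components_def Let_def by (simp add: coset_mem)
qed

lemmas fibre_product_pair =
  fibre_product_closed[where u = "(a, b)" for a b, unfolded fst_conv snd_conv]
  fibre_product_add[where u = "(a, b)" and v = "(a', b')" for a b a' b', unfolded fst_conv snd_conv]
  fibre_product_scale[where u = "(a, b)" for a b, unfolded fst_conv snd_conv]
  fibre_product_mul[where u = "(a, b)" and v = "(a', b')" for a b a' b', unfolded fst_conv snd_conv]
  fibre_product_diff[where u = "(a, b)" for a b, unfolded fst_conv snd_conv]

lemma wedge_elementE:
  assumes "S \<in> carrier (gr (wedge A B) n)"
  obtains u where "u \<in> F n" "S = coset n u"
  using assms by (auto simp: wedge_carrier)

lemma fst_components_hom: "(\<lambda>n S. fst (comps n S)) \<in> dga_hom (wedge A B) A"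
  unfolding dga_hom_def mem_Collect_eq
proof (intro conjI allI ballI)
  show "(\<lambda>S. fst (comps n S)) \<in> rat_linear (gr (wedge A B) n) (gr A n)" for n
    by (rule rat_linearI) (auto elim!: wedge_elementE simp: components_coset wedge_add
        wedge_scale fibre_product_pair wedge_carrier)
qed (auto elim!: wedge_elementE simp: components_coset wedge_mul wedge_unit wedge_diff
      fibre_product_unit fibre_product_pair)

lemma snd_components_hom: "(\<lambda>n S. snd (comps n S)) \<in> dga_hom (wedge A B) B"
  unfolding dga_hom_def mem_Collect_eq
proof (intro conjI allI ballI)
  show "(\<lambda>S. snd (comps n S)) \<in> rat_linear (gr (wedge A B) n) (gr B n)" for n
    by (rule rat_linearI) (auto elim!: wedge_elementE simp: components_coset wedge_add
        wedge_scale fibre_product_pair wedge_carrier)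
qed (auto elim!: wedge_elementE simp: components_coset wedge_mul wedge_unit wedge_diff
      fibre_product_unit fibre_product_pair)

lemma dga_wedge: "dga (wedge A B)"
proof (rule dga_of_jointly_injective[OF A.dga_axioms B.dga_axioms fst_components_hom snd_components_hom])
  show "x = y" if "x \<in> carrier (gr (wedge A B) n)" "y \<in> carrier (gr (wedge A B) n)"
    "fst (comps n x) = fst (comps n y)" "snd (comps n x) = snd (comps n y)" for n x y
    using that by (auto elim!: wedge_elementE simp: components_coset prod_eq_iff)
qed (auto elim!: wedge_elementE simp: components_coset wedge_zero zero_in_fibre_product wedge_carrier wedge_add wedge_scale
    wedge_mul wedge_unit wedge_diff fibre_product_unit fibre_product_pair
    intro!: imageI)

lemma wedge_connected:
  assumes A1: "cohomologically_1_connected A" and B1: "cohomologically_1_connected B"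
  shows "cohomologically_1_connected (wedge A B)"
proof -
  interpret A0: rational_space "gr A 0" by (rule A.space)
  interpret B0: rational_space "gr B 0" by (rule B.space)
  have eq: "coset n u = coset n v \<longleftrightarrow> u = v" if "u \<in> F n" "v \<in> F n" for n u v
    using components_coset that by metis
  have cocycle: "coset n u \<in> cocycles (wedge A B) n \<longleftrightarrow> fst u \<in> cocycles A n \<and> snd u \<in> cocycles B n" if u: "u \<in> F n" for n u
    using u fibre_product_closed[OF u]
    by (auto simp: cocycles_def wedge_carrier wedge_diff wedge_zero eq[OF fibre_product_diff[OF u] zero_in_fibre_product])
  have scale_unit: "c \<odot>\<^bsub>gr (wedge A B) 0\<^esub> unit (wedge A B) = coset 0 (c \<odot>\<^bsub>gr A 0\<^esub> unit A, c \<odot>\<^bsub>gr B 0\<^esub> unit B)" for c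
    using wedge_scale[OF fibre_product_unit] by (simp add: wedge_unit)
  have unit_F: "(c \<odot>\<^bsub>gr A 0\<^esub> unit A, c \<odot>\<^bsub>gr B 0\<^esub> unit B) \<in> F 0" for c
    using fibre_product_scale[OF fibre_product_unit, of c] by simp
  have A_bij: "bij_betw (\<lambda>c. c \<odot>\<^bsub>gr A 0\<^esub> unit A) UNIV (cocycles A 0)"
    and B_bij: "bij_betw (\<lambda>c. c \<odot>\<^bsub>gr B 0\<^esub> unit B) UNIV (cocycles B 0)"
    and A_im: "cocycles A 1 = diff A 0 ` carrier (gr A 0)" and B_im: "cocycles B 1 = diff B 0 ` carrier (gr B 0)"
    using A1 B1 by (auto simp: cohomologically_1_connected_def)
  have "bij_betw (\<lambda>c. c \<odot>\<^bsub>gr (wedge A B) 0\<^esub> unit (wedge A B)) UNIV (cocycles (wedge A B) 0)"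
    unfolding bij_betw_def
  proof
    show "inj (\<lambda>c. c \<odot>\<^bsub>gr (wedge A B) 0\<^esub> unit (wedge A B))"
      unfolding scale_unit using A_bij by (auto simp: inj_on_def eq[OF unit_F unit_F] bij_betw_def)
    show "range (\<lambda>c. c \<odot>\<^bsub>gr (wedge A B) 0\<^esub> unit (wedge A B)) = cocycles (wedge A B) 0"
    proof
      show "range (\<lambda>c. c \<odot>\<^bsub>gr (wedge A B) 0\<^esub> unit (wedge A B)) \<subseteq> cocycles (wedge A B) 0"
        unfolding scale_unit using bij_betwE[OF A_bij] bij_betwE[OF B_bij] by (auto simp: cocycle[OF unit_F])
      show "cocycles (wedge A B) 0 \<subseteq> range (\<lambda>c. c \<odot>\<^bsub>gr (wedge A B) 0\<^esub> unit (wedge A B))"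
      proof
        fix S assume S: "S \<in> cocycles (wedge A B) 0"
        then obtain u where u: "u \<in> F 0" "S = coset 0 u" by (auto simp: cocycles_def elim: wedge_elementE)
        then have "fst u \<in> cocycles A 0" "snd u \<in> cocycles B 0" using S cocycle by auto
        then obtain a b where ab: "fst u = a \<odot>\<^bsub>gr A 0\<^esub> unit A" "snd u = b \<odot>\<^bsub>gr B 0\<^esub> unit B"
          unfolding bij_betw_imp_surj_on[OF A_bij, symmetric] bij_betw_imp_surj_on[OF B_bij, symmetric] by blast
        \<comment> \<open>the two constants agree because \<open>u\<close> lies in the fibre product\<close>
        have "a = b" using u(1) ab
          by (simp add: fibre_product_def A.aug_smult B.aug_smult A.unit_closed B.unit_closed A.aug_unit B.aug_unit)
        then show "S \<in> range (\<lambda>c. c \<odot>\<^bsub>gr (wedge A B) 0\<^esub> unit (wedge A B))"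
          unfolding scale_unit u(2) using ab by (intro image_eqI[of _ _ a]) (cases u; simp)+
      qed
    qed
  qed
  moreover have "cocycles (wedge A B) 1 = diff (wedge A B) 0 ` carrier (gr (wedge A B) 0)"
  proof
    show "cocycles (wedge A B) 1 \<subseteq> diff (wedge A B) 0 ` carrier (gr (wedge A B) 0)"
    proof
      fix S assume S: "S \<in> cocycles (wedge A B) 1"
      then obtain u where u: "u \<in> F 1" "S = coset 1 u" by (auto simp: cocycles_def elim: wedge_elementE)
      then have "fst u \<in> cocycles A 1" "snd u \<in> cocycles B 1" using S cocycle by auto
      then obtain a b where ab: "a \<in> carrier (gr A 0)" "b \<in> carrier (gr B 0)" "fst u = diff A 0 a" "snd u = diff B 0 b"
        unfolding A_im B_im by blast
      \<comment> \<open>\<open>b\<close> is moved by a constant to make the augmentations agree\<close>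
      let ?c = "aug A a - aug B b"
      let ?v = "(a, b \<oplus>\<^bsub>gr B 0\<^esub> ?c \<odot>\<^bsub>gr B 0\<^esub> unit B)"
      have v: "?v \<in> F 0"
        using ab by (simp add: fibre_product_def B.aug_add B.aug_smult B.aug_unit B.unit_closed)
      interpret Bs: rational_space "gr B (Suc 0)" by (rule B.space)
      have "diff B 0 (snd ?v) = snd u"
        using ab B.diff_closed[OF ab(2)]
        by (simp add: rat_linear_add[OF B.diff_linear] rat_linear_scale[OF B.diff_linear] B.unit_closed B.diff_unit
            Bs.scale_zero_right)
      then have "S = diff (wedge A B) 0 (coset 0 ?v)"
        using wedge_diff[OF v] u ab by (cases u) simp
      then show "S \<in> diff (wedge A B) 0 ` carrier (gr (wedge A B) 0)" using v by (auto simp: wedge_carrier)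
    qed
    show "diff (wedge A B) 0 ` carrier (gr (wedge A B) 0) \<subseteq> cocycles (wedge A B) 1"
    proof
      fix S assume "S \<in> diff (wedge A B) 0 ` carrier (gr (wedge A B) 0)"
      then obtain u where u: "u \<in> F 0" "S = diff (wedge A B) 0 (coset 0 u)" by (auto simp: wedge_carrier)
      have "diff A 0 (fst u) \<in> cocycles A 1" "diff B 0 (snd u) \<in> cocycles B 1"
        using fibre_product_closed[OF u(1)] unfolding A_im B_im by auto
      then show "S \<in> cocycles (wedge A B) 1"
        using cocycle[OF fibre_product_diff[OF u(1)]] u by (simp add: wedge_diff)
    qed
  qed
  ultimately show ?thesis by (simp add: cohomologically_1_connected_def)
qed

end

definition aug_dga_hom :: "'a aug_dga \<Rightarrow> 'b aug_dga \<Rightarrow> (nat \<Rightarrow> 'a \<Rightarrow> 'b) set" where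
  "aug_dga_hom A B = {f \<in> dga_hom A B. \<forall>x\<in>carrier (gr A 0). aug B (f 0 x) = aug A x}"

lemma aug_dga_hom_linear: "f \<in> aug_dga_hom A B \<Longrightarrow> f n \<in> rat_linear (gr A n) (gr B n)"
  by (simp add: aug_dga_hom_def dga_hom_def)

lemma aug_dga_hom_mul:
  "f \<in> aug_dga_hom A B \<Longrightarrow> x \<in> carrier (gr A m) \<Longrightarrow> y \<in> carrier (gr A n) \<Longrightarrow>
   f (m + n) (mul A m n x y) = mul B m n (f m x) (f n y)"
  by (simp add: aug_dga_hom_def dga_hom_def)

lemma aug_dga_hom_unit: "f \<in> aug_dga_hom A B \<Longrightarrow> f 0 (unit A) = unit B"
  by (simp add: aug_dga_hom_def dga_hom_def)

lemma aug_dga_hom_diff: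
  "f \<in> aug_dga_hom A B \<Longrightarrow> x \<in> carrier (gr A n) \<Longrightarrow> f (Suc n) (diff A n x) = diff B n (f n x)"
  by (simp add: aug_dga_hom_def dga_hom_def)

lemma aug_dga_hom_scalar_part:
  assumes "aug_dga A" "aug_dga A'" "f \<in> aug_dga_hom A A'" "g \<in> aug_dga_hom B B'" "b \<in> carrier (gr B n)"
  shows "f n (scalar_part B A n b) = scalar_part B' A' n (g n b)"
proof -
  interpret A: aug_dga A by fact
  interpret A': aug_dga A' by fact
  show ?thesis
    using assms(4,5) rat_linear_zero[OF A.space A'.space aug_dga_hom_linear[OF assms(3)]]
    by (auto simp: scalar_part_def rat_linear_scale[OF aug_dga_hom_linear[OF assms(3)] A.unit_closed]
        aug_dga_hom_unit[OF assms(3)] aug_dga_hom_def)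
qed

locale wedge_pair_hom = W: wedge_pair A B + W': wedge_pair A' B'
  for A :: "'a aug_dga" and B :: "'b aug_dga" and A' :: "'a aug_dga" and B' :: "'b aug_dga" +
  fixes f :: "nat \<Rightarrow> 'a \<Rightarrow> 'a" and g :: "nat \<Rightarrow> 'b \<Rightarrow> 'b"
  assumes f: "f \<in> aug_dga_hom A A'" and g: "g \<in> aug_dga_hom B B'"
begin

lemma fibre_product_map: "u \<in> W.F n \<Longrightarrow> (f n (fst u), g n (snd u)) \<in> W'.F n"
  using rat_linear_closed[OF aug_dga_hom_linear[OF f]] rat_linear_closed[OF aug_dga_hom_linear[OF g]] f g
  by (auto simp: fibre_product_def aug_dga_hom_def)

lemma wedge_map_coset:
  assumes u: "u \<in> W.F n"
  shows "wedge_map A' B' f g n (W.coset n u) = W'.coset n (f n (fst u), g n (snd u))"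
proof -
  note fl = aug_dga_hom_linear[OF f] and gl = aug_dga_hom_linear[OF g]
  have "map_prod (f n) (g n) ` W.coset n u \<subseteq> W'.coset n (f n (fst u), g n (snd u))"
  proof
    fix z assume "z \<in> map_prod (f n) (g n) ` W.coset n u"
    then obtain x where x: "x \<in> W.coset n u" "z = (f n (fst x), g n (snd x))" by (auto simp: map_prod_def split_beta)
    have xP: "x \<in> carrier (W.P n)" and cl: "fst x \<in> carrier (gr A n)" "snd x \<in> carrier (gr B n)"
      using x(1) by (auto simp: W.coset_mem W.sum_simps)
    have zP: "z \<in> carrier (W'.P n)" using cl x(2) rat_linear_closed[OF fl] rat_linear_closed[OF gl] by (simp add: W'.sum_simps)
    have "f n (W.right n x) = W'.right n z"
      unfolding W.right_eq[OF xP] W'.right_eq[OF zP] using cl rat_linear_closed[OF W.scBA cl(2)] x(2)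
      by (simp add: rat_linear_add[OF fl] aug_dga_hom_scalar_part[OF W.A.aug_dga_axioms W'.A.aug_dga_axioms f g])
    moreover have "g n (W.left n x) = W'.left n z"
      unfolding W.left_eq[OF xP] W'.left_eq[OF zP] using cl rat_linear_closed[OF W.scAB cl(1)] x(2)
      by (simp add: rat_linear_add[OF gl] aug_dga_hom_scalar_part[OF W.B.aug_dga_axioms W'.B.aug_dga_axioms g f])
    ultimately show "z \<in> W'.coset n (f n (fst u), g n (snd u))"
      using x zP by (simp add: W.coset_mem W'.coset_mem)
  qed
  then show ?thesis
    using W'.wedge_rel_add[OF fibre_product_map[OF u]] W.coset_nonempty[OF u] by (simp add: wedge_map_def)
qed

lemma wedge_map_hom: "wedge_map A' B' f g \<in> dga_hom (wedge A B) (wedge A' B')"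
proof -
  note map = wedge_map_coset fibre_product_map
    and fl = aug_dga_hom_linear[OF f] and gl = aug_dga_hom_linear[OF g] and cl = W.fibre_product_closed
  show ?thesis
    unfolding dga_hom_def mem_Collect_eq
  proof (intro conjI allI ballI)
    show "wedge_map A' B' f g n \<in> rat_linear (gr (wedge A B) n) (gr (wedge A' B') n)" for n
    proof (rule rat_linearI)
      fix S T c assume "S \<in> carrier (gr (wedge A B) n)"
      then obtain u where u: "u \<in> W.F n" and S: "S = W.coset n u" by (rule W.wedge_elementE)
      show "wedge_map A' B' f g n S \<in> carrier (gr (wedge A' B') n)"
        unfolding S W'.wedge_carrier by (simp add: map u)
      show "wedge_map A' B' f g n (c \<odot>\<^bsub>gr (wedge A B) n\<^esub> S) = c \<odot>\<^bsub>gr (wedge A' B') n\<^esub> wedge_map A' B' f g n S"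
        unfolding S using W.wedge_scale[OF u, of c] W'.wedge_scale[OF fibre_product_map[OF u], of c]
          wedge_map_coset[OF W.fibre_product_scale[OF u, of c]]
        by (simp add: map u rat_linear_scale[OF fl] rat_linear_scale[OF gl] cl)
      assume "T \<in> carrier (gr (wedge A B) n)"
      then obtain v where v: "v \<in> W.F n" and T: "T = W.coset n v" by (rule W.wedge_elementE)
      show "wedge_map A' B' f g n (S \<oplus>\<^bsub>gr (wedge A B) n\<^esub> T) =
          wedge_map A' B' f g n S \<oplus>\<^bsub>gr (wedge A' B') n\<^esub> wedge_map A' B' f g n T"
        unfolding S T using W.wedge_add[OF u v] W'.wedge_add[OF fibre_product_map[OF u] fibre_product_map[OF v]]
          wedge_map_coset[OF W.fibre_product_add[OF u v]]
        by (simp add: map u v rat_linear_add[OF fl] rat_linear_add[OF gl] cl)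
    qed
  next
    fix m n S T assume "S \<in> carrier (gr (wedge A B) m)" "T \<in> carrier (gr (wedge A B) n)"
    then obtain u v where u: "u \<in> W.F m" and S: "S = W.coset m u" and v: "v \<in> W.F n" and T: "T = W.coset n v"
      by (metis W.wedge_elementE)
    show "wedge_map A' B' f g (m + n) (mul (wedge A B) m n S T) =
        mul (wedge A' B') m n (wedge_map A' B' f g m S) (wedge_map A' B' f g n T)"
      unfolding S T using W.wedge_mul[OF u v] W'.wedge_mul[OF fibre_product_map[OF u] fibre_product_map[OF v]]
        wedge_map_coset[OF W.fibre_product_mul[OF u v]]
      by (simp add: map u v aug_dga_hom_mul[OF f] aug_dga_hom_mul[OF g] cl)
  next
    show "wedge_map A' B' f g 0 (unit (wedge A B)) = unit (wedge A' B')"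
      by (simp add: W.wedge_unit W'.wedge_unit wedge_map_coset[OF W.fibre_product_unit]
          aug_dga_hom_unit[OF f] aug_dga_hom_unit[OF g])
  next
    fix n S assume "S \<in> carrier (gr (wedge A B) n)"
    then obtain u where u: "u \<in> W.F n" and S: "S = W.coset n u" by (rule W.wedge_elementE)
    show "wedge_map A' B' f g (Suc n) (diff (wedge A B) n S) = diff (wedge A' B') n (wedge_map A' B' f g n S)"
      unfolding S using W.wedge_diff[OF u] W'.wedge_diff[OF fibre_product_map[OF u]]
        wedge_map_coset[OF W.fibre_product_diff[OF u]]
      by (simp add: map u aug_dga_hom_diff[OF f] aug_dga_hom_diff[OF g] cl)
  qed
qed

end

section \<open>The wedge of two diagrams\<close>

lemma aug_dga_diagram_vec: "aug_dga_diagram G U \<Longrightarrow> vec_diagram G (underlying U)"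
  by (simp add: aug_dga_diagram_def dga_diagram_def)

lemma aug_dga_diagram_ob: "aug_dga_diagram G U \<Longrightarrow> subgroup H G \<Longrightarrow> aug_dga (ob U H)"
  by (simp add: aug_dga_diagram_def)

lemma aug_dga_diagram_connected:
  "aug_dga_diagram G U \<Longrightarrow> subgroup H G \<Longrightarrow> cohomologically_1_connected (ob U H)"
  by (simp add: aug_dga_diagram_def dga_diagram_def)

lemma aug_dga_diagram_mor:
  "aug_dga_diagram G U \<Longrightarrow> subgroup H G \<Longrightarrow> subgroup K G \<Longrightarrow> \<phi> \<in> orbit_hom G H K \<Longrightarrow>
   mor U H K \<phi> \<in> aug_dga_hom (ob U H) (ob U K)"
  by (simp add: aug_dga_diagram_def dga_diagram_def aug_dga_hom_def)

locale wedge_of_diagrams =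
  p1: abelian_surjection G C1 \<pi>1 + p2: abelian_surjection G C2 \<pi>2
  for G :: "('g, 'l) monoid_scheme" and C1 :: "('a, 'm) monoid_scheme" and C2 :: "('b, 'n) monoid_scheme"
    and \<pi>1 :: "'g \<Rightarrow> 'a" and \<pi>2 :: "'g \<Rightarrow> 'b" +
  fixes \<theta> :: "'g \<Rightarrow> 'a \<times> 'b" and U1 :: "('a, 'v aug_dga, 'v) diagram" and U2 :: "('b, 'w aug_dga, 'w) diagram"
  assumes \<pi>1: "\<pi>1 = fst \<circ> \<theta>" and \<pi>2: "\<pi>2 = snd \<circ> \<theta>"
    and U1: "aug_dga_diagram C1 U1" and U2: "aug_dga_diagram C2 U2"
begin

abbreviation "W \<equiv> wedge_diagram C1 C2 \<theta> U1 U2"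
abbreviation "A H \<equiv> ob U1 (\<pi>1 ` H)"
abbreviation "B H \<equiv> ob U2 (\<pi>2 ` H)"
abbreviation "mor1 H K \<phi> \<equiv> mor U1 (\<pi>1 ` H) (\<pi>1 ` K) (orbit_component C1 \<pi>1 H \<phi>)"
abbreviation "mor2 H K \<phi> \<equiv> mor U2 (\<pi>2 ` H) (\<pi>2 ` K) (orbit_component C2 \<pi>2 H \<phi>)"
abbreviation "pull1 \<equiv> pullback_diagram C1 \<pi>1 (underlying U1)"
abbreviation "pull2 \<equiv> pullback_diagram C2 \<pi>2 (underlying U2)"

lemma pair: "subgroup H G \<Longrightarrow> wedge_pair (A H) (B H)"
  by (intro wedge_pair.intro aug_dga_diagram_ob[OF U1 p1.subgroup_image] aug_dga_diagram_ob[OF U2 p2.subgroup_image])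

lemma pair_hom:
  assumes "subgroup H G" "subgroup K G" "\<phi> \<in> orbit_hom G H K"
  shows "wedge_pair_hom (A H) (B H) (A K) (B K) (mor1 H K \<phi>) (mor2 H K \<phi>)"
  by (intro wedge_pair_hom.intro wedge_pair_hom_axioms.intro pair assms
      aug_dga_diagram_mor[OF U1 p1.subgroup_image p1.subgroup_image p1.component_in_orbit_hom]
      aug_dga_diagram_mor[OF U2 p2.subgroup_image p2.subgroup_image p2.component_in_orbit_hom])

lemma W_simps:
  "ob W H = wedge (A H) (B H)" "mor W H K \<phi> = wedge_map (A K) (B K) (mor1 H K \<phi>) (mor2 H K \<phi>)"
  "ob (underlying W) H = gr (wedge (A H) (B H))"
  "mor (underlying W) H K \<phi> = wedge_map (A K) (B K) (mor1 H K \<phi>) (mor2 H K \<phi>)"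
  by (simp_all add: wedge_diagram_def underlying_def Let_def \<pi>1 \<pi>2)

lemma pull_simps:
  "ob pull1 H = gr (A H)" "mor pull1 H K \<phi> = mor1 H K \<phi>" "ob pull2 H = gr (B H)" "mor pull2 H K \<phi> = mor2 H K \<phi>"
  by (simp_all add: pullback_diagram_def underlying_def)

lemmas pull1_vec = p1.vec_diagram_pullback[OF aug_dga_diagram_vec[OF U1]]
  and pull2_vec = p2.vec_diagram_pullback[OF aug_dga_diagram_vec[OF U2]]

lemma vec_diagram_wedge: "vec_diagram G (underlying W)"
  unfolding vec_diagram_def W_simps
proof (intro conjI allI impI ballI)
  fix H n assume H: "subgroup H G"
  interpret w: wedge_pair "A H" "B H" by (rule pair[OF H])
  show "module rat_field (gr (wedge (A H) (B H)) n)" by (rule dga.gr_module[OF w.dga_wedge])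
  fix S assume "S \<in> carrier (gr (wedge (A H) (B H)) n)"
  then obtain u where u: "u \<in> w.F n" and S: "S = w.coset n u" by (rule w.wedge_elementE)
  interpret h: wedge_pair_hom "A H" "B H" "A H" "B H" "mor1 H H (\<lambda>S\<in>lcosets\<^bsub>G\<^esub> H. S)" "mor2 H H (\<lambda>S\<in>lcosets\<^bsub>G\<^esub> H. S)"
    by (rule pair_hom[OF H H orbit_hom_id[OF p1.G.is_group H]])
  show "wedge_map (A H) (B H) (mor1 H H (\<lambda>S\<in>lcosets\<^bsub>G\<^esub> H. S)) (mor2 H H (\<lambda>S\<in>lcosets\<^bsub>G\<^esub> H. S)) n S = S"
    using vec_diagram_id[OF pull1_vec H] vec_diagram_id[OF pull2_vec H] w.fibre_product_closed[OF u]
    by (simp add: S h.wedge_map_coset[OF u] pull_simps)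
next
  fix H K \<phi> n assume H: "subgroup H G" "subgroup K G" "\<phi> \<in> orbit_hom G H K"
  show "wedge_map (A K) (B K) (mor1 H K \<phi>) (mor2 H K \<phi>) n \<in>
      rat_linear (gr (wedge (A H) (B H)) n) (gr (wedge (A K) (B K)) n)"
    using wedge_pair_hom.wedge_map_hom[OF pair_hom[OF H]] by (simp add: dga_hom_def)
next
  fix H K L \<phi> \<psi> n S
  assume H: "subgroup H G" and K: "subgroup K G" and L: "subgroup L G"
    and \<phi>: "\<phi> \<in> orbit_hom G H K" and \<psi>: "\<psi> \<in> orbit_hom G K L"
    and "S \<in> carrier (gr (wedge (A H) (B H)) n)"
  let ?\<chi> = "compose (lcosets\<^bsub>G\<^esub> H) \<psi> \<phi>"
  interpret hk: wedge_pair_hom "A H" "B H" "A K" "B K" "mor1 H K \<phi>" "mor2 H K \<phi>" by (rule pair_hom[OF H K \<phi>])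
  interpret kl: wedge_pair_hom "A K" "B K" "A L" "B L" "mor1 K L \<psi>" "mor2 K L \<psi>" by (rule pair_hom[OF K L \<psi>])
  interpret hl: wedge_pair_hom "A H" "B H" "A L" "B L" "mor1 H L ?\<chi>" "mor2 H L ?\<chi>"
    by (rule pair_hom[OF H L orbit_hom_compose[OF p1.G.is_group H \<phi> \<psi>]])
  obtain u where u: "u \<in> hk.W.F n" and S: "S = hk.W.coset n u"
    using \<open>S \<in> _\<close> by (rule hk.W.wedge_elementE)
  show "wedge_map (A L) (B L) (mor1 H L ?\<chi>) (mor2 H L ?\<chi>) n S =
      wedge_map (A L) (B L) (mor1 K L \<psi>) (mor2 K L \<psi>) n (wedge_map (A K) (B K) (mor1 H K \<phi>) (mor2 H K \<phi>) n S)"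
    using vec_diagram_comp[OF pull1_vec H K L \<phi> \<psi>] vec_diagram_comp[OF pull2_vec H K L \<phi> \<psi>] hk.W.fibre_product_closed[OF u]
    by (simp add: S hl.wedge_map_coset[OF u] hk.wedge_map_coset[OF u] kl.wedge_map_coset[OF hk.fibre_product_map[OF u]]
        pull_simps)
qed

lemma dga_diagram_wedge: "dga_diagram G W"
  unfolding dga_diagram_def
proof (intro conjI allI impI)
  show "vec_diagram G (underlying W)" by (rule vec_diagram_wedge)
  fix H assume H: "subgroup H G"
  interpret w: wedge_pair "A H" "B H" by (rule pair[OF H])
  show "dga (ob W H)" unfolding W_simps by (rule w.dga_wedge)
  show "cohomologically_1_connected (ob W H)"
    unfolding W_simps
    by (intro w.wedge_connected aug_dga_diagram_connected[OF U1 p1.subgroup_image[OF H]]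
        aug_dga_diagram_connected[OF U2 p2.subgroup_image[OF H]])
next
  fix H K \<phi> assume "subgroup H G" "subgroup K G" "\<phi> \<in> orbit_hom G H K"
  then show "mor W H K \<phi> \<in> dga_hom (ob W H) (ob W K)"
    unfolding W_simps by (rule wedge_pair_hom.wedge_map_hom[OF pair_hom])
qed

text \<open>The constants of the wedge are counted in \<open>to1\<close>. They are subtracted in \<open>to2\<close>, as they would otherwise
  be counted twice in \<open>from1 \<circ> to1 + from2 \<circ> to2\<close>.\<close>

definition to1 :: "'g set \<Rightarrow> nat \<Rightarrow> ('v \<times> 'w) set \<Rightarrow> 'v" where
  "to1 H n S = fst (wedge_components (A H) (B H) n S)"

definition to2 :: "'g set \<Rightarrow> nat \<Rightarrow> ('v \<times> 'w) set \<Rightarrow> 'w" where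
  "to2 H n S = (let b = snd (wedge_components (A H) (B H) n S)
     in b \<oplus>\<^bsub>gr (B H) n\<^esub> (- 1) \<odot>\<^bsub>gr (B H) n\<^esub> scalar_part (B H) (B H) n b)"

definition from1 :: "'g set \<Rightarrow> nat \<Rightarrow> 'v \<Rightarrow> ('v \<times> 'w) set" where
  "from1 H n a = wedge_coset (A H) (B H) n (a, scalar_part (A H) (B H) n a)"

definition from2 :: "'g set \<Rightarrow> nat \<Rightarrow> 'w \<Rightarrow> ('v \<times> 'w) set" where
  "from2 H n b = wedge_coset (A H) (B H) n (scalar_part (B H) (A H) n b, b)"

lemma wedge_elementE:
  assumes "subgroup H G" "S \<in> carrier (ob (underlying W) H n)"
  obtains u where "u \<in> fibre_product (A H) (B H) n" "S = wedge_coset (A H) (B H) n u"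
  using wedge_pair.wedge_elementE[OF pair[OF assms(1)]] assms(2) unfolding W_simps by blast

lemma to1_hom: "to1 \<in> vec_hom G (underlying W) pull1"
proof (rule vec_homI)
  fix H n assume H: "subgroup H G"
  interpret w: wedge_pair "A H" "B H" by (rule pair[OF H])
  show "to1 H n \<in> rat_linear (ob (underlying W) H n) (ob pull1 H n)"
    using w.fst_components_hom unfolding to1_def[abs_def] W_simps pull_simps by (simp add: dga_hom_def)
next
  fix H K \<phi> n S
  assume H: "subgroup H G" and K: "subgroup K G" and \<phi>: "\<phi> \<in> orbit_hom G H K"
    and "S \<in> carrier (ob (underlying W) H n)"
  interpret h: wedge_pair_hom "A H" "B H" "A K" "B K" "mor1 H K \<phi>" "mor2 H K \<phi>" by (rule pair_hom[OF H K \<phi>])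
  obtain u where u: "u \<in> h.W.F n" "S = h.W.coset n u"
    using wedge_elementE[OF H \<open>S \<in> _\<close>] by blast
  show "to1 K n (mor (underlying W) H K \<phi> n S) = mor pull1 H K \<phi> n (to1 H n S)"
    unfolding to1_def W_simps pull_simps
    by (simp add: u h.wedge_map_coset h.W.components_coset h.W'.components_coset h.fibre_product_map)
qed

lemma to2_hom: "to2 \<in> vec_hom G (underlying W) pull2"
proof (rule vec_homI)
  fix H n assume H: "subgroup H G"
  interpret w: wedge_pair "A H" "B H" by (rule pair[OF H])
  have b: "(\<lambda>S. snd (w.comps n S)) \<in> rat_linear (gr (wedge (A H) (B H)) n) (gr (B H) n)"
    using w.snd_components_hom by (simp add: dga_hom_def)
  show "to2 H n \<in> rat_linear (ob (underlying W) H n) (ob pull2 H n)"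
    unfolding to2_def[abs_def] Let_def W_simps pull_simps
    by (rule rat_linear_plus[OF w.B.space b rat_linear_scaled[OF w.B.space rat_linear_comp[OF b w.scBB]]])
next
  fix H K \<phi> n S
  assume H: "subgroup H G" and K: "subgroup K G" and \<phi>: "\<phi> \<in> orbit_hom G H K"
    and "S \<in> carrier (ob (underlying W) H n)"
  interpret h: wedge_pair_hom "A H" "B H" "A K" "B K" "mor1 H K \<phi>" "mor2 H K \<phi>" by (rule pair_hom[OF H K \<phi>])
  interpret Bn: rational_space "gr (B H) n" by (rule h.W.B.space)
  obtain u where u: "u \<in> h.W.F n" "S = h.W.coset n u"
    using wedge_elementE[OF H \<open>S \<in> _\<close>] by blast
  note cl = h.W.fibre_product_closed(2)[OF u(1)]
  note m = aug_dga_hom_linear[OF h.g]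
  show "to2 K n (mor (underlying W) H K \<phi> n S) = mor pull2 H K \<phi> n (to2 H n S)"
    unfolding to2_def Let_def W_simps pull_simps
    using cl rat_linear_closed[OF h.W.scBB cl]
    by (simp add: u h.wedge_map_coset h.W.components_coset h.W'.components_coset h.fibre_product_map
        rat_linear_add[OF m] rat_linear_scale[OF m]
        aug_dga_hom_scalar_part[OF h.W.B.aug_dga_axioms h.W'.B.aug_dga_axioms h.g h.g])
qed

lemma from1_in: "subgroup H G \<Longrightarrow> a \<in> carrier (gr (A H) n) \<Longrightarrow>
    (a, scalar_part (A H) (B H) n a) \<in> fibre_product (A H) (B H) n"
  and from2_in: "subgroup H G \<Longrightarrow> b \<in> carrier (gr (B H) n) \<Longrightarrow>
    (scalar_part (B H) (A H) n b, b) \<in> fibre_product (A H) (B H) n"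
proof -
  assume H: "subgroup H G"
  interpret w: wedge_pair "A H" "B H" by (rule pair[OF H])
  show "(a, scalar_part (A H) (B H) n a) \<in> fibre_product (A H) (B H) n" if "a \<in> carrier (gr (A H) n)"
    using that rat_linear_closed[OF w.scAB that]
    by (auto simp: fibre_product_def scalar_part_def w.B.aug_smult w.B.aug_unit w.B.unit_closed)
  show "(scalar_part (B H) (A H) n b, b) \<in> fibre_product (A H) (B H) n" if "b \<in> carrier (gr (B H) n)"
    using that rat_linear_closed[OF w.scBA that]
    by (auto simp: fibre_product_def scalar_part_def w.A.aug_smult w.A.aug_unit w.A.unit_closed)
qed

lemma from1_hom: "from1 \<in> vec_hom G pull1 (underlying W)"
proof (rule vec_homI)
  fix H n assume H: "subgroup H G"
  interpret w: wedge_pair "A H" "B H" by (rule pair[OF H])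
  note i = from1_in[OF H]
  show "from1 H n \<in> rat_linear (ob pull1 H n) (ob (underlying W) H n)"
    unfolding from1_def[abs_def] W_simps pull_simps
    by (rule rat_linearI)
      (simp_all add: w.wedge_carrier i w.wedge_add[OF i i] w.wedge_scale[OF i]
        rat_linear_add[OF w.scAB] rat_linear_scale[OF w.scAB])
next
  fix H K \<phi> n a
  assume H: "subgroup H G" and K: "subgroup K G" and \<phi>: "\<phi> \<in> orbit_hom G H K"
    and a: "a \<in> carrier (ob pull1 H n)"
  interpret h: wedge_pair_hom "A H" "B H" "A K" "B K" "mor1 H K \<phi>" "mor2 H K \<phi>" by (rule pair_hom[OF H K \<phi>])
  show "from1 K n (mor pull1 H K \<phi> n a) = mor (underlying W) H K \<phi> n (from1 H n a)"
    using a unfolding from1_def W_simps pull_simps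
    by (simp add: h.wedge_map_coset[OF from1_in[OF H]]
        aug_dga_hom_scalar_part[OF h.W.B.aug_dga_axioms h.W'.B.aug_dga_axioms h.g h.f])
qed

lemma from2_hom: "from2 \<in> vec_hom G pull2 (underlying W)"
proof (rule vec_homI)
  fix H n assume H: "subgroup H G"
  interpret w: wedge_pair "A H" "B H" by (rule pair[OF H])
  note i = from2_in[OF H]
  show "from2 H n \<in> rat_linear (ob pull2 H n) (ob (underlying W) H n)"
    unfolding from2_def[abs_def] W_simps pull_simps
    by (rule rat_linearI)
      (simp_all add: w.wedge_carrier i w.wedge_add[OF i i] w.wedge_scale[OF i]
        rat_linear_add[OF w.scBA] rat_linear_scale[OF w.scBA])
next
  fix H K \<phi> n b
  assume H: "subgroup H G" and K: "subgroup K G" and \<phi>: "\<phi> \<in> orbit_hom G H K"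
    and b: "b \<in> carrier (ob pull2 H n)"
  interpret h: wedge_pair_hom "A H" "B H" "A K" "B K" "mor1 H K \<phi>" "mor2 H K \<phi>" by (rule pair_hom[OF H K \<phi>])
  show "from2 K n (mor pull2 H K \<phi> n b) = mor (underlying W) H K \<phi> n (from2 H n b)"
    using b unfolding from2_def W_simps pull_simps
    by (simp add: h.wedge_map_coset[OF from2_in[OF H]]
        aug_dga_hom_scalar_part[OF h.W.A.aug_dga_axioms h.W'.A.aug_dga_axioms h.f h.g])
qed

lemma vec_injective_wedge:
  assumes "vec_injective TYPE('y) C1 (underlying U1)" "vec_injective TYPE('y) C2 (underlying U2)"
  shows "vec_injective TYPE('y) G (underlying W)"
proof (rule vec_injective_retract_of_two[OF vec_diagram_wedge p1.vec_injective_pullback[OF assms(1)]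
      p2.vec_injective_pullback[OF assms(2)] to1_hom to2_hom from1_hom from2_hom])
  fix H n S assume H: "subgroup H G" and "S \<in> carrier (ob (underlying W) H n)"
  interpret w: wedge_pair "A H" "B H" by (rule pair[OF H])
  interpret An: rational_space "gr (A H) n" by (rule w.A.space)
  interpret Bn: rational_space "gr (B H) n" by (rule w.B.space)
  obtain u where u: "u \<in> w.F n" "S = w.coset n u"
    using wedge_elementE[OF H \<open>S \<in> _\<close>] by blast
  define a b where "a = fst u" and "b = snd u"
  have ab: "a \<in> carrier (gr (A H) n)" "b \<in> carrier (gr (B H) n)"
    using w.fibre_product_closed[OF u(1)] by (simp_all add: a_def b_def)
  define c where "c = b \<oplus>\<^bsub>gr (B H) n\<^esub> (- 1) \<odot>\<^bsub>gr (B H) n\<^esub> scalar_part (B H) (B H) n b"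
  note bb = rat_linear_closed[OF w.scBB ab(2)] and ba = rat_linear_closed[OF w.scBA ab(2)]
  have c: "c \<in> carrier (gr (B H) n)" using ab bb by (simp add: c_def)
  have t1: "to1 H n S = a" and t2: "to2 H n S = c"
    by (simp_all add: to1_def to2_def Let_def u w.components_coset a_def b_def c_def)
  have "scalar_part (B H) (A H) n c = \<zero>\<^bsub>gr (A H) n\<^esub>"
    using ab bb ba unfolding c_def
    by (simp add: rat_linear_add[OF w.scBA] rat_linear_scale[OF w.scBA] An.add_neg_scale
        scalar_part_scalar_part[OF w.B.aug_dga_axioms])
  moreover have "scalar_part (A H) (B H) n a = scalar_part (B H) (B H) n b"
    using w.scalar_part_fibre_product[OF u(1)] by (simp add: a_def b_def)
  then have "scalar_part (A H) (B H) n a \<oplus>\<^bsub>gr (B H) n\<^esub> c = b"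
    using ab bb unfolding c_def by (simp add: Bn.M.a_lcomm Bn.add_neg_scale)
  ultimately show "from1 H n (to1 H n S) \<oplus>\<^bsub>ob (underlying W) H n\<^esub> from2 H n (to2 H n S) = S"
    unfolding t1 t2 from1_def from2_def W_simps
    using w.wedge_add[OF from1_in[OF H ab(1)] from2_in[OF H c]] ab by (simp add: u a_def b_def)
qed

end

theorem proposition4p3:
  fixes p q :: nat
    and Cp :: "('a, 'm) monoid_scheme"
    and Cq :: "('b, 'n) monoid_scheme"
    and Cpq :: "('g, 'l) monoid_scheme"
    and \<theta> :: "'g \<Rightarrow> 'a \<times> 'b"
    and U1 :: "('a, 'v aug_dga, 'v) diagram"
    and U2 :: "('b, 'w aug_dga, 'w) diagram"
  assumes "prime p" and "prime q" and "p \<noteq> q"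
    and "group Cp" and "cyclic_group Cp" and "order Cp = p"
    and "group Cq" and "cyclic_group Cq" and "order Cq = q"
    and "group Cpq" and "cyclic_group Cpq" and "order Cpq = p * q"
    and "\<theta> \<in> iso Cpq (Cp \<times>\<times> Cq)"
    and "aug_dga_diagram Cp U1" and "aug_dga_diagram Cq U2"
    and "infinite (UNIV :: 'x set)"
    and "vec_injective TYPE('x) Cp (underlying U1)"
    and "vec_injective TYPE('x) Cq (underlying U2)"
  shows "dga_diagram Cpq (wedge_diagram Cp Cq \<theta> U1 U2) \<and>
         vec_injective TYPE('y) Cpq (underlying (wedge_diagram Cp Cq \<theta> U1 U2))"
proof -
  have comm: "comm_group Cp" "comm_group Cq"
    using group.cyclic_imp_abelian_group assms(4,5,7,8) by auto
  have "\<theta> \<in> hom Cpq (Cp \<times>\<times> Cq)" and img: "\<theta> ` carrier Cpq = carrier Cp \<times> carrier Cq"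
    using assms(13) by (auto simp: iso_def bij_betw_def)
  then have hom: "fst \<circ> \<theta> \<in> hom Cpq Cp" "snd \<circ> \<theta> \<in> hom Cpq Cq"
    unfolding hom_def DirProd_def by (auto simp: Pi_iff split_beta)
  have ne: "carrier Cp \<noteq> {}" "carrier Cq \<noteq> {}"
    using assms(4,7) group.is_monoid monoid.one_closed by blast+
  have surj: "(fst \<circ> \<theta>) ` carrier Cpq = carrier Cp" "(snd \<circ> \<theta>) ` carrier Cpq = carrier Cq"
    unfolding image_comp[symmetric] img using ne by auto
  interpret wedge_of_diagrams Cpq Cp Cq "fst \<circ> \<theta>" "snd \<circ> \<theta>" \<theta> U1 U2
    using assms comm hom surj
    by (intro wedge_of_diagrams.intro wedge_of_diagrams_axioms.intro abelian_surjection.intro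
        abelian_surjection_axioms.intro refl)
  have "vec_injective TYPE('y) Cp (underlying U1)" "vec_injective TYPE('y) Cq (underlying U2)"
    using vec_injective_change_of_type[OF comm(1) _ assms(16,17)] vec_injective_change_of_type[OF comm(2) _ assms(16,18)]
      assms(1,2,6,9) by auto
  then show ?thesis using dga_diagram_wedge vec_injective_wedge by blast
qed

end
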